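(* Let $A,B,C$ be finite-dimensional complex vector spaces and let $W_A\subset B\otimes C$, $W_B\subset A\otimes C$, $W_C\subset A\otimes B$ be linear subspaces. Then there exist a finite-dimensional complex vector space $V$ with a basis $\Sigma$ and three linear subspaces $$\mathcal{M}_A\subset (B\otimes V)\otimes(C\otimes V),\quad \mathcal{M}_B\subset (A\otimes V)\otimes(C\otimes V),\quad \mathcal{M}_C\subset (A\otimes V)\otimes(B\otimes V),$$ of dimensions $\mathbf{m}_A,\mathbf{m}_B,\mathbf{m}_C$ respectively, such that: (1) $\mathcal{M}_A$, $\mathcal{M}_B$, $\mathcal{M}_C$ are spanned by rank one tensors (of order 2, with respect to the displayed two factors); (2) $W_A^{\Sigma}\subset\mathcal{M}_A$, $W_B^{\Sigma}\subset\mathcal{M}_B$, $W_C^{\Sigma}\subset\mathcal{M}_C$; (3) for every tensor $T\in A\otimes B\otimes C$, the $\Sigma$-clone $T^{\Sigma}\in(A\otimes V)\otimes(B\otimes V)\otimes(C\otimes V)$ satisfies $$\min\mathbf{R}\bigl(T^{\Sigma}\bmod(\mathcal{M}_A,\mathcal{M}_B,\mathcal{M}_C)\bigr)=\min\mathbf{R}\bigl(T\bmod(W_A,W_B,W_C)\bigr),$$ and, in particular, the rank of the augmented tensor $$T^{\Sigma}+T_{\mathcal{M}_A}+T_{\mathcal{M}_B}+T_{\mathcal{M}_C}\in\bigl((A\otimes V)\oplus\mathbb{C}^{\mathbf{m}_A}\bigr)\otimes\bigl((B\otimes V)\oplus\mathbb{C}^{\mathbf{m}_B}\bigr)\otimes\bigl((C\otimes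 V)\oplus\mathbb{C}^{\mathbf{m}_C}\bigr)$$ is given by $$\mathbf{R}(T^{\Sigma}+T_{\mathcal{M}_A}+T_{\mathcal{M}_B}+T_{\mathcal{M}_C})=\min\mathbf{R}\bigl(T\bmod(W_A,W_B,W_C)\bigr)+\mathbf{m}_A+\mathbf{m}_B+\mathbf{m}_C.$$
   Context: All vector spaces are finite-dimensional over $\mathbb{C}$. $\mathbf{R}(T)$ denotes tensor rank: the minimum number of simple tensors $a\otimes b\otimes c$ summing to $T$. Modifications: for $T\in A\otimes B\otimes C$ and subspaces $W_A\subset B\otimes C$, $W_B\subset A\otimes C$, $W_C\subset A\otimes B$, the set $T\bmod(W_A,W_B,W_C)$ consists of all tensors $T+\sum_i a_i\otimes u_i+\sum_j b_j\otimes v_j+\sum_k w_k\otimes c_k$ (finite sums) with $a_i\in A$, $u_i\in W_A$, $b_j\in B$, $v_j\in W_B$, $c_k\in C$, $w_k\in W_C$, where all summands are reordered to lie in $A\otimes B\otimes C$. $\min\mathbf{R}(T\bmod(W_A,W_B,W_C))$ is the smallest rank of an element of this set. The same definition is applied to the spaces $A\otimes V,B\otimes V,C\otimes V$ and $\mathcal{M}_A,\mathcal{M}_B,\mathcal{M}_C$. Clones: for a basis $\Sigma=\{v_1,\dots,v_n\}$ of $V$ put $S_\Sigma=v_1+\cdots+v_n$. The $\Sigma$-clone of $T\in A_1\otimes\cdots\otimes A_d$ is the Kronecker product $T^\Sigma=T\boxtimes S_\Sigma^{\otimes d}\in(A_1\otimes V)\otimes\cdots\otimes(A_d\otimes V)$,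 i.e. the linear extension of $a_1\otimes\cdots\otimes a_d\mapsto(a_1\otimes S_\Sigma)\otimes\cdots\otimes(a_d\otimes S_\Sigma)$. Corresponding tensor: for a subspace $U\subset B\otimes C$ of dimension $u$ with basis $u_1,\dots,u_u$, $T_U=\sum_{j=1}^{u}e_j\otimes u_j\in\mathbb{C}^{u}\otimes B\otimes C$, where $e_1,\dots,e_u$ is the canonical basis of $\mathbb{C}^u$; analogously for subspaces of $A\otimes C$ and $A\otimes B$, with $\mathbb{C}^{u}$ placed in the second, respectively third, position. The choice of basis does not affect ranks. The $\Sigma$-clone of $U\subset B\otimes C$ is the subspace $U^\Sigma=T_U^\Sigma\bigl((\mathbb{C}^u\otimes V)^*\bigr)\subset(B\otimes V)\otimes(C\otimes V)$, the image of the flattening of $T_U^\Sigma$ (it equals the set of $\Sigma$-clones of elements of $U$); similarly for subspaces of $A\otimes C$ and $A\otimes B$. In the augmented tensor, all four summands are regarded as elements of the displayed tensor product of direct sums via the natural inclusions. *)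

theory Defs
  imports Complex_Main "HOL-Library.Function_Algebras"
begin

text \<open>
  A finite-dimensional complex vector space is a finite-dimensional subspace of a space
  \<open>'i \<Rightarrow> complex\<close> of functions (\<open>'i\<close> arbitrary); up to isomorphism every such space arises in
  this way.  Tensors are functions on tuples of indices, the simple tensor of \<open>a, b, c\<close> being
  \<open>(i, j, k) \<mapsto> a i * b j * c k\<close>.  Since \<open>f \<otimes> g \<mapsto> ((i, j) \<mapsto> f i * g j)\<close> is injective on the
  algebraic tensor product of function spaces, the span of the simple tensors is the tensor
  product of the given subspaces.
\<close>

definition cscale :: "complex \<Rightarrow> ('i \<Rightarrow> complex) \<Rightarrow> 'i \<Rightarrow> complex" where
  "cscale r f = (\<lambda>i. r * f i)"

global_interpretation cfun: vector_space cscale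
  by unfold_locales (auto simp: cscale_def fun_eq_iff algebra_simps)

definition fin_dim_space :: "('i \<Rightarrow> complex) set \<Rightarrow> bool" where
  "fin_dim_space X \<longleftrightarrow> (\<exists>B. finite B \<and> cfun.span B = X)"

definition is_basis_list :: "('i \<Rightarrow> complex) list \<Rightarrow> ('i \<Rightarrow> complex) set \<Rightarrow> bool" where
  "is_basis_list us U \<longleftrightarrow> distinct us \<and> cfun.independent (set us) \<and> cfun.span (set us) = U"

subsection \<open>Tensor products and rank\<close>

definition tensor2 :: "('i \<Rightarrow> complex) \<Rightarrow> ('j \<Rightarrow> complex) \<Rightarrow> 'i \<times> 'j \<Rightarrow> complex" where
  "tensor2 a b = (\<lambda>(i, j). a i * b j)"

definition tensor3 ::
  "('i \<Rightarrow> complex) \<Rightarrow> ('j \<Rightarrow> complex) \<Rightarrow> ('k \<Rightarrow> complex) \<Rightarrow> 'i \<times> 'j \<times> 'k \<Rightarrow> complex" where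
  "tensor3 a b c = (\<lambda>(i, j, k). a i * b j * c k)"

definition tprod2 ::
  "('i \<Rightarrow> complex) set \<Rightarrow> ('j \<Rightarrow> complex) set \<Rightarrow> ('i \<times> 'j \<Rightarrow> complex) set" where
  "tprod2 X Y = cfun.span {tensor2 x y | x y. x \<in> X \<and> y \<in> Y}"

definition tprod3 ::
  "('i \<Rightarrow> complex) set \<Rightarrow> ('j \<Rightarrow> complex) set \<Rightarrow> ('k \<Rightarrow> complex) set
    \<Rightarrow> ('i \<times> 'j \<times> 'k \<Rightarrow> complex) set" where
  "tprod3 X Y Z = cfun.span {tensor3 x y z | x y z. x \<in> X \<and> y \<in> Y \<and> z \<in> Z}"

text \<open>The rank of \<open>T\<close> as an element of \<open>X \<otimes> Y \<otimes> Z\<close>; meaningful for \<open>T \<in> tprod3 X Y Z\<close>.\<close>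

definition tensor_rank ::
  "('i \<Rightarrow> complex) set \<Rightarrow> ('j \<Rightarrow> complex) set \<Rightarrow> ('k \<Rightarrow> complex) set
    \<Rightarrow> ('i \<times> 'j \<times> 'k \<Rightarrow> complex) \<Rightarrow> nat" where
  "tensor_rank X Y Z T =
    (LEAST r. \<exists>a b c. (\<forall>l<r. a l \<in> X \<and> b l \<in> Y \<and> c l \<in> Z)
                    \<and> T = (\<Sum>l<r. tensor3 (a l) (b l) (c l)))"

definition rank_one_tensors ::
  "('i \<Rightarrow> complex) set \<Rightarrow> ('j \<Rightarrow> complex) set \<Rightarrow> ('i \<times> 'j \<Rightarrow> complex) set" where
  "rank_one_tensors X Y = {tensor2 x y | x y. x \<in> X \<and> y \<in> Y \<and> x \<noteq> 0 \<and> y \<noteq> 0}"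

definition spanned_by_rank_one ::
  "('i \<Rightarrow> complex) set \<Rightarrow> ('j \<Rightarrow> complex) set \<Rightarrow> ('i \<times> 'j \<Rightarrow> complex) set \<Rightarrow> bool" where
  "spanned_by_rank_one X Y M \<longleftrightarrow> (\<exists>R \<subseteq> rank_one_tensors X Y. cfun.span R = M)"

subsection \<open>Modifications\<close>

text \<open>The tensor product of a vector and an order-2 tensor, reordered so that the vector sits in
  position 1, 2 and 3 respectively.\<close>

definition ins1 ::
  "('i \<Rightarrow> complex) \<Rightarrow> ('j \<times> 'k \<Rightarrow> complex) \<Rightarrow> 'i \<times> 'j \<times> 'k \<Rightarrow> complex" where
  "ins1 a u = (\<lambda>(i, j, k). a i * u (j, k))"

definition ins2 ::
  "('j \<Rightarrow> complex) \<Rightarrow> ('i \<times> 'k \<Rightarrow> complex) \<Rightarrow> 'i \<times> 'j \<times> 'k \<Rightarrow> complex" where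
  "ins2 b v = (\<lambda>(i, j, k). b j * v (i, k))"

definition ins3 ::
  "('k \<Rightarrow> complex) \<Rightarrow> ('i \<times> 'j \<Rightarrow> complex) \<Rightarrow> 'i \<times> 'j \<times> 'k \<Rightarrow> complex" where
  "ins3 c w = (\<lambda>(i, j, k). w (i, j) * c k)"

definition modifications ::
  "('i \<Rightarrow> complex) set \<Rightarrow> ('j \<Rightarrow> complex) set \<Rightarrow> ('k \<Rightarrow> complex) set
    \<Rightarrow> ('i \<times> 'j \<times> 'k \<Rightarrow> complex)
    \<Rightarrow> ('j \<times> 'k \<Rightarrow> complex) set \<Rightarrow> ('i \<times> 'k \<Rightarrow> complex) set \<Rightarrow> ('i \<times> 'j \<Rightarrow> complex) set
    \<Rightarrow> ('i \<times> 'j \<times> 'k \<Rightarrow> complex) set" where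
  "modifications X Y Z T WX WY WZ =
    {T + (\<Sum>l<p. ins1 (a l) (u l)) + (\<Sum>l<q. ins2 (b l) (v l)) + (\<Sum>l<r. ins3 (c l) (w l))
      | (p::nat) (q::nat) (r::nat) a u b v c w.
        (\<forall>l<p. a l \<in> X \<and> u l \<in> WX) \<and> (\<forall>l<q. b l \<in> Y \<and> v l \<in> WY) \<and>
        (\<forall>l<r. c l \<in> Z \<and> w l \<in> WZ)}"

definition min_rank_mod ::
  "('i \<Rightarrow> complex) set \<Rightarrow> ('j \<Rightarrow> complex) set \<Rightarrow> ('k \<Rightarrow> complex) set
    \<Rightarrow> ('i \<times> 'j \<times> 'k \<Rightarrow> complex)
    \<Rightarrow> ('j \<times> 'k \<Rightarrow> complex) set \<Rightarrow> ('i \<times> 'k \<Rightarrow> complex) set \<Rightarrow> ('i \<times> 'j \<Rightarrow> complex) set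
    \<Rightarrow> nat" where
  "min_rank_mod X Y Z T WX WY WZ =
    (LEAST r. \<exists>T' \<in> modifications X Y Z T WX WY WZ. tensor_rank X Y Z T' = r)"

subsection \<open>Corresponding tensors\<close>

definition unit_vec :: "nat \<Rightarrow> nat \<Rightarrow> complex" where
  "unit_vec j = (\<lambda>i. if i = j then 1 else 0)"

definition coord_space :: "nat \<Rightarrow> (nat \<Rightarrow> complex) set" where
  "coord_space m = {f. \<forall>i\<ge>m. f i = 0}"

text \<open>The tensor corresponding to a subspace, computed from a basis \<open>us\<close> of it, with the
  coordinate space \<open>coord_space (length us)\<close> in position 1, 2 and 3 respectively.\<close>

definition corr1 :: "('j \<times> 'k \<Rightarrow> complex) list \<Rightarrow> nat \<times> 'j \<times> 'k \<Rightarrow> complex" where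
  "corr1 us = (\<Sum>j<length us. ins1 (unit_vec j) (us ! j))"

definition corr2 :: "('i \<times> 'k \<Rightarrow> complex) list \<Rightarrow> 'i \<times> nat \<times> 'k \<Rightarrow> complex" where
  "corr2 us = (\<Sum>j<length us. ins2 (unit_vec j) (us ! j))"

definition corr3 :: "('i \<times> 'j \<Rightarrow> complex) list \<Rightarrow> 'i \<times> 'j \<times> nat \<Rightarrow> complex" where
  "corr3 us = (\<Sum>j<length us. ins3 (unit_vec j) (us ! j))"

subsection \<open>Clones\<close>

text \<open>The Kronecker product with \<open>S \<otimes> S \<otimes> S\<close>, where \<open>S\<close> is the sum of the elements of the
  basis \<open>\<Sigma>\<close>; see \<open>clone3_tensor3\<close> below for its effect on simple tensors.\<close>

definition clone3 ::
  "('v \<Rightarrow> complex) set \<Rightarrow> ('i \<times> 'j \<times> 'k \<Rightarrow> complex)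
    \<Rightarrow> ('i \<times> 'v) \<times> ('j \<times> 'v) \<times> ('k \<times> 'v) \<Rightarrow> complex" where
  "clone3 \<Sigma> T = (let S = \<Sum>\<Sigma> in (\<lambda>((i, x), (j, y), (k, z)). T (i, j, k) * (S x * S y * S z)))"

definition clone2 ::
  "('v \<Rightarrow> complex) set \<Rightarrow> ('i \<times> 'j \<Rightarrow> complex) \<Rightarrow> ('i \<times> 'v) \<times> ('j \<times> 'v) \<Rightarrow> complex" where
  "clone2 \<Sigma> u = (let S = \<Sum>\<Sigma> in (\<lambda>((i, x), (j, y)). u (i, j) * (S x * S y)))"

text \<open>Image of the flattening of a tensor with one distinguished factor: contraction of that
  factor with all linear functionals.  Functionals on the whole function space suffice, as every
  functional on a subspace extends.\<close>

definition flattening_image :: "('x \<Rightarrow> 'p \<Rightarrow> complex) \<Rightarrow> ('p \<Rightarrow> complex) set" where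
  "flattening_image F = {\<lambda>p. \<phi> (\<lambda>x. F x p) | \<phi>. Vector_Spaces.linear cscale (*) \<phi>}"

text \<open>The \<open>\<Sigma>\<close>-clone of a subspace; it does not depend on the chosen basis, by
  \<open>flattening_clone_corr1\<close> etc. below.\<close>

definition clone_space1 ::
  "('v \<Rightarrow> complex) set \<Rightarrow> ('j \<times> 'k \<Rightarrow> complex) set
    \<Rightarrow> (('j \<times> 'v) \<times> ('k \<times> 'v) \<Rightarrow> complex) set" where
  "clone_space1 \<Sigma> U = (let T = clone3 \<Sigma> (corr1 (SOME us. is_basis_list us U))
     in flattening_image (\<lambda>x (y, z). T (x, y, z)))"

definition clone_space2 ::
  "('v \<Rightarrow> complex) set \<Rightarrow> ('i \<times> 'k \<Rightarrow> complex) set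
    \<Rightarrow> (('i \<times> 'v) \<times> ('k \<times> 'v) \<Rightarrow> complex) set" where
  "clone_space2 \<Sigma> U = (let T = clone3 \<Sigma> (corr2 (SOME us. is_basis_list us U))
     in flattening_image (\<lambda>y (x, z). T (x, y, z)))"

definition clone_space3 ::
  "('v \<Rightarrow> complex) set \<Rightarrow> ('i \<times> 'j \<Rightarrow> complex) set
    \<Rightarrow> (('i \<times> 'v) \<times> ('j \<times> 'v) \<Rightarrow> complex) set" where
  "clone_space3 \<Sigma> U = (let T = clone3 \<Sigma> (corr3 (SOME us. is_basis_list us U))
     in flattening_image (\<lambda>z (x, y). T (x, y, z)))"

subsection \<open>Direct sums and the augmented tensor\<close>

definition dsum ::
  "('i \<Rightarrow> complex) set \<Rightarrow> ('j \<Rightarrow> complex) set \<Rightarrow> ('i + 'j \<Rightarrow> complex) set" where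
  "dsum X Y = {case_sum x y | x y. x \<in> X \<and> y \<in> Y}"

text \<open>The natural inclusions into \<open>(X \<oplus> X') \<otimes> (Y \<oplus> Y') \<otimes> (Z \<oplus> Z')\<close> of
  \<open>X \<otimes> Y \<otimes> Z\<close>, \<open>X' \<otimes> Y \<otimes> Z\<close>, \<open>X \<otimes> Y' \<otimes> Z\<close> and \<open>X \<otimes> Y \<otimes> Z'\<close>.\<close>

definition incl0 ::
  "('i \<times> 'j \<times> 'k \<Rightarrow> complex) \<Rightarrow> ('i + 'l) \<times> ('j + 'm) \<times> ('k + 'n) \<Rightarrow> complex" where
  "incl0 T = (\<lambda>p. case p of (Inl i, Inl j, Inl k) \<Rightarrow> T (i, j, k) | _ \<Rightarrow> 0)"

definition incl1 ::
  "('l \<times> 'j \<times> 'k \<Rightarrow> complex) \<Rightarrow> ('i + 'l) \<times> ('j + 'm) \<times> ('k + 'n) \<Rightarrow> complex" where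
  "incl1 T = (\<lambda>p. case p of (Inr l, Inl j, Inl k) \<Rightarrow> T (l, j, k) | _ \<Rightarrow> 0)"

definition incl2 ::
  "('i \<times> 'm \<times> 'k \<Rightarrow> complex) \<Rightarrow> ('i + 'l) \<times> ('j + 'm) \<times> ('k + 'n) \<Rightarrow> complex" where
  "incl2 T = (\<lambda>p. case p of (Inl i, Inr m, Inl k) \<Rightarrow> T (i, m, k) | _ \<Rightarrow> 0)"

definition incl3 ::
  "('i \<times> 'j \<times> 'n \<Rightarrow> complex) \<Rightarrow> ('i + 'l) \<times> ('j + 'm) \<times> ('k + 'n) \<Rightarrow> complex" where
  "incl3 T = (\<lambda>p. case p of (Inl i, Inl j, Inr n) \<Rightarrow> T (i, j, n) | _ \<Rightarrow> 0)"

text \<open>\<open>T + T\<^sub>1 + T\<^sub>2 + T\<^sub>3\<close>, where the \<open>T\<^sub>i\<close> correspond to the spaces with bases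
  \<open>us, vs, ws\<close>.\<close>

definition augmented ::
  "('i \<times> 'j \<times> 'k \<Rightarrow> complex) \<Rightarrow> ('j \<times> 'k \<Rightarrow> complex) list \<Rightarrow> ('i \<times> 'k \<Rightarrow> complex) list
    \<Rightarrow> ('i \<times> 'j \<Rightarrow> complex) list \<Rightarrow> ('i + nat) \<times> ('j + nat) \<times> ('k + nat) \<Rightarrow> complex" where
  "augmented T us vs ws =
    incl0 T + incl1 (corr1 us) + incl2 (corr2 vs) + incl3 (corr3 ws)"

subsection \<open>Sanity checks\<close>

lemma clone3_tensor3:
  "clone3 \<Sigma> (tensor3 a b c) = tensor3 (tensor2 a (\<Sum>\<Sigma>)) (tensor2 b (\<Sum>\<Sigma>)) (tensor2 c (\<Sum>\<Sigma>))"
  by (auto simp: clone3_def tensor3_def tensor2_def fun_eq_iff Let_def)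

lemma clone3_add: "clone3 \<Sigma> (T + T') = clone3 \<Sigma> T + clone3 \<Sigma> T'"
  by (auto simp: clone3_def fun_eq_iff Let_def algebra_simps)

lemma clone3_cscale: "clone3 \<Sigma> (cscale r T) = cscale r (clone3 \<Sigma> T)"
  by (auto simp: clone3_def cscale_def fun_eq_iff Let_def)

lemma sum_fun_apply: "(\<Sum>l\<in>I. f l) x = (\<Sum>l\<in>I. (f l x :: complex))"
  by (induction I rule: infinite_finite_induct) auto

lemma basis_list_span:
  assumes "is_basis_list us U"
  shows "U = {\<Sum>l<length us. cscale (r l) (us ! l) | r. True}"
proof -
  have d: "distinct us" and U: "U = cfun.span (set us)"
    using assms by (auto simp: is_basis_list_def)
  have inj: "inj_on ((!) us) {..<length us}"
    using d by (auto simp: inj_on_def nth_eq_iff_index_eq)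
  have im: "(!) us ` {..<length us} = set us"
    by (auto simp: set_conv_nth)
  have "U = {\<Sum>v\<in>set us. cscale (r v) v | r. True}"
    unfolding U by (subst cfun.span_finite) auto
  also have "\<dots> = {\<Sum>l<length us. cscale (r (us ! l)) (us ! l) | r. True}"
    using inj by (simp add: sum.reindex im[symmetric])
  also have "\<dots> = {\<Sum>l<length us. cscale (r l) (us ! l) | r. True}"
  proof -
    have "\<exists>r'. (\<Sum>l<length us. cscale (r l) (us ! l))
             = (\<Sum>l<length us. cscale (r' (us ! l)) (us ! l))" for r
      by (rule exI[of _ "\<lambda>v. r (inv_into {..<length us} ((!) us) v)"])
        (auto intro!: sum.cong simp: inv_into_f_f[OF inj])
    then show ?thesis by auto
  qed
  finally show ?thesis .
qed

lemma flattening_aux: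
  fixes us :: "('j \<times> 'k \<Rightarrow> complex) list" and S :: "'v \<Rightarrow> complex"
  assumes "is_basis_list us U"
  shows "flattening_image (\<lambda>(m, x) ((j, y), (k, z)).
           (\<Sum>l<length us. unit_vec l m * (us ! l) (j, k)) * (S x * S y * S z))
       = (\<lambda>u ((j, y), (k, z)). u (j, k) * (S y * S z)) ` U" (is "flattening_image ?F = ?c ` U")
proof (intro equalityI subsetI)
  fix t assume "t \<in> flattening_image ?F"
  then obtain \<phi> where lin: "Vector_Spaces.linear cscale (*) \<phi>" and t: "t = (\<lambda>p. \<phi> (\<lambda>x. ?F x p))"
    by (auto simp: flattening_image_def)
  interpret lin: Vector_Spaces.linear cscale "(*)" \<phi> by (rule lin)
  have *: "(\<lambda>x. ?F x ((j, y), (k, z)))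
      = (\<Sum>l<length us. cscale ((us ! l) (j, k) * (S y * S z)) (tensor2 (unit_vec l) S))" for j y k z
    by (auto simp: fun_eq_iff sum_fun_apply cscale_def tensor2_def sum_distrib_right
        intro!: sum.cong)
  have "t ((j, y), (k, z))
      = ?c (\<Sum>l<length us. cscale (\<phi> (tensor2 (unit_vec l) S)) (us ! l)) ((j, y), (k, z))" for j y k z
  proof -
    have "t ((j, y), (k, z))
        = \<phi> (\<Sum>l<length us. cscale ((us ! l) (j, k) * (S y * S z)) (tensor2 (unit_vec l) S))"
      unfolding t by (simp only: *)
    also have "\<dots> = (\<Sum>l<length us. (us ! l) (j, k) * (S y * S z) * \<phi> (tensor2 (unit_vec l) S))"
      by (simp only: lin.sum lin.scale)
    also have "\<dots> = ?c (\<Sum>l<length us. cscale (\<phi> (tensor2 (unit_vec l) S)) (us ! l)) ((j, y), (k, z))"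
      unfolding prod.case sum_fun_apply sum_distrib_right
      by (rule sum.cong) (simp_all add: cscale_def)
    finally show ?thesis .
  qed
  then have "t = ?c (\<Sum>l<length us. cscale (\<phi> (tensor2 (unit_vec l) S)) (us ! l))"
    by (auto simp: fun_eq_iff)
  moreover have "(\<Sum>l<length us. cscale (\<phi> (tensor2 (unit_vec l) S)) (us ! l)) \<in> U"
    unfolding basis_list_span[OF assms] by (intro CollectI exI conjI TrueI) (rule refl)
  ultimately show "t \<in> ?c ` U" by (rule image_eqI)
next
  fix t assume "t \<in> ?c ` U"
  then obtain u where u: "u \<in> U" and tu: "t = ?c u" by (rule imageE)
  obtain r where r: "u = (\<Sum>l<length us. cscale (r l) (us ! l))"
    using u unfolding basis_list_span[OF assms] by (elim CollectE exE conjE)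
  have t: "t = ?c (\<Sum>l<length us. cscale (r l) (us ! l))"
    unfolding tu r ..
  show "t \<in> flattening_image ?F"
  proof (cases "S = 0")
    case True
    have "Vector_Spaces.linear cscale (*) (\<lambda>_ :: nat \<times> 'v \<Rightarrow> complex. 0 :: complex)"
      by unfold_locales (simp_all add: algebra_simps)
    moreover have "t = (\<lambda>_. 0)"
      unfolding tu True by (auto simp: fun_eq_iff)
    ultimately show ?thesis
      unfolding flattening_image_def using True
      by (intro CollectI exI[of _ "\<lambda>_. 0"] conjI) simp_all
  next
    case False
    then obtain p where p: "S p \<noteq> 0" by (auto simp: fun_eq_iff)
    define \<phi> where "\<phi> f = (\<Sum>l<length us. r l * f (l, p)) / S p" for f :: "nat \<times> 'v \<Rightarrow> complex"
    have "Vector_Spaces.linear cscale (*) \<phi>"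
      by unfold_locales
        (simp_all add: \<phi>_def cscale_def algebra_simps sum.distrib sum_distrib_left
          add_divide_distrib)
    moreover have "t = (\<lambda>p. \<phi> (\<lambda>x. ?F x p))"
    proof -
      have "(\<Sum>l<length us. unit_vec l m * (us ! l) (j, k)) = (us ! m) (j, k)"
        if "m < length us" for m j k
      proof -
        have "(\<Sum>l<length us. unit_vec l m * (us ! l) (j, k))
            = (\<Sum>l<length us. if m = l then (us ! l) (j, k) else 0)"
          by (rule sum.cong) (auto simp: unit_vec_def)
        then show ?thesis using that by simp
      qed
      then have "\<phi> (\<lambda>x. ?F x ((j, y), (k, z))) = t ((j, y), (k, z))" for j y k z
        unfolding t \<phi>_def prod.case sum_fun_apply sum_distrib_right sum_divide_distrib
        using p by (intro sum.cong) (simp_all add: cscale_def flip: sum_distrib_right)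
      then show ?thesis by (auto simp: fun_eq_iff)
    qed
    ultimately show ?thesis
      unfolding flattening_image_def by (intro CollectI exI[of _ \<phi>] conjI)
  qed
qed

lemma flattening_clone_corr1:
  assumes "is_basis_list us U"
  shows "flattening_image (\<lambda>x (y, z). clone3 \<Sigma> (corr1 us) (x, y, z)) = clone2 \<Sigma> ` U"
  using flattening_aux[OF assms, of "\<Sum>\<Sigma>"]
  by (simp add: clone3_def clone2_def[abs_def] corr1_def ins1_def sum_fun_apply Let_def
      case_prod_unfold)

lemma flattening_clone_corr2:
  assumes "is_basis_list us U"
  shows "flattening_image (\<lambda>y (x, z). clone3 \<Sigma> (corr2 us) (x, y, z)) = clone2 \<Sigma> ` U"
  using flattening_aux[OF assms, of "\<Sum>\<Sigma>"]
  by (simp add: clone3_def clone2_def[abs_def] corr2_def ins2_def sum_fun_apply Let_def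
      case_prod_unfold mult_ac)

lemma flattening_clone_corr3:
  assumes "is_basis_list us U"
  shows "flattening_image (\<lambda>z (x, y). clone3 \<Sigma> (corr3 us) (x, y, z)) = clone2 \<Sigma> ` U"
  using flattening_aux[OF assms, of "\<Sum>\<Sigma>"]
  by (simp add: clone3_def clone2_def[abs_def] corr3_def ins3_def sum_fun_apply Let_def
      case_prod_unfold mult_ac)

lemma ex_basis_list:
  assumes "fin_dim_space U"
  shows "\<exists>us. is_basis_list us U"
proof -
  obtain G where G: "finite G" "cfun.span G = U"
    using assms by (auto simp: fin_dim_space_def)
  obtain B where B: "B \<subseteq> G" "cfun.independent B" "G \<subseteq> cfun.span B"
    using cfun.maximal_independent_subset[of G] by blast
  have "cfun.span B = U"
    using B G cfun.span_mono[of B G] cfun.span_minimal[OF B(3) cfun.subspace_span] by auto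
  moreover obtain us where "set us = B" "distinct us"
    using finite_distinct_list[OF finite_subset[OF B(1) G(1)]] by blast
  ultimately show ?thesis
    using B(2) by (auto simp: is_basis_list_def)
qed

lemma clone_space_eq_image:
  assumes "fin_dim_space U"
  shows "clone_space1 \<Sigma> U = clone2 \<Sigma> ` U"
    and "clone_space2 \<Sigma> U = clone2 \<Sigma> ` U"
    and "clone_space3 \<Sigma> U = clone2 \<Sigma> ` U"
  unfolding clone_space1_def clone_space2_def clone_space3_def Let_def
  by (rule flattening_clone_corr1 flattening_clone_corr2 flattening_clone_corr3,
      rule someI_ex, rule ex_basis_list, rule assms)+

end

theory Submission
  imports Defs "HOL-Library.FuncSet"
begin

text \<open>
  Write \<open>W\<close> as the common kernel of functionals \<open>\<theta>\<^sub>1, \<dots>, \<theta>\<^sub>k\<close> on \<open>B \<otimes> C\<close>.  The kernel of a single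
  functional is always spanned by rank one tensors.  Index the basis of \<open>V\<close> by digit vectors in
  \<open>{0..<n}\<^sup>K\<close>, with one digit for each functional belonging to \<open>W\<^sub>A\<close>, \<open>W\<^sub>B\<close> or \<open>W\<^sub>C\<close>, and view elements of
  \<open>(B \<otimes> V) \<otimes> (C \<otimes> V)\<close> as matrices of blocks in \<open>B \<otimes> C\<close>.  \<open>M\<^sub>A\<close> consists of the block matrices
  whose \<open>(y, z)\<close> block depends only on the \<open>A\<close>-digits of \<open>y\<close> and \<open>z\<close>, and is killed by \<open>\<theta>\<^sub>s\<close>
  whenever these digits differ exactly in digit \<open>s\<close> and increase there; \<open>M\<^sub>B\<close>, \<open>M\<^sub>C\<close> are analogous.

  Let a modification of the clone of \<open>T\<close> have rank \<open>r\<close>.  If only digit \<open>s\<close> of \<open>y\<close> and of \<open>z\<close> varies and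
  \<open>x\<close> is fixed, then \<open>\<theta>\<^sub>s\<close> turns the \<open>M\<^sub>A\<close>-part of the \<open>(x, y, z)\<close> blocks into a triangular \<open>n \<times> n\<close>
  matrix, while the other parts depend on \<open>y\<close> alone or on \<open>z\<close> alone; hence the triangular matrix has
  rank \<open>O(r)\<close> and only \<open>O(r)\<close> nonzero diagonal entries.  For \<open>n\<close> large, a union bound gives a digit
  vector at which all functionals vanish, and the corresponding block is a modification of \<open>T\<close> of
  rank at most \<open>r\<close>.  The rank of the augmented tensor then follows from the substitution method.
\<close>

section \<open>Tensor products of finite-dimensional function spaces\<close>

lemma cscale_apply: "cscale r f i = r * f i"
  by (simp add: cscale_def)

lemma fin_dim_subspace: "fin_dim_space X \<Longrightarrow> cfun.subspace X"
  by (auto simp: fin_dim_space_def)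

text \<open>Dual bases consisting of evaluations at points.  With these every functional needed below is a
  finite combination of point evaluations, and so is defined on the whole function space.\<close>

lemma span_points:
  assumes "finite G"
  shows "\<exists>P e. finite P \<and> (\<forall>p\<in>P. e p \<in> cfun.span G) \<and>
    (\<forall>p\<in>P. \<forall>q\<in>P. e p q = (if p = q then 1 else 0)) \<and>
    (\<forall>f\<in>cfun.span G. \<forall>i. f i = (\<Sum>p\<in>P. f p * e p i))"
  using assms
proof (induction G)
  case empty
  show ?case by (rule exI[of _ "{}"]) auto
next
  case (insert g G)
  obtain P e where P: "finite P" and e_ball: "\<forall>p\<in>P. e p \<in> cfun.span G"
    and dl_ball: "\<forall>p\<in>P. \<forall>q\<in>P. e p q = (if p = q then 1 else 0)"
    and rep_ball: "\<forall>f\<in>cfun.span G. \<forall>i. f i = (\<Sum>p\<in>P. f p * e p i)"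
    using insert.IH by (elim exE conjE)
  note e = bspec[OF e_ball] and dl = bspec[OF bspec[OF dl_ball]]
    and rep = spec[OF bspec[OF rep_ball]]
  have mono: "cfun.span G \<subseteq> cfun.span (insert g G)"
    by (rule cfun.span_mono) auto
  \<comment> \<open>\<open>g'\<close> is the error of interpolating \<open>g\<close> at the points
    \<open>P\<close>. It vanishes on \<open>P\<close>, so any point where it is nonzero is a new
    one.\<close>
  define g' where "g' = g - (\<Sum>p\<in>P. cscale (g p) (e p))"
  have sG: "(\<Sum>p\<in>P. cscale (g p) (e p)) \<in> cfun.span G"
    by (intro cfun.span_sum cfun.span_scale e)
  have g'in: "g' \<in> cfun.span (insert g G)"
    unfolding g'_def
    by (intro cfun.span_diff cfun.span_base subsetD[OF mono sG]) auto
  have g'P: "g' p = 0" if "p \<in> P" for p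
  proof -
    have "(\<Sum>q\<in>P. g q * e q p) = (\<Sum>q\<in>P. if q = p then g q else 0)"
      using that by (intro sum.cong) (auto simp: dl)
    then show ?thesis
      using P that by (simp add: g'_def sum_fun_apply cscale_apply)
  qed
  show ?case
  proof (cases "g' = 0")
    case True
    then have "g \<in> cfun.span G" using sG by (simp add: g'_def)
    then have "cfun.span (insert g G) = cfun.span G" by (rule cfun.span_redundant)
    then show ?thesis using insert.IH by simp
  next
    case False
    then obtain t where t: "g' t \<noteq> 0" by (auto simp: fun_eq_iff)
    have tP: "t \<notin> P" using t g'P by auto
    define h where "h = cscale (1 / g' t) g'"
    have ht: "h t = 1" using t by (simp add: h_def cscale_apply)
    have hP: "h p = 0" if "p \<in> P" for p using g'P[OF that] by (simp add: h_def cscale_apply)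
    have hin: "h \<in> cfun.span (insert g G)" unfolding h_def by (intro cfun.span_scale g'in)
    \<comment> \<open>Subtracting the multiple of \<open>h\<close> makes \<open>e p\<close> vanish
      at \<open>t\<close>; since \<open>h\<close> vanishes on \<open>P\<close>, the values there are
      kept.\<close>
    define e' where "e' p = (if p = t then h else e p - cscale (e p t) h)" for p
    have new: "f i = (\<Sum>p\<in>insert t P. f p * e' p i)"
      if "f i = (\<Sum>p\<in>P. f p * e p i) + c * h i" "f t = (\<Sum>p\<in>P. f p * e p t) + c" for f c i
    proof -
      have "(\<Sum>p\<in>insert t P. f p * e' p i) = f t * h i + (\<Sum>p\<in>P. f p * e' p i)"
        using P tP by (simp add: e'_def)
      also have "(\<Sum>p\<in>P. f p * e' p i) = (\<Sum>p\<in>P. f p * e p i - (f p * e p t) * h i)"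
        using tP by (intro sum.cong) (auto simp: e'_def cscale_apply algebra_simps)
      also have "\<dots> = (\<Sum>p\<in>P. f p * e p i) - (\<Sum>p\<in>P. f p * e p t) * h i"
        by (simp add: sum_subtractf sum_distrib_right)
      finally show ?thesis using that by (simp add: algebra_simps)
    qed
    have rep': "f i = (\<Sum>p\<in>insert t P. f p * e' p i)" if f: "f \<in> cfun.span (insert g G)" for f i
    proof -
      obtain k where k: "f - cscale k g \<in> cfun.span G"
        using cfun.span_breakdown_eq[of f g G] f by blast
      \<comment> \<open>\<open>f0\<close> replaces the \<open>g\<close>-component of
        \<open>f\<close> by its interpolant, so that \<open>f - f0\<close> is a multiple of
        \<open>g'\<close> and hence of \<open>h\<close>.\<close>
      define f0 where "f0 = f - cscale k g + cscale k (\<Sum>p\<in>P. cscale (g p) (e p))"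
      have f0: "f0 \<in> cfun.span G"
        unfolding f0_def by (intro cfun.span_add k cfun.span_scale sG)
      have f_eq: "f x = f0 x + (k * g' t) * h x" for x
      proof -
        have "(k * g' t) * h x = k * g' x"
          using t by (simp add: h_def cscale_apply)
        then show ?thesis
          by (simp add: f0_def g'_def cscale_apply algebra_simps)
      qed
      have fP: "f p = f0 p" if "p \<in> P" for p using hP[OF that] f_eq by simp
      have *: "f x = (\<Sum>p\<in>P. f p * e p x) + (k * g' t) * h x" for x
        using rep[OF f0, of x] f_eq[of x] fP by simp
      show ?thesis
        using *[of t] unfolding ht mult_1_right by (rule new[OF *])
    qed
    have "e' p \<in> cfun.span (insert g G)" if "p \<in> insert t P" for p
      using that e mono hin
      by (auto simp: e'_def intro!: cfun.span_diff cfun.span_scale)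
    moreover have "e' p q = (if p = q then 1 else 0)" if "p \<in> insert t P" "q \<in> insert t P" for p q
      using that tP ht hP dl by (auto simp: e'_def cscale_apply)
    ultimately show ?thesis
      using P rep' by (intro exI[of _ "insert t P"] exI[of _ e']) auto
  qed
qed

lemma fin_dim_points:
  assumes "fin_dim_space X"
  obtains P e where "finite P" "\<And>p. p \<in> P \<Longrightarrow> e p \<in> X"
    "\<And>f i. f \<in> X \<Longrightarrow> f i = (\<Sum>p\<in>P. f p * e p i)"
proof -
  obtain G where G: "finite G" "cfun.span G = X"
    using assms by (auto simp: fin_dim_space_def)
  obtain P e where "finite P" "\<forall>p\<in>P. e p \<in> X" "\<forall>f\<in>X. \<forall>i. f i = (\<Sum>p\<in>P. f p * e p i)"
    using span_points[OF G(1)] unfolding G(2) by (elim exE conjE)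
  then show thesis by (intro that[of P e]) blast+
qed

lemma subspace_fin_dim:
  assumes "fin_dim_space X" "cfun.subspace W" "W \<subseteq> X"
  shows "fin_dim_space W"
proof -
  obtain G where G: "finite G" "cfun.span G = X"
    using assms(1) by (auto simp: fin_dim_space_def)
  obtain B where B: "B \<subseteq> W" "cfun.independent B" "W \<subseteq> cfun.span B"
    using cfun.maximal_independent_subset[of W] by blast
  have "finite B" using cfun.independent_span_bound[OF G(1) B(2)] B(1) assms(3) G(2) by auto
  moreover have "cfun.span B = W"
    using B cfun.span_minimal[OF B(1) assms(2)] by auto
  ultimately show ?thesis by (auto simp: fin_dim_space_def)
qed

lemma fin_dim_tprod2:
  assumes "fin_dim_space X" "fin_dim_space Y"
  shows "fin_dim_space (tprod2 X Y)"
proof -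
  obtain P e where P: "finite P" "\<And>p. p \<in> P \<Longrightarrow> e p \<in> X"
    and e: "\<And>f i. f \<in> X \<Longrightarrow> f i = (\<Sum>p\<in>P. f p * e p i)"
    using fin_dim_points[OF assms(1)] by metis
  obtain Q d where Q: "finite Q" "\<And>p. p \<in> Q \<Longrightarrow> d p \<in> Y"
    and d: "\<And>f i. f \<in> Y \<Longrightarrow> f i = (\<Sum>p\<in>Q. f p * d p i)"
    using fin_dim_points[OF assms(2)] by metis
  let ?G = "(\<lambda>(p, q). tensor2 (e p) (d q)) ` (P \<times> Q)"
  have "tensor2 x y \<in> cfun.span ?G" if "x \<in> X" "y \<in> Y" for x y
  proof -
    have "tensor2 x y = (\<Sum>p\<in>P. \<Sum>q\<in>Q. cscale (x p * y q) (tensor2 (e p) (d q)))"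
    proof (rule ext, clarify)
      fix i j
      have "tensor2 x y (i, j) = (\<Sum>p\<in>P. x p * e p i) * (\<Sum>q\<in>Q. y q * d q j)"
        unfolding e[OF that(1), symmetric] d[OF that(2), symmetric] by (simp add: tensor2_def)
      then show "tensor2 x y (i, j)
          = (\<Sum>p\<in>P. \<Sum>q\<in>Q. cscale (x p * y q) (tensor2 (e p) (d q))) (i, j)"
        by (simp add: sum_fun_apply cscale_apply tensor2_def sum_product mult_ac)
    qed
    also have "\<dots> \<in> cfun.span ?G"
      by (intro cfun.span_sum cfun.span_scale cfun.span_base) auto
    finally show ?thesis .
  qed
  then have "tprod2 X Y \<subseteq> cfun.span ?G"
    unfolding tprod2_def by (intro cfun.span_minimal) auto
  moreover have "cfun.span ?G \<subseteq> tprod2 X Y"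
    unfolding tprod2_def using P Q by (intro cfun.span_mono) auto
  ultimately show ?thesis
    unfolding fin_dim_space_def using P(1) Q(1) by (intro exI[of _ ?G]) auto
qed

section \<open>Subspaces as common kernels of functionals\<close>

text \<open>Interpolation at the points \<open>R\<close> maps every function into \<open>W\<close>
  and fixes \<open>W\<close>. So an element of \<open>U\<close> lies in \<open>W\<close> exactly
  when it agrees with its interpolant; both lie in \<open>U\<close>, where agreement on the points
  \<open>P\<close> is enough. This gives one functional for each point of \<open>P\<close>.\<close>

lemma subspace_functionals:
  assumes "fin_dim_space U" "cfun.subspace W" "W \<subseteq> U"
  obtains Q k \<theta> where "finite Q"
    "\<And>u. u \<in> U \<Longrightarrow> u \<in> W \<longleftrightarrow> (\<forall>s<(k::nat). (\<Sum>q\<in>Q. \<theta> s q * u q) = 0)"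
proof -
  obtain P e where P: "finite P"
    and e: "\<And>f i. f \<in> U \<Longrightarrow> f i = (\<Sum>p\<in>P. f p * e p i)"
    using fin_dim_points[OF assms(1)] by metis
  obtain R g where R: "finite R" and gW: "\<And>p. p \<in> R \<Longrightarrow> g p \<in> W"
    and g: "\<And>f i. f \<in> W \<Longrightarrow> f i = (\<Sum>p\<in>R. f p * g p i)"
    using fin_dim_points[OF subspace_fin_dim[OF assms]] by metis
  obtain ps where ps: "set ps = P" using finite_list[OF P] by blast
  \<comment> \<open>The coefficients of the functional taking \<open>u\<close> to its value at
    \<open>ps ! s\<close> minus the value there of its interpolant from \<open>R\<close>.\<close>
  define \<theta> where "\<theta> s q = (if q = ps ! s then 1 else 0) - (if q \<in> R then g q (ps ! s) else 0)" for s q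
  have \<theta>: "(\<Sum>q\<in>P \<union> R. \<theta> s q * u q) = u (ps ! s) - (\<Sum>q\<in>R. u q * g q (ps ! s))"
    if "s < length ps" for s u
  proof -
    have "(\<Sum>q\<in>P \<union> R. \<theta> s q * u q) = (\<Sum>q\<in>P \<union> R. if q = ps ! s then u q else 0)
        - (\<Sum>q\<in>P \<union> R. if q \<in> R then u q * g q (ps ! s) else 0)"
      unfolding sum_subtractf[symmetric] by (rule sum.cong) (auto simp: \<theta>_def algebra_simps)
    moreover have "ps ! s \<in> P" using that ps by auto
    moreover have "(\<Sum>q\<in>P \<union> R. if q \<in> R then u q * g q (ps ! s) else 0)
        = (\<Sum>q\<in>R. u q * g q (ps ! s))"
      using P R by (intro sum.mono_neutral_cong_right) auto
    ultimately show ?thesis using P R by simp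
  qed
  have "u \<in> W \<longleftrightarrow> (\<forall>s<length ps. (\<Sum>q\<in>P \<union> R. \<theta> s q * u q) = 0)" if u: "u \<in> U" for u
  proof
    assume "u \<in> W"
    then have "(\<Sum>q\<in>R. u q * g q (ps ! s)) = u (ps ! s)" for s
      using g by metis
    then show "\<forall>s<length ps. (\<Sum>q\<in>P \<union> R. \<theta> s q * u q) = 0"
      by (simp add: \<theta>)
  next
    assume a: "\<forall>s<length ps. (\<Sum>q\<in>P \<union> R. \<theta> s q * u q) = 0"
    define w where "w = (\<Sum>q\<in>R. cscale (u q) (g q))"
    have w: "w \<in> W"
      unfolding w_def by (intro cfun.subspace_sum cfun.subspace_scale assms(2) gW)
    have "u p = w p" if "p \<in> P" for p
      using a that ps by (auto simp: \<theta> w_def sum_fun_apply cscale_apply in_set_conv_nth)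
    then have "(\<Sum>p\<in>P. u p * e p i) = (\<Sum>p\<in>P. w p * e p i)" for i
      by (intro sum.cong) auto
    then have "u i = w i" for i
      using e[OF u, of i] e[OF subsetD[OF assms(3) w], of i] by metis
    then have "u = w" by auto
    then show "u \<in> W" using w by simp
  qed
  then show thesis using P R that[of "P \<union> R" "length ps" \<theta>] by blast
qed

section \<open>Simple tensors in the kernel of one functional\<close>

lemma tensor2_add_left: "tensor2 (x + x') y = tensor2 x y + tensor2 x' y"
  by (auto simp: tensor2_def fun_eq_iff cscale_apply algebra_simps)

lemma tensor2_add_right: "tensor2 x (y + y') = tensor2 x y + tensor2 x y'"
  by (auto simp: tensor2_def fun_eq_iff cscale_apply algebra_simps)

lemma tensor2_diff_left: "tensor2 (x - x') y = tensor2 x y - tensor2 x' y"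
  by (auto simp: tensor2_def fun_eq_iff cscale_apply algebra_simps)

lemma tensor2_diff_right: "tensor2 x (y - y') = tensor2 x y - tensor2 x y'"
  by (auto simp: tensor2_def fun_eq_iff cscale_apply algebra_simps)

lemma tensor2_scale_left: "tensor2 (cscale r x) y = cscale r (tensor2 x y)"
  by (auto simp: tensor2_def fun_eq_iff cscale_apply algebra_simps)

lemma tensor2_scale_right: "tensor2 x (cscale r y) = cscale r (tensor2 x y)"
  by (auto simp: tensor2_def fun_eq_iff cscale_apply algebra_simps)

lemma tensor2_in_tprod2: "x \<in> X \<Longrightarrow> y \<in> Y \<Longrightarrow> tensor2 x y \<in> tprod2 X Y"
  unfolding tprod2_def by (intro cfun.span_base) auto

text \<open>Fix a simple tensor \<open>t\<close> with \<phi> equal to 1. Modulo the span of the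
  simple tensors killed by \<phi>, every simple tensor is congruent to its \<phi>-value times
  \<open>t\<close>. By linearity \<open>u\<close> is congruent to \<phi>(u) times \<open>t\<close>,
  which is zero. If \<phi> kills all simple tensors, there is no such \<open>t\<close> and the claim
  is immediate.\<close>

lemma tprod2_kernel_span:
  assumes X: "cfun.subspace X" and Y: "cfun.subspace Y"
    and add: "\<And>u v. \<phi> (u + v) = \<phi> u + (\<phi> v :: complex)"
    and scale: "\<And>r u. \<phi> (cscale r u) = r * \<phi> u"
    and u: "u \<in> tprod2 X Y" "\<phi> u = 0"
  shows "u \<in> cfun.span {tensor2 x y | x y. x \<in> X \<and> y \<in> Y \<and> \<phi> (tensor2 x y) = 0}"
    (is "u \<in> cfun.span ?R")
proof (cases "\<exists>x\<in>X. \<exists>y\<in>Y. \<phi> (tensor2 x y) \<noteq> 0")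
  case False
  then have "?R = {tensor2 x y | x y. x \<in> X \<and> y \<in> Y}" by auto
  then show ?thesis using u by (simp add: tprod2_def)
next
  case True
  then obtain x1 y0 where x1: "x1 \<in> X" "\<phi> (tensor2 x1 y0) \<noteq> 0" and y0: "y0 \<in> Y" by auto
  define x0 where "x0 = cscale (1 / \<phi> (tensor2 x1 y0)) x1"
  have x0: "x0 \<in> X" unfolding x0_def by (intro cfun.subspace_scale X x1)
  have one: "\<phi> (tensor2 x0 y0) = 1"
    using x1 by (simp add: x0_def tensor2_scale_left scale)
  define t where "t = tensor2 x0 y0"
  have R: "tensor2 x y \<in> cfun.span ?R" if "x \<in> X" "y \<in> Y" "\<phi> (tensor2 x y) = 0" for x y
    using that by (intro cfun.span_base) blast
  have diff: "\<phi> (u - v) = \<phi> u - \<phi> v" for u v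
    using add[of u "cscale (- 1) v"] scale[of "- 1" v] by simp
  note lin = tensor2_add_left tensor2_add_right tensor2_diff_left tensor2_diff_right tensor2_scale_left tensor2_scale_right add scale
    diff one
  \<comment> \<open>\<open>\<phi>\<close> vanishes on each of the three simple tensors into which the left-hand side is decomposed.\<close>
  have mod: "tensor2 x y - cscale (\<phi> (tensor2 x y)) t \<in> cfun.span ?R" if xy: "x \<in> X" "y \<in> Y" for x y
  proof -
    define \<beta> \<gamma> where "\<beta> = \<phi> (tensor2 x y0)" and "\<gamma> = \<phi> (tensor2 x0 y)"
    define x' y' where "x' = x - cscale \<beta> x0" and "y' = y - cscale \<gamma> y0"
    define \<kappa> where "\<kappa> = \<phi> (tensor2 x' y')"
    have x': "x' \<in> X" "\<phi> (tensor2 x' y0) = 0"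
      unfolding x'_def by (rule cfun.subspace_diff[OF X xy(1) cfun.subspace_scale[OF X x0]])
        (simp add: lin flip: \<beta>_def)
    have y': "y' \<in> Y" "\<phi> (tensor2 x0 y') = 0"
      unfolding y'_def by (rule cfun.subspace_diff[OF Y xy(2) cfun.subspace_scale[OF Y y0]])
        (simp add: lin flip: \<gamma>_def)
    have \<kappa>: "\<phi> (tensor2 x y) = \<beta> * \<gamma> + \<kappa>"
      by (simp add: \<kappa>_def x'_def y'_def lin flip: \<beta>_def \<gamma>_def)
    \<comment> \<open>The tensor of \<open>x'\<close> and \<open>y'\<close> need not be killed.
      Adding \<open>x0\<close> to one factor and subtracting \<kappa> times \<open>y0\<close> from
      the other offsets its value \<kappa> by that of \<open>t\<close>, while the mixed terms are
      killed.\<close>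
    have 1: "tensor2 (x' + x0) (y' - cscale \<kappa> y0) \<in> cfun.span ?R"
    proof (rule R)
      show "x' + x0 \<in> X" "y' - cscale \<kappa> y0 \<in> Y"
        by (intro cfun.subspace_diff cfun.subspace_scale cfun.subspace_add x' y' x0 y0 X Y)+
      show "\<phi> (tensor2 (x' + x0) (y' - cscale \<kappa> y0)) = 0"
        using x'(2) y'(2) by (simp add: lin flip: \<kappa>_def)
    qed
    have "tensor2 x y - cscale (\<phi> (tensor2 x y)) t
      = tensor2 (x' + x0) (y' - cscale \<kappa> y0) + cscale (\<kappa> + \<gamma>) (tensor2 x' y0)
        + cscale (\<beta> - 1) (tensor2 x0 y')"
      unfolding \<kappa> t_def x'_def y'_def by (auto simp: fun_eq_iff tensor2_def cscale_apply algebra_simps)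
    then show ?thesis
      using 1 R[OF x'(1) y0 x'(2)] R[OF x0 y'(1) y'(2)]
      by (simp add: cfun.span_add cfun.span_scale)
  qed
  have "u - cscale (\<phi> u) t \<in> cfun.span ?R"
    using u(1) unfolding tprod2_def
  proof (induction rule: cfun.span_induct_alt)
    case base
    have "\<phi> 0 = 0" using scale[of 0 0] by simp
    then have "0 - cscale (\<phi> 0) t = 0" by (simp only: cfun.scale_zero_left diff_self)
    then show ?case by (simp only: cfun.span_zero)
  next
    case (step c a v)
    then obtain x y where a: "a = tensor2 x y" "x \<in> X" "y \<in> Y" by auto
    have "cscale c a + v - cscale (\<phi> (cscale c a + v)) t
      = cscale c (a - cscale (\<phi> a) t) + (v - cscale (\<phi> v) t)"
      by (auto simp: fun_eq_iff cscale_apply add scale algebra_simps)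
    then show ?case
      using cfun.span_add[OF cfun.span_scale[OF mod[OF a(2,3)], of c] step(2)] by (simp only: a(1))
  qed
  moreover have "u - cscale (\<phi> u) t = u" using u(2) by (auto simp: fun_eq_iff cscale_apply)
  ultimately show ?thesis by simp
qed

section \<open>Spaces of block matrices\<close>

text \<open>\<open>V\<close> is \<open>coord_space m\<close>; the block in row \<open>y\<close> and column \<open>z\<close> depends only on the keys of \<open>y\<close>
  and \<open>z\<close>.\<close>

definition block_space ::
  "nat \<Rightarrow> (nat \<Rightarrow> 'q) \<Rightarrow> ('q \<Rightarrow> 'q \<Rightarrow> ('i \<times> 'j \<Rightarrow> complex) set)
    \<Rightarrow> (('i \<times> nat) \<times> ('j \<times> nat) \<Rightarrow> complex) set" where
  "block_space m key H = {u. \<exists>G. (\<forall>P Q. G P Q \<in> H P Q) \<and>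
    u = (\<lambda>((p, y), (q, z)). if y < m \<and> z < m then G (key y) (key z) (p, q) else 0)}"

lemma block_spaceE:
  assumes "u \<in> block_space m key H"
  obtains G where "\<And>P Q. G P Q \<in> H P Q"
    "\<And>p q y z. y < m \<Longrightarrow> z < m \<Longrightarrow> u ((p, y), (q, z)) = G (key y) (key z) (p, q)"
  using assms unfolding block_space_def by fastforce

lemma subspace_block_space:
  assumes H: "\<And>P Q. cfun.subspace (H P Q)"
  shows "cfun.subspace (block_space m key H)"
proof (rule cfun.subspaceI)
  show "0 \<in> block_space m key H"
    unfolding block_space_def
    by (rule CollectI, rule exI[of _ "\<lambda>_ _. 0"]) (auto simp: fun_eq_iff cfun.subspace_0[OF H])
next
  fix u v assume "u \<in> block_space m key H" "v \<in> block_space m key H"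
  then obtain G G' where G: "\<forall>P Q. G P Q \<in> H P Q" "\<forall>P Q. G' P Q \<in> H P Q"
    and u: "u = (\<lambda>((p, y), (q, z)). if y < m \<and> z < m then G (key y) (key z) (p, q) else 0)"
    and v: "v = (\<lambda>((p, y), (q, z)). if y < m \<and> z < m then G' (key y) (key z) (p, q) else 0)"
    unfolding block_space_def by blast
  have "\<forall>P Q. G P Q + G' P Q \<in> H P Q"
    using G by (intro allI cfun.subspace_add[OF H]) auto
  then show "u + v \<in> block_space m key H"
    unfolding block_space_def
    by (intro CollectI exI[of _ "\<lambda>P Q. G P Q + G' P Q"] conjI) (auto simp: u v fun_eq_iff)
next
  fix r u assume "u \<in> block_space m key H"
  then obtain G where G: "\<forall>P Q. G P Q \<in> H P Q"
    and u: "u = (\<lambda>((p, y), (q, z)). if y < m \<and> z < m then G (key y) (key z) (p, q) else 0)"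
    unfolding block_space_def by blast
  have "\<forall>P Q. cscale r (G P Q) \<in> H P Q"
    using G by (intro allI cfun.subspace_scale[OF H]) auto
  then show "cscale r u \<in> block_space m key H"
    unfolding block_space_def
    by (intro CollectI exI[of _ "\<lambda>P Q. cscale r (G P Q)"] conjI)
      (auto simp: u fun_eq_iff cscale_apply)
qed

text \<open>The positions with a given pair of keys form a rectangle, whose indicator is a product.
  Filling its blocks with one simple tensor therefore gives a simple tensor again. A general element
  is a sum of such fillings, since each block lies in a space spanned by simple tensors.\<close>

lemma rank_one_block_space:
  fixes H :: "'q \<Rightarrow> 'q \<Rightarrow> ('i \<times> 'j \<Rightarrow> complex) set"
  assumes H: "\<And>P Q. cfun.subspace (H P Q)"
    and gen: "\<And>P Q. H P Q
      \<subseteq> cfun.span {tensor2 x y | x y. x \<in> X \<and> y \<in> Y \<and> tensor2 x y \<in> H P Q}"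
  shows "spanned_by_rank_one (tprod2 X (coord_space m)) (tprod2 Y (coord_space m))
    (block_space m key H)"
proof -
  let ?M = "block_space m key H"
  let ?R = "rank_one_tensors (tprod2 X (coord_space m)) (tprod2 Y (coord_space m)) \<inter> ?M"
  define ind where "ind P y = (if y < m \<and> key y = P then 1 else 0 :: complex)" for P y
  define ext where "ext P Q v = (\<lambda>((p, y), (q, z)). v (p, q) * (ind P y * ind Q z))"
    for P Q and v :: "'i \<times> 'j \<Rightarrow> complex"
  have ind: "ind P \<in> coord_space m" for P by (auto simp: ind_def coord_space_def)
  have ind_sum: "(\<Sum>P\<in>key ` {..<m}. ind P y * f P) = (if y < m then f (key y) else 0)" for y f
  proof (cases "y < m")
    case True
    then have "(\<Sum>P\<in>key ` {..<m}. ind P y * f P) = (\<Sum>P\<in>key ` {..<m}. if P = key y then f P else 0)"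
      by (intro sum.cong) (auto simp: ind_def)
    then show ?thesis using True by simp
  qed (simp add: ind_def)
  have ext_tensor2: "ext P Q (tensor2 x y) \<in> cfun.span ?R"
    if "x \<in> X" "y \<in> Y" "tensor2 x y \<in> H P Q" for P Q x y
  proof -
    have eq: "ext P Q (tensor2 x y) = tensor2 (tensor2 x (ind P)) (tensor2 y (ind Q))"
      by (auto simp: ext_def tensor2_def fun_eq_iff)
    have "\<forall>P' Q'. (if P' = P \<and> Q' = Q then tensor2 x y else 0) \<in> H P' Q'"
      using that(3) cfun.subspace_0[OF H] by auto
    then have M: "ext P Q (tensor2 x y) \<in> ?M"
      unfolding block_space_def
      by (intro CollectI exI[of _ "\<lambda>P' Q'. if P' = P \<and> Q' = Q then tensor2 x y else 0"] conjI)
        (auto simp: ext_def ind_def fun_eq_iff)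
    show ?thesis
    \<comment> \<open>Rank one tensors have nonzero factors, so the zero tensor, which arises for
      instance when no index has key \<open>P\<close>, is treated apart.\<close>
    proof (cases "tensor2 x (ind P) = 0 \<or> tensor2 y (ind Q) = 0")
      case True
      then have "ext P Q (tensor2 x y) = 0"
        unfolding eq by (auto simp: tensor2_def fun_eq_iff)
      then show ?thesis by (simp only: cfun.span_zero)
    next
      case False
      then have "ext P Q (tensor2 x y) \<in> ?R"
        using M that(1,2) ind unfolding eq rank_one_tensors_def
        by (blast intro: tensor2_in_tprod2)
      then show ?thesis by (rule cfun.span_base)
    qed
  qed
  have ext_span: "ext P Q v \<in> cfun.span ?R" if "v \<in> H P Q" for P Q v
  proof -
    have "v \<in> cfun.span {tensor2 x y | x y. x \<in> X \<and> y \<in> Y \<and> tensor2 x y \<in> H P Q}"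
      using that gen by blast
    then show ?thesis
    proof (induction rule: cfun.span_induct_alt)
      case base
      have "ext P Q 0 = 0" by (auto simp: ext_def fun_eq_iff)
      then show ?case by (simp only: cfun.span_zero)
    next
      case (step c a v)
      then obtain x y where a: "a = tensor2 x y" "x \<in> X" "y \<in> Y" "tensor2 x y \<in> H P Q" by auto
      have "ext P Q (cscale c a + v) = cscale c (ext P Q a) + ext P Q v"
        by (auto simp: ext_def fun_eq_iff cscale_apply algebra_simps)
      then show ?case
        using cfun.span_add[OF cfun.span_scale[OF ext_tensor2[OF a(2-4)], of c] step(2)]
        by (simp only: a(1))
    qed
  qed
  have "u \<in> cfun.span ?R" if u_in: "u \<in> ?M" for u
  proof -
    obtain G where G: "\<forall>P Q. G P Q \<in> H P Q"
      and u: "u = (\<lambda>((p, y), (q, z)). if y < m \<and> z < m then G (key y) (key z) (p, q) else 0)"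
      using u_in unfolding block_space_def by blast
    \<comment> \<open>The indicators of distinct keys have disjoint supports, so at each position at
      most one summand is nonzero.\<close>
    have "u = (\<Sum>P\<in>key ` {..<m}. \<Sum>Q\<in>key ` {..<m}. ext P Q (G P Q))"
    proof (rule ext, clarify)
      fix p y q z
      have "(\<Sum>P\<in>key ` {..<m}. \<Sum>Q\<in>key ` {..<m}. ext P Q (G P Q)) ((p, y), (q, z))
          = (\<Sum>P\<in>key ` {..<m}. ind P y * (\<Sum>Q\<in>key ` {..<m}. ind Q z * G P Q (p, q)))"
        by (simp add: sum_fun_apply ext_def sum_distrib_left mult_ac)
      also have "\<dots> = u ((p, y), (q, z))"
        by (simp add: ind_sum u)
      finally show "u ((p, y), (q, z))
          = (\<Sum>P\<in>key ` {..<m}. \<Sum>Q\<in>key ` {..<m}. ext P Q (G P Q)) ((p, y), (q, z))" ..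
    qed
    also have "\<dots> \<in> cfun.span ?R"
      using G by (intro cfun.span_sum ext_span) auto
    finally show ?thesis .
  qed
  moreover have "cfun.span ?R \<subseteq> ?M"
    by (intro cfun.span_minimal subspace_block_space H) auto
  ultimately show ?thesis
    unfolding spanned_by_rank_one_def by (intro exI[of _ ?R]) auto
qed

lemma spanned_by_rank_one_subset:
  assumes "spanned_by_rank_one X Y M"
  shows "M \<subseteq> tprod2 X Y"
proof -
  obtain R where "R \<subseteq> rank_one_tensors X Y" "cfun.span R = M"
    using assms by (auto simp: spanned_by_rank_one_def)
  then show ?thesis
    unfolding tprod2_def rank_one_tensors_def
    using cfun.span_mono[of R "{tensor2 x y |x y. x \<in> X \<and> y \<in> Y}"] by blast
qed

section \<open>The standard basis of the coordinate space\<close>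

lemma inj_unit_vec: "inj unit_vec"
  by (rule injI) (metis unit_vec_def zero_neq_one)

lemma sum_unit_vec: "\<Sum>(unit_vec ` {..<m}) i = (if i < m then 1 else 0)"
  by (simp add: sum.reindex inj_on_subset[OF inj_unit_vec] sum_fun_apply) (simp add: unit_vec_def)

lemma coord_space_expand: "f \<in> coord_space m \<Longrightarrow> f = (\<Sum>j<m. cscale (f j) (unit_vec j))"
  by (auto simp: fun_eq_iff sum_fun_apply cscale_apply unit_vec_def coord_space_def if_distrib
      cong: if_cong)

lemma unit_vec_in_coord_space: "j < m \<Longrightarrow> unit_vec j \<in> coord_space m"
  by (auto simp: unit_vec_def coord_space_def)

lemma subspace_coord_space: "cfun.subspace (coord_space m)"
  by (rule cfun.subspaceI) (auto simp: coord_space_def cscale_apply)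

lemma span_unit_vec: "cfun.span (unit_vec ` {..<m}) = coord_space m"
proof (rule antisym)
  show "cfun.span (unit_vec ` {..<m}) \<subseteq> coord_space m"
    by (intro cfun.span_minimal subspace_coord_space) (auto intro: unit_vec_in_coord_space)
  show "coord_space m \<subseteq> cfun.span (unit_vec ` {..<m})"
  proof
    fix f assume "f \<in> coord_space m"
    then have "f = (\<Sum>j<m. cscale (f j) (unit_vec j))" by (rule coord_space_expand)
    also have "\<dots> \<in> cfun.span (unit_vec ` {..<m})"
      by (intro cfun.span_sum cfun.span_scale cfun.span_base) auto
    finally show "f \<in> cfun.span (unit_vec ` {..<m})" .
  qed
qed

lemma independent_unit_vec: "cfun.independent (unit_vec ` {..<m})"
proof (induction m)
  case (Suc m)
  have "unit_vec m \<notin> cfun.span (unit_vec ` {..<m})"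
    unfolding span_unit_vec by (auto simp: coord_space_def unit_vec_def)
  then show ?case using Suc by (simp add: lessThan_Suc cfun.independent_insert)
qed (simp add: cfun.independent_empty)

section \<open>Triangular matrices of low rank and the union bound\<close>

text \<open>For the least index \<open>b\<close>, the functional with coefficients
  \<open>g s b\<close> kills the vectors of all larger indices but not the one at \<open>b\<close>,
  which hence lies outside their span. Entries from \<open>R\<close> on are set to zero so that the
  family lives in \<open>coord_space R\<close>, whose dimension will bound its size.\<close>

lemma triangular_independent:
  fixes g h :: "nat \<Rightarrow> nat \<Rightarrow> complex" and R :: nat
  defines "v \<equiv> \<lambda>k s. if s < R then h s k else 0"
  assumes "finite J"
    and "\<And>j k. j \<in> J \<Longrightarrow> k \<in> J \<Longrightarrow> j < k \<Longrightarrow> (\<Sum>s<R. g s j * h s k) = 0"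
    and "\<And>j. j \<in> J \<Longrightarrow> (\<Sum>s<R. g s j * h s j) \<noteq> 0"
  shows "cfun.independent (v ` J) \<and> inj_on v J"
  using assms(2-)
proof (induction J rule: finite_linorder_min_induct)
  case empty
  then show ?case by (simp add: cfun.independent_empty)
next
  case (insert b A)
  let ?L = "\<lambda>x. \<Sum>s<R. g s b * x s"
  have Lv: "?L (v k) = (\<Sum>s<R. g s b * h s k)" for k
    by (rule sum.cong) (auto simp: v_def)
  have "?L x = 0" if "x \<in> cfun.span (v ` A)" for x
    using that
  proof (induction rule: cfun.span_induct_alt)
    case (step c a y)
    then obtain k where "k \<in> A" "a = v k" by auto
    then have "?L a = 0" using insert.hyps(2) insert.prems(1)[of b k] Lv by auto
    then show ?case
      using step by (simp add: cscale_apply algebra_simps sum.distrib flip: sum_distrib_left)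
  qed simp
  moreover have "?L (v b) \<noteq> 0" using insert.prems(2)[of b] unfolding Lv by simp
  ultimately have nin: "v b \<notin> cfun.span (v ` A)" by blast
  have IH: "cfun.independent (v ` A) \<and> inj_on v A"
    using insert.prems by (intro insert.IH) auto
  have "v b \<notin> v ` A" using nin cfun.span_base[of "v b" "v ` A"] by blast
  moreover have "A - {b} = A" using insert.hyps by auto
  ultimately show ?case
    using IH nin by (auto simp: cfun.independent_insert)
qed

text \<open>The rows and columns with nonzero diagonal entry form a triangular matrix with nonzero
  diagonal, so their columns of \<open>h\<close> are independent in
  \<open>coord_space R\<close>.\<close>

lemma triangular_diagonal_card:
  fixes g h :: "nat \<Rightarrow> nat \<Rightarrow> complex"
  assumes "\<And>j k. j < k \<Longrightarrow> k < n \<Longrightarrow> (\<Sum>s<R. g s j * h s k) = 0"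
  shows "card {j. j < n \<and> (\<Sum>s<R. g s j * h s j) \<noteq> 0} \<le> R"
proof -
  let ?J = "{j. j < n \<and> (\<Sum>s<R. g s j * h s j) \<noteq> 0}"
  let ?v = "\<lambda>k s. if s < R then h s k else 0"
  have ind: "cfun.independent (?v ` ?J) \<and> inj_on ?v ?J"
    by (rule triangular_independent) (auto intro: assms)
  have "?v ` ?J \<subseteq> cfun.span (unit_vec ` {..<R})"
    unfolding span_unit_vec by (auto simp: coord_space_def)
  then have "card (?v ` ?J) \<le> card (unit_vec ` {..<R})"
    using cfun.independent_span_bound[of "unit_vec ` {..<R}"] ind by auto
  also have "\<dots> \<le> R" using card_image_le[of "{..<R}" unit_vec] by simp
  finally show ?thesis using ind by (simp add: card_image)
qed

text \<open>Rank is bounded through a factorization, the form in which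
  \<open>triangular_diagonal_card\<close> takes its matrix.\<close>

definition matrix_rank_le :: "nat \<Rightarrow> (nat \<Rightarrow> nat \<Rightarrow> complex) \<Rightarrow> bool" where
  "matrix_rank_le R f \<longleftrightarrow> (\<exists>g h. \<forall>j k. f j k = (\<Sum>s<R. g s j * h s k))"

lemma matrix_rank_le_prod: "matrix_rank_le 1 (\<lambda>j k. g j * h k)"
  unfolding matrix_rank_le_def by (intro exI[of _ "\<lambda>_. g"] exI[of _ "\<lambda>_. h"]) simp

lemma matrix_rank_le_0: "matrix_rank_le 0 (\<lambda>j k. 0)"
  unfolding matrix_rank_le_def by simp

lemma matrix_rank_le_add:
  assumes "matrix_rank_le R f" "matrix_rank_le R' f'"
  shows "matrix_rank_le (R + R') (\<lambda>j k. f j k + f' j k)"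
proof -
  obtain g h g' h' where f: "\<And>j k. f j k = (\<Sum>s<R. g s j * h s k)"
    and f': "\<And>j k. f' j k = (\<Sum>s<R'. g' s j * h' s k)"
    using assms unfolding matrix_rank_le_def by blast
  have split: "(\<Sum>s<R + R'. x s) = (\<Sum>s<R. x s) + (\<Sum>s<R'. x (R + s))" for x :: "nat \<Rightarrow> complex"
    by (induction R') simp_all
  have "(\<Sum>s<R + R'. (if s < R then g s j else g' (s - R) j) * (if s < R then h s k else h' (s - R) k))
      = f j k + f' j k" for j k
    by (simp add: f f' split)
  then show ?thesis unfolding matrix_rank_le_def
    by (intro exI[of _ "\<lambda>s j. if s < R then g s j else g' (s - R) j"]
        exI[of _ "\<lambda>s k. if s < R then h s k else h' (s - R) k"]) simp
qed

lemma matrix_rank_le_sum: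
  assumes "finite S" "\<And>s. s \<in> S \<Longrightarrow> matrix_rank_le R (f s)"
  shows "matrix_rank_le (card S * R) (\<lambda>j k. \<Sum>s\<in>S. f s j k)"
  using assms
proof (induction S)
  case empty
  then show ?case by (simp add: matrix_rank_le_0)
next
  case (insert s S)
  then show ?case using matrix_rank_le_add[of R "f s" "card S * R"] by simp
qed

text \<open>Apply the functional \<theta> to both sides. For each of the \<open>card Q\<close>
  evaluation points, a simple tensor on the right becomes a function of \<open>j\<close> times a
  function of \<open>k\<close>. The terms \<open>t\<close>, \<open>g\<close>, \<open>h\<close> are
  constant, dependent on \<open>j\<close> alone and dependent on \<open>k\<close> alone, and each
  raises the rank by at most one. The values of \<theta> on the blocks thus form a triangular matrix
  of rank at most \<open>card Q * r + 3\<close>.\<close>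

lemma triangular_block_card:
  assumes Q: "finite Q"
    and eq: "\<And>(j::nat) k p q. j < n \<Longrightarrow> k < n \<Longrightarrow> (p, q) \<in> Q \<Longrightarrow>
      G j k p q + (t p q :: complex) + g p q j + h p q k = (\<Sum>l<r. \<alpha> l * \<beta> l p j * \<gamma> l q k)"
    and tri: "\<And>j k. j < k \<Longrightarrow> k < n \<Longrightarrow> (\<Sum>(p, q)\<in>Q. \<theta> (p, q) * G j k p q) = 0"
  shows "card {j. j < n \<and> (\<Sum>(p, q)\<in>Q. \<theta> (p, q) * G j j p q) \<noteq> 0} \<le> card Q * r + 3"
proof -
  \<comment> \<open>These are the values of \<theta> on the blocks, solved for by \<open>eq\<close>
    and written as sums of products. They are defined for all \<open>j\<close> and \<open>k\<close>,
    but agree with the block values only below \<open>n\<close>.\<close>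
  define f where "f j k = (\<Sum>x\<in>Q. \<Sum>l<r. (\<theta> x * \<alpha> l * \<beta> l (fst x) j) * \<gamma> l (snd x) k)
    + (\<Sum>x\<in>Q. - \<theta> x * t (fst x) (snd x)) * 1
    + (\<Sum>x\<in>Q. - \<theta> x * g (fst x) (snd x) j) * 1
    + 1 * (\<Sum>x\<in>Q. - \<theta> x * h (fst x) (snd x) k)" for j k
  have "matrix_rank_le (card Q * (card {..<r} * 1) + 1 + 1 + 1) f"
    unfolding f_def
    by (intro matrix_rank_le_add matrix_rank_le_sum matrix_rank_le_prod Q finite_lessThan)
  moreover have "card Q * (card {..<r} * 1) + 1 + 1 + 1 = card Q * r + 3" by simp
  ultimately have "matrix_rank_le (card Q * r + 3) f" by (simp only:)
  then obtain u v where uv: "f j k = (\<Sum>s<card Q * r + 3. u s j * v s k)" for j k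
    unfolding matrix_rank_le_def by auto
  have f: "(\<Sum>(p, q)\<in>Q. \<theta> (p, q) * G j k p q) = f j k" if "j < n" "k < n" for j k
  proof -
    have "(\<Sum>(p, q)\<in>Q. \<theta> (p, q) * G j k p q) = (\<Sum>x\<in>Q. \<theta> x *
       ((\<Sum>l<r. \<alpha> l * \<beta> l (fst x) j * \<gamma> l (snd x) k) - t (fst x) (snd x)
          - g (fst x) (snd x) j - h (fst x) (snd x) k))"
    proof (rule sum.cong, simp, clarify)
      fix p q assume "(p, q) \<in> Q"
      from eq[OF that this, symmetric] show "\<theta> (p, q) * G j k p q = \<theta> (p, q) *
       ((\<Sum>l<r. \<alpha> l * \<beta> l (fst (p, q)) j * \<gamma> l (snd (p, q)) k) - t (fst (p, q)) (snd (p, q))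
          - g (fst (p, q)) (snd (p, q)) j - h (fst (p, q)) (snd (p, q)) k)" by simp
    qed
    then show ?thesis
      by (simp add: f_def right_diff_distrib sum_subtractf sum_distrib_left sum_negf mult_ac)
  qed
  have "card {j. j < n \<and> f j j \<noteq> 0} \<le> card Q * r + 3"
    unfolding uv
  proof (rule triangular_diagonal_card)
    fix j k assume "j < k" "k < n"
    then show "(\<Sum>s<card Q * r + 3. u s j * v s k) = 0"
      using tri[of j k] f[of j k] uv[of j k] by simp
  qed
  moreover have "{j. j < n \<and> (\<Sum>(p, q)\<in>Q. \<theta> (p, q) * G j j p q) \<noteq> 0} = {j. j < n \<and> f j j \<noteq> 0}"
    using f by auto
  ultimately show ?thesis by simp
qed

text \<open>Each line in direction \<kappa> contains at most \<open>R\<close> bad tuples, so at most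
  \<open>n ^ (card K - 1) * R\<close> tuples are bad for \<kappa>. Summed over \<open>K\<close> this
  is less than the number \<open>n ^ card K\<close> of all tuples.\<close>

lemma exists_avoiding:
  assumes K: "finite K"
    and bad: "\<And>\<kappa> i. \<kappa> \<in> K \<Longrightarrow> i \<in> PiE K (\<lambda>_. {..<n}) \<Longrightarrow> card {j. j < n \<and> Bad \<kappa> (i(\<kappa> := j))} \<le> R"
    and n: "card K * R < n"
  shows "\<exists>i \<in> PiE K (\<lambda>_. {..<n::nat}). \<forall>\<kappa>\<in>K. \<not> Bad \<kappa> i"
proof (rule ccontr)
  let ?E = "PiE K (\<lambda>_. {..<n})"
  assume neg: "\<not> ?thesis"
  have fE: "finite ?E" using K by (intro finite_PiE) auto
  have cE: "card ?E = n ^ card K" using K by (simp add: card_PiE)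
  have ne: "?E \<noteq> {}" using n by (auto simp: PiE_eq_empty_iff)
  \<comment> \<open>For empty \<open>K\<close> any tuple would do. Nonemptiness lets
    \<open>n * n ^ (card K - 1)\<close> collapse to \<open>n ^ card K\<close> at the end.\<close>
  have K0: "K \<noteq> {}" using neg ne by auto
  have one: "card {i \<in> ?E. Bad \<kappa> i} \<le> n ^ (card K - 1) * R" if \<kappa>: "\<kappa> \<in> K" for \<kappa>
  proof -
    let ?E' = "PiE (K - {\<kappa>}) (\<lambda>_. {..<n})"
    let ?B = "\<lambda>i. {j. j < n \<and> Bad \<kappa> (i(\<kappa> := j))}"
    \<comment> \<open>Splits a tuple into the line in direction \<kappa> through it and its position
      on that line. The value \<open>undefined\<close> is the one that \<open>PiE\<close> prescribes
      outside the remaining digits.\<close>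
    let ?\<Phi> = "\<lambda>i. (i(\<kappa> := undefined), i \<kappa>)"
    have fE': "finite ?E'" using K by (intro finite_PiE) auto
    have B: "card (?B i) \<le> R" if "i \<in> ?E'" for i
    proof -
      \<comment> \<open>The hypothesis \<open>bad\<close> speaks of full tuples; any digit below
        \<open>n\<close> may be filled in, since the line stays the same.\<close>
      have "i(\<kappa> := 0) \<in> ?E" using that n \<kappa> by (auto simp: PiE_iff extensional_def)
      then show ?thesis using bad[OF \<kappa>, of "i(\<kappa> := 0)"] by simp
    qed
    have "inj_on ?\<Phi> {i \<in> ?E. Bad \<kappa> i}"
      by (rule inj_onI) (metis fun_upd_triv fun_upd_upd prod.inject)
    moreover have "?\<Phi> ` {i \<in> ?E. Bad \<kappa> i} \<subseteq> Sigma ?E' ?B"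
      using \<kappa> by (auto simp: PiE_iff extensional_def split: if_splits)
    moreover have fS: "finite (Sigma ?E' ?B)" using fE' by (intro finite_SigmaI) auto
    ultimately have "card {i \<in> ?E. Bad \<kappa> i} \<le> card (Sigma ?E' ?B)"
      by (intro card_inj_on_le[of ?\<Phi>])
    also have "\<dots> = (\<Sum>i\<in>?E'. card (?B i))" using fE' by (intro card_SigmaI) auto
    also have "\<dots> \<le> card ?E' * R" using sum_bounded_above[of ?E', OF B] by simp
    also have "card ?E' = n ^ (card K - 1)" using K \<kappa> by (simp add: card_PiE)
    finally show ?thesis .
  qed
  have "?E \<subseteq> (\<Union>\<kappa>\<in>K. {i \<in> ?E. Bad \<kappa> i})" using neg by blast
  then have "card ?E \<le> card (\<Union>\<kappa>\<in>K. {i \<in> ?E. Bad \<kappa> i})"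
    using K fE by (intro card_mono) auto
  also have "\<dots> \<le> (\<Sum>\<kappa>\<in>K. card {i \<in> ?E. Bad \<kappa> i})" using K by (rule card_UN_le)
  also have "\<dots> \<le> card K * (n ^ (card K - 1) * R)"
    using sum_bounded_above[of K, OF one] by simp
  also have "\<dots> = (card K * R) * n ^ (card K - 1)" by simp
  also have "\<dots> < n * n ^ (card K - 1)" using n by simp
  also have "\<dots> = n ^ card K" using K K0 by (simp add: card_gt_0_iff flip: power_Suc)
  finally show False using cE by simp
qed

text \<open>The substitution method: every coordinate \<open>Inr j\<close> is eliminated at the cost of one rank one
  term, by substituting for it so that this term vanishes.\<close>

lemma eliminate_coordinates:
  assumes "finite L" and X: "cfun.subspace X"
    and "\<And>s p. F s p = (\<Sum>l\<in>L. \<alpha> l s * \<delta> l p)"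
    and "\<And>l. l \<in> L \<Longrightarrow> (\<lambda>i. \<alpha> l (Inl i)) \<in> X"
    and "\<And>c. (\<And>p. (\<Sum>j<m. c j * F (Inr j) p) = 0) \<Longrightarrow> \<forall>j<m. c j = 0"
  shows "\<exists>L' \<rho> \<alpha>'. L' \<subseteq> L \<and> card L' + m = card L \<and> (\<forall>j<m. \<rho> j \<in> X) \<and> (\<forall>l\<in>L'. \<alpha>' l \<in> X) \<and>
    (\<forall>i p. F (Inl i) p + (\<Sum>j<m. \<rho> j i * F (Inr j) p) = (\<Sum>l\<in>L'. \<alpha>' l i * \<delta> l p))"
  using assms(1,3-)
proof (induction m arbitrary: L \<alpha> F)
  case 0
  show ?case
    by (rule exI[of _ L], rule exI[of _ "\<lambda>_. 0"], rule exI[of _ "\<lambda>l i. \<alpha> l (Inl i)"])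
      (use 0 in auto)
next
  case (Suc m)
  note fin = Suc.prems(1) and F = Suc.prems(2) and \<alpha>X = Suc.prems(3) and ind = Suc.prems(4)
  \<comment> \<open>Otherwise the slice at \<open>Inr m\<close> would be zero, against the
    independence of the slices.\<close>
  have "\<exists>l0\<in>L. \<alpha> l0 (Inr m) \<noteq> 0"
  proof (rule ccontr)
    assume "\<not> ?thesis"
    then have "F (Inr m) p = 0" for p unfolding F by (intro sum.neutral) auto
    then have "\<forall>j<Suc m. (if j = m then 1 else 0 :: complex) = 0"
      by (intro ind) (auto intro!: sum.neutral)
    then show False by auto
  qed
  then obtain l0 where l0: "l0 \<in> L" "\<alpha> l0 (Inr m) \<noteq> 0" by blast
  define a where "a = \<alpha> l0 (Inr m)"
  have a: "a \<noteq> 0" using l0 by (simp add: a_def)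
  \<comment> \<open>From every slice a multiple of the slice at \<open>Inr m\<close> is subtracted
    so that its \<open>l0\<close> coefficient becomes zero. The term \<open>l0\<close> then drops
    out of the decomposition.\<close>
  define \<alpha>1 where "\<alpha>1 l s = \<alpha> l s - \<alpha> l (Inr m) / a * \<alpha> l0 s" for l s
  define F1 where "F1 s p = F s p - \<alpha> l0 s / a * F (Inr m) p" for s p
  have F1: "F1 s p = (\<Sum>l\<in>L - {l0}. \<alpha>1 l s * \<delta> l p)" for s p
  proof -
    have "F1 s p = (\<Sum>l\<in>L. \<alpha>1 l s * \<delta> l p)"
      by (simp add: F1_def F \<alpha>1_def algebra_simps sum_subtractf sum_distrib_left)
    also have "\<dots> = (\<Sum>l\<in>L - {l0}. \<alpha>1 l s * \<delta> l p)"
      using fin l0 a by (simp add: sum.remove[of L l0] \<alpha>1_def a_def[symmetric])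
    finally show ?thesis .
  qed
  have "\<exists>L' \<rho> \<alpha>'. L' \<subseteq> L - {l0} \<and> card L' + m = card (L - {l0}) \<and> (\<forall>j<m. \<rho> j \<in> X) \<and>
    (\<forall>l\<in>L'. \<alpha>' l \<in> X) \<and>
    (\<forall>i p. F1 (Inl i) p + (\<Sum>j<m. \<rho> j i * F1 (Inr j) p) = (\<Sum>l\<in>L'. \<alpha>' l i * \<delta> l p))"
  proof (rule Suc.IH[where \<alpha> = \<alpha>1])
    show "finite (L - {l0})" using fin by simp
    show "F1 s p = (\<Sum>l\<in>L - {l0}. \<alpha>1 l s * \<delta> l p)" for s p by (rule F1)
    show "(\<lambda>i. \<alpha>1 l (Inl i)) \<in> X" if "l \<in> L - {l0}" for l
    proof -
      have "(\<lambda>i. \<alpha>1 l (Inl i)) = (\<lambda>i. \<alpha> l (Inl i)) - cscale (\<alpha> l (Inr m) / a) (\<lambda>i. \<alpha> l0 (Inl i))"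
        by (simp add: \<alpha>1_def fun_eq_iff cscale_apply)
      then show ?thesis
        using cfun.subspace_diff[OF X \<alpha>X cfun.subspace_scale[OF X \<alpha>X]] that l0 by auto
    qed
    fix c assume c: "\<And>p. (\<Sum>j<m. c j * F1 (Inr j) p) = 0"
    \<comment> \<open>With this coefficient at \<open>Inr m\<close>, a relation among the slices of
      \<open>F1\<close> becomes one among the slices of \<open>F\<close>, so independence is
      inherited.\<close>
    define b where "b = - (\<Sum>j<m. c j * (\<alpha> l0 (Inr j) / a))"
    have "\<forall>j<Suc m. (if j < m then c j else b) = 0"
    proof (rule ind)
      fix p
      have "(\<Sum>j<Suc m. (if j < m then c j else b) * F (Inr j) p)
        = (\<Sum>j<m. c j * F (Inr j) p) + b * F (Inr m) p" by simp
      also have "\<dots> = (\<Sum>j<m. c j * F1 (Inr j) p)"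
        by (simp add: F1_def b_def right_diff_distrib sum_subtractf sum_distrib_left sum_distrib_right mult_ac)
      finally show "(\<Sum>j<Suc m. (if j < m then c j else b) * F (Inr j) p) = 0" using c by simp
    qed
    then show "\<forall>j<m. c j = 0" by (metis less_SucI)
  qed
  then obtain L' \<rho> \<alpha>' where L': "L' \<subseteq> L - {l0}" "card L' + m = card (L - {l0})"
    and \<rho>: "\<forall>j<m. \<rho> j \<in> X" and \<alpha>': "\<forall>l\<in>L'. \<alpha>' l \<in> X"
    and eq: "\<forall>i p. F1 (Inl i) p + (\<Sum>j<m. \<rho> j i * F1 (Inr j) p) = (\<Sum>l\<in>L'. \<alpha>' l i * \<delta> l p)"
    by (elim exE conjE)
  \<comment> \<open>Once \<open>F1\<close> is expanded in terms of \<open>F\<close>, \<sigma> is the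
    total coefficient of the slice at \<open>Inr m\<close>.\<close>
  define \<sigma> where "\<sigma> = cscale (- 1 / a) ((\<lambda>i. \<alpha> l0 (Inl i)) + (\<Sum>j<m. cscale (\<alpha> l0 (Inr j)) (\<rho> j)))"
  have \<sigma>X: "\<sigma> \<in> X"
    unfolding \<sigma>_def using \<rho> l0
    by (intro cfun.subspace_scale cfun.subspace_add cfun.subspace_sum X \<alpha>X) auto
  have \<sigma>: "\<sigma> i = - (\<alpha> l0 (Inl i) / a) - (\<Sum>j<m. \<rho> j i * (\<alpha> l0 (Inr j) / a))" for i
    by (simp add: \<sigma>_def cscale_apply sum_fun_apply sum_distrib_left distrib_left sum_divide_distrib
        sum_negf mult_ac)
  have "\<forall>i p. F (Inl i) p + (\<Sum>j<Suc m. (if j < m then \<rho> j else \<sigma>) i * F (Inr j) p)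
      = (\<Sum>l\<in>L'. \<alpha>' l i * \<delta> l p)"
  proof (intro allI)
    fix i p
    have "F (Inl i) p + (\<Sum>j<Suc m. (if j < m then \<rho> j else \<sigma>) i * F (Inr j) p)
      = F (Inl i) p + (\<Sum>j<m. \<rho> j i * F (Inr j) p) + \<sigma> i * F (Inr m) p" by simp
    also have "\<dots> = F1 (Inl i) p + (\<Sum>j<m. \<rho> j i * F1 (Inr j) p)"
      by (simp add: F1_def \<sigma> right_diff_distrib left_diff_distrib sum_subtractf sum_distrib_left sum_distrib_right mult_ac)
    finally show "F (Inl i) p + (\<Sum>j<Suc m. (if j < m then \<rho> j else \<sigma>) i * F (Inr j) p)
      = (\<Sum>l\<in>L'. \<alpha>' l i * \<delta> l p)"
      using eq by simp
  qed
  moreover have "card L' + Suc m = card L" using L'(2) card_Suc_Diff1[OF fin l0(1)] by simp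
  moreover have "L' \<subseteq> L" using L' by auto
  moreover have "\<forall>j<Suc m. (if j < m then \<rho> j else \<sigma>) \<in> X" using \<rho> \<sigma>X by auto
  ultimately show ?case using \<alpha>'
    by (intro exI[of _ L'] exI[of _ "\<lambda>j. if j < m then \<rho> j else \<sigma>"] exI[of _ \<alpha>'] conjI)
qed

section \<open>Rank, modifications and augmented tensors\<close>

definition rank_le ::
  "('i \<Rightarrow> complex) set \<Rightarrow> ('j \<Rightarrow> complex) set \<Rightarrow> ('k \<Rightarrow> complex) set \<Rightarrow> nat
    \<Rightarrow> ('i \<times> 'j \<times> 'k \<Rightarrow> complex) \<Rightarrow> bool" where
  "rank_le X Y Z r T \<longleftrightarrow> (\<exists>a b c. (\<forall>l<r. a l \<in> X \<and> b l \<in> Y \<and> c l \<in> Z) \<and>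
    (\<forall>i j k. T (i, j, k) = (\<Sum>l<r. a l i * b l j * c l k)))"

lemma tensor_rank_eq: "tensor_rank X Y Z T = (LEAST r. rank_le X Y Z r T)"
  by (simp add: tensor_rank_def rank_le_def fun_eq_iff sum_fun_apply tensor3_def)

lemma rank_leI:
  assumes L: "finite L" and mem: "\<And>l. l \<in> L \<Longrightarrow> a l \<in> X \<and> b l \<in> Y \<and> c l \<in> Z"
    and T: "\<And>i j k. T (i, j, k) = (\<Sum>l\<in>L. a l i * b l j * c l k)"
  shows "rank_le X Y Z (card L) T"
proof -
  obtain h where h: "bij_betw h {..<card L} L"
    using ex_bij_betw_nat_finite[OF L] by (auto simp: atLeast0LessThan)
  have "h l \<in> L" if "l < card L" for l using h that by (auto simp: bij_betw_def)
  moreover have "T (i, j, k) = (\<Sum>l<card L. a (h l) i * b (h l) j * c (h l) k)" for i j k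
    unfolding T using sum.reindex_bij_betw[OF h, of "\<lambda>l. a l i * b l j * c l k"] by simp
  ultimately show ?thesis
    unfolding rank_le_def using mem
    by (intro exI[of _ "\<lambda>l. a (h l)"] exI[of _ "\<lambda>l. b (h l)"] exI[of _ "\<lambda>l. c (h l)"]) blast
qed

lemma rank_le_add:
  assumes "rank_le X Y Z r T" "rank_le X Y Z s T'"
  shows "rank_le X Y Z (r + s) (T + T')"
proof -
  obtain a b c where abc: "\<forall>l<r. a l \<in> X \<and> b l \<in> Y \<and> c l \<in> Z"
    and T: "\<forall>i j k. T (i, j, k) = (\<Sum>l<r. a l i * b l j * c l k)"
    using assms(1) unfolding rank_le_def by (elim exE conjE)
  obtain a' b' c' where abc': "\<forall>l<s. a' l \<in> X \<and> b' l \<in> Y \<and> c' l \<in> Z"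
    and T': "\<forall>i j k. T' (i, j, k) = (\<Sum>l<s. a' l i * b' l j * c' l k)"
    using assms(2) unfolding rank_le_def by (elim exE conjE)
  have "rank_le X Y Z (card ({..<r} <+> {..<s})) (T + T')"
    by (rule rank_leI[where a = "case_sum a a'" and b = "case_sum b b'" and c = "case_sum c c'"])
      (use abc abc' T T' in \<open>auto simp: sum.Plus\<close>)
  then show ?thesis by (simp add: card_Plus)
qed

lemma rank_le_0: "rank_le X Y Z 0 0"
  by (simp add: rank_le_def)

text \<open>Without a witness the \<open>LEAST\<close> in \<open>tensor_rank\<close> would carry no
  information. Scalars of a linear combination are absorbed into the first factor.\<close>

lemma tprod3_rank_le:
  assumes X: "cfun.subspace X" and "T \<in> tprod3 X Y Z"
  shows "\<exists>r. rank_le X Y Z r T"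
  using assms(2) unfolding tprod3_def
proof (induction rule: cfun.span_induct_alt)
  case base
  show ?case using rank_le_0 by blast
next
  case (step r t T)
  then obtain x y z where t: "t = tensor3 x y z" "x \<in> X" "y \<in> Y" "z \<in> Z" by blast
  have "rank_le X Y Z (card {()}) (cscale r t)"
    by (rule rank_leI[where a = "\<lambda>_. cscale r x" and b = "\<lambda>_. y" and c = "\<lambda>_. z"])
      (use t X in \<open>auto simp: tensor3_def cscale_apply intro: cfun.subspace_scale\<close>)
  then show ?case using step rank_le_add by blast
qed

lemma tensor3_in_tprod3: "x \<in> X \<Longrightarrow> y \<in> Y \<Longrightarrow> z \<in> Z \<Longrightarrow> tensor3 x y z \<in> tprod3 X Y Z"
  unfolding tprod3_def by (intro cfun.span_base) blast

lemma subspace_tprod3: "cfun.subspace (tprod3 X Y Z)"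
  by (simp add: tprod3_def)

lemma ins_in_tprod3:
  fixes X :: "('i \<Rightarrow> complex) set" and Y :: "('j \<Rightarrow> complex) set" and Z :: "('k \<Rightarrow> complex) set"
  shows "a \<in> X \<Longrightarrow> u \<in> tprod2 Y Z \<Longrightarrow> ins1 a u \<in> tprod3 X Y Z"
    and "b \<in> Y \<Longrightarrow> v \<in> tprod2 X Z \<Longrightarrow> ins2 b v \<in> tprod3 X Y Z"
    and "c \<in> Z \<Longrightarrow> w \<in> tprod2 X Y \<Longrightarrow> ins3 c w \<in> tprod3 X Y Z"
proof -
  show "ins1 a u \<in> tprod3 X Y Z" if a: "a \<in> X" and u: "u \<in> tprod2 Y Z"
    using u unfolding tprod2_def
  proof (induction rule: cfun.span_induct_alt)
    case base
    have "ins1 a (0 :: 'j \<times> 'k \<Rightarrow> complex) = 0" by (auto simp: ins1_def fun_eq_iff)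
    then show ?case by (simp only: cfun.subspace_0[OF subspace_tprod3])
  next
    case (step r t v)
    then obtain y z where t: "t = tensor2 y z" "y \<in> Y" "z \<in> Z" by blast
    have "ins1 a (cscale r t + v) = cscale r (tensor3 a y z) + ins1 a v"
      by (auto simp: ins1_def t(1) tensor2_def tensor3_def fun_eq_iff cscale_apply algebra_simps)
    moreover have "tensor3 a y z \<in> tprod3 X Y Z" by (intro tensor3_in_tprod3 a t)
    ultimately show ?case using step by (simp only: cfun.subspace_add[OF subspace_tprod3] cfun.subspace_scale[OF subspace_tprod3])
  qed
  show "ins2 b u \<in> tprod3 X Y Z" if a: "b \<in> Y" and u: "u \<in> tprod2 X Z" for u
    using u unfolding tprod2_def
  proof (induction rule: cfun.span_induct_alt)
    case base
    have "ins2 b (0 :: 'i \<times> 'k \<Rightarrow> complex) = 0" by (auto simp: ins2_def fun_eq_iff)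
    then show ?case by (simp only: cfun.subspace_0[OF subspace_tprod3])
  next
    case (step r t v)
    then obtain y z where t: "t = tensor2 y z" "y \<in> X" "z \<in> Z" by blast
    have "ins2 b (cscale r t + v) = cscale r (tensor3 y b z) + ins2 b v"
      by (auto simp: ins2_def t(1) tensor2_def tensor3_def fun_eq_iff cscale_apply algebra_simps)
    moreover have "tensor3 y b z \<in> tprod3 X Y Z" by (intro tensor3_in_tprod3 a t)
    ultimately show ?case using step by (simp only: cfun.subspace_add[OF subspace_tprod3] cfun.subspace_scale[OF subspace_tprod3])
  qed
  show "ins3 c u \<in> tprod3 X Y Z" if a: "c \<in> Z" and u: "u \<in> tprod2 X Y" for u
    using u unfolding tprod2_def
  proof (induction rule: cfun.span_induct_alt)
    case base
    have "ins3 c (0 :: 'i \<times> 'j \<Rightarrow> complex) = 0" by (auto simp: ins3_def fun_eq_iff)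
    then show ?case by (simp only: cfun.subspace_0[OF subspace_tprod3])
  next
    case (step r t v)
    then obtain y z where t: "t = tensor2 y z" "y \<in> X" "z \<in> Y" by blast
    have "ins3 c (cscale r t + v) = cscale r (tensor3 y z c) + ins3 c v"
      by (auto simp: ins3_def t(1) tensor2_def tensor3_def fun_eq_iff cscale_apply algebra_simps)
    moreover have "tensor3 y z c \<in> tprod3 X Y Z" by (intro tensor3_in_tprod3 a t)
    ultimately show ?case using step by (simp only: cfun.subspace_add[OF subspace_tprod3] cfun.subspace_scale[OF subspace_tprod3])
  qed
qed

text \<open>Ensures that every modification has a decomposition, so that its
  \<open>tensor_rank\<close> is an attained minimum.\<close>

lemma modifications_subset:
  assumes "T \<in> tprod3 X Y Z" "WX \<subseteq> tprod2 Y Z" "WY \<subseteq> tprod2 X Z" "WZ \<subseteq> tprod2 X Y"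
  shows "modifications X Y Z T WX WY WZ \<subseteq> tprod3 X Y Z"
proof
  fix T' assume "T' \<in> modifications X Y Z T WX WY WZ"
  then obtain p q r a u b v c w where
    m: "\<forall>l<p. a l \<in> X \<and> u l \<in> WX" "\<forall>l<q. b l \<in> Y \<and> v l \<in> WY" "\<forall>l<r. c l \<in> Z \<and> w l \<in> WZ"
    and T': "T' = T + (\<Sum>l<(p::nat). ins1 (a l) (u l)) + (\<Sum>l<(q::nat). ins2 (b l) (v l))
      + (\<Sum>l<(r::nat). ins3 (c l) (w l))"
    unfolding modifications_def by blast
  have "(\<Sum>l<p. ins1 (a l) (u l)) \<in> tprod3 X Y Z"
    using m(1) assms(2) by (intro cfun.subspace_sum[OF subspace_tprod3] ins_in_tprod3) auto
  moreover have "(\<Sum>l<q. ins2 (b l) (v l)) \<in> tprod3 X Y Z"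
    using m(2) assms(3) by (intro cfun.subspace_sum[OF subspace_tprod3] ins_in_tprod3) auto
  moreover have "(\<Sum>l<r. ins3 (c l) (w l)) \<in> tprod3 X Y Z"
    using m(3) assms(4) by (intro cfun.subspace_sum[OF subspace_tprod3] ins_in_tprod3) auto
  ultimately show "T' \<in> tprod3 X Y Z"
    unfolding T' using assms(1) by (intro cfun.subspace_add[OF subspace_tprod3])
qed

section \<open>Minimal rank of modifications\<close>

definition mod_rank_le ::
  "('i \<Rightarrow> complex) set \<Rightarrow> ('j \<Rightarrow> complex) set \<Rightarrow> ('k \<Rightarrow> complex) set
    \<Rightarrow> ('i \<times> 'j \<times> 'k \<Rightarrow> complex)
    \<Rightarrow> ('j \<times> 'k \<Rightarrow> complex) set \<Rightarrow> ('i \<times> 'k \<Rightarrow> complex) set \<Rightarrow> ('i \<times> 'j \<Rightarrow> complex) set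
    \<Rightarrow> nat \<Rightarrow> bool" where
  "mod_rank_le X Y Z T WX WY WZ r \<longleftrightarrow> (\<exists>T'\<in>modifications X Y Z T WX WY WZ. rank_le X Y Z r T')"

lemma mod_rank_leI:
  assumes "rank_le X Y Z r T'"
    and fin: "finite S1" "finite S2" "finite S3"
    and 1: "\<And>l. l \<in> S1 \<Longrightarrow> a l \<in> X \<and> u l \<in> WX"
    and 2: "\<And>l. l \<in> S2 \<Longrightarrow> b l \<in> Y \<and> v l \<in> WY"
    and 3: "\<And>l. l \<in> S3 \<Longrightarrow> c l \<in> Z \<and> w l \<in> WZ"
    and T': "\<And>i j k. T' (i, j, k) = T (i, j, k) + (\<Sum>l\<in>S1. a l i * u l (j, k))
      + (\<Sum>l\<in>S2. b l j * v l (i, k)) + (\<Sum>l\<in>S3. c l k * w l (i, j))"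
  shows "mod_rank_le X Y Z T WX WY WZ r"
proof -
  obtain h1 where h1: "bij_betw h1 {..<card S1} S1"
    using ex_bij_betw_nat_finite[OF fin(1)] by (auto simp: atLeast0LessThan)
  obtain h2 where h2: "bij_betw h2 {..<card S2} S2"
    using ex_bij_betw_nat_finite[OF fin(2)] by (auto simp: atLeast0LessThan)
  obtain h3 where h3: "bij_betw h3 {..<card S3} S3"
    using ex_bij_betw_nat_finite[OF fin(3)] by (auto simp: atLeast0LessThan)
  have eq: "T' = T + (\<Sum>l<card S1. ins1 (a (h1 l)) (u (h1 l))) + (\<Sum>l<card S2. ins2 (b (h2 l)) (v (h2 l)))
      + (\<Sum>l<card S3. ins3 (c (h3 l)) (w (h3 l)))"
  proof (rule ext, clarify)
    fix i j k
    show "T' (i, j, k) = (T + (\<Sum>l<card S1. ins1 (a (h1 l)) (u (h1 l)))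
      + (\<Sum>l<card S2. ins2 (b (h2 l)) (v (h2 l))) + (\<Sum>l<card S3. ins3 (c (h3 l)) (w (h3 l)))) (i, j, k)"
      using sum.reindex_bij_betw[OF h1, of "\<lambda>l. a l i * u l (j, k)"]
        sum.reindex_bij_betw[OF h2, of "\<lambda>l. b l j * v l (i, k)"]
        sum.reindex_bij_betw[OF h3, of "\<lambda>l. c l k * w l (i, j)"]
      by (simp add: T' sum_fun_apply ins1_def ins2_def ins3_def mult.commute)
  qed
  have "\<forall>l<card S1. a (h1 l) \<in> X \<and> u (h1 l) \<in> WX" "\<forall>l<card S2. b (h2 l) \<in> Y \<and> v (h2 l) \<in> WY"
    "\<forall>l<card S3. c (h3 l) \<in> Z \<and> w (h3 l) \<in> WZ"
    using bij_betwE[OF h1] bij_betwE[OF h2] bij_betwE[OF h3] 1 2 3 by blast+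
  then have "T' \<in> modifications X Y Z T WX WY WZ"
    unfolding modifications_def mem_Collect_eq
    by (intro exI conjI) (rule eq)
  then show ?thesis using assms(1) unfolding mod_rank_le_def by blast
qed

lemma mod_rank_leE:
  assumes "mod_rank_le X Y Z T WX WY WZ r"
  obtains \<alpha> \<beta> \<gamma> p a u q b v s c w where
    "\<forall>l<r. \<alpha> l \<in> X \<and> \<beta> l \<in> Y \<and> \<gamma> l \<in> Z"
    "\<forall>l<p. a l \<in> X \<and> u l \<in> WX" "\<forall>l<q. b l \<in> Y \<and> v l \<in> WY" "\<forall>l<s. c l \<in> Z \<and> w l \<in> WZ"
    "\<forall>i j k. T (i, j, k) + (\<Sum>l<(p::nat). a l i * u l (j, k)) + (\<Sum>l<(q::nat). b l j * v l (i, k))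
      + (\<Sum>l<(s::nat). c l k * w l (i, j)) = (\<Sum>l<r. \<alpha> l i * \<beta> l j * \<gamma> l k)"
proof -
  obtain T' where T': "T' \<in> modifications X Y Z T WX WY WZ" and rk: "rank_le X Y Z r T'"
    using assms unfolding mod_rank_le_def by blast
  obtain p q s a u b v c w where
    m: "\<forall>l<p. a l \<in> X \<and> u l \<in> WX" "\<forall>l<q. b l \<in> Y \<and> v l \<in> WY" "\<forall>l<s. c l \<in> Z \<and> w l \<in> WZ"
    and eq: "T' = T + (\<Sum>l<(p::nat). ins1 (a l) (u l)) + (\<Sum>l<(q::nat). ins2 (b l) (v l))
      + (\<Sum>l<(s::nat). ins3 (c l) (w l))"
    using T' unfolding modifications_def by blast
  obtain \<alpha> \<beta> \<gamma> where abc: "\<forall>l<r. \<alpha> l \<in> X \<and> \<beta> l \<in> Y \<and> \<gamma> l \<in> Z"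
    and dec: "\<forall>i j k. T' (i, j, k) = (\<Sum>l<r. \<alpha> l i * \<beta> l j * \<gamma> l k)"
    using rk unfolding rank_le_def by (elim exE conjE)
  have "T (i, j, k) + (\<Sum>l<p. a l i * u l (j, k)) + (\<Sum>l<q. b l j * v l (i, k))
      + (\<Sum>l<s. c l k * w l (i, j)) = T' (i, j, k)" for i j k
    by (simp add: eq sum_fun_apply ins1_def ins2_def ins3_def mult.commute)
  with dec have "\<forall>i j k. T (i, j, k) + (\<Sum>l<p. a l i * u l (j, k)) + (\<Sum>l<q. b l j * v l (i, k))
      + (\<Sum>l<s. c l k * w l (i, j)) = (\<Sum>l<r. \<alpha> l i * \<beta> l j * \<gamma> l k)" by simp
  from abc m this show thesis by (rule that)
qed

text \<open>\<open>min_rank_mod\<close> is a minimum of \<open>tensor_rank\<close>, itself a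
  minimum. Both are attained, so they merge into a single \<open>LEAST\<close> over
  \<open>mod_rank_le\<close>.\<close>

lemma min_rank_mod_eq:
  assumes "cfun.subspace X" "T \<in> tprod3 X Y Z"
    "WX \<subseteq> tprod2 Y Z" "WY \<subseteq> tprod2 X Z" "WZ \<subseteq> tprod2 X Y"
  shows "min_rank_mod X Y Z T WX WY WZ = (LEAST r. mod_rank_le X Y Z T WX WY WZ r)"
    and "mod_rank_le X Y Z T WX WY WZ (min_rank_mod X Y Z T WX WY WZ)"
proof -
  let ?M = "modifications X Y Z T WX WY WZ"
  have ex: "\<exists>r. rank_le X Y Z r T'" if "T' \<in> ?M" for T'
    using tprod3_rank_le[OF assms(1)] modifications_subset[OF assms(2-)] that by blast
  have "T \<in> ?M"
    unfolding modifications_def mem_Collect_eq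
    by (intro exI[of _ "0::nat"] exI conjI) (auto simp: fun_eq_iff)
  then have T: "\<exists>r. \<exists>T'\<in>?M. tensor_rank X Y Z T' = r" by blast
  have rk: "rank_le X Y Z (tensor_rank X Y Z T') T'" if "T' \<in> ?M" for T'
    unfolding tensor_rank_eq using ex[OF that] by (metis LeastI_ex)
  show 1: "mod_rank_le X Y Z T WX WY WZ (min_rank_mod X Y Z T WX WY WZ)"
    using LeastI_ex[OF T] rk unfolding min_rank_mod_def mod_rank_le_def by metis
  show "min_rank_mod X Y Z T WX WY WZ = (LEAST r. mod_rank_le X Y Z T WX WY WZ r)"
  proof (rule sym, rule Least_equality, rule 1)
    fix r assume "mod_rank_le X Y Z T WX WY WZ r"
    then obtain T' where T': "T' \<in> ?M" "rank_le X Y Z r T'" unfolding mod_rank_le_def by blast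
    have "min_rank_mod X Y Z T WX WY WZ \<le> tensor_rank X Y Z T'"
      unfolding min_rank_mod_def using T' by (intro Least_le) blast
    also have "\<dots> \<le> r" unfolding tensor_rank_eq using T' by (intro Least_le)
    finally show "min_rank_mod X Y Z T WX WY WZ \<le> r" .
  qed
qed

section \<open>The rank of augmented tensors\<close>

lemma augmented_simps:
  "augmented T us vs ws (Inl i, Inl j, Inl k) = T (i, j, k)"
  "augmented T us vs ws (Inr l, Inl j, Inl k) = (if l < length us then (us ! l) (j, k) else 0)"
  "augmented T us vs ws (Inl i, Inr l, Inl k) = (if l < length vs then (vs ! l) (i, k) else 0)"
  "augmented T us vs ws (Inl i, Inl j, Inr l) = (if l < length ws then (ws ! l) (i, j) else 0)"
  "augmented T us vs ws (Inr l, Inr l', x) = 0"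
  "augmented T us vs ws (Inr l, y, Inr l') = 0"
  "augmented T us vs ws (x', Inr l, Inr l') = 0"
  by (auto simp: augmented_def incl0_def incl1_def incl2_def incl3_def corr1_def corr2_def corr3_def
      ins1_def ins2_def ins3_def sum_fun_apply unit_vec_def if_distrib if_distribR cong: if_cong
      split: sum.splits)

lemma basis_list_independent:
  assumes "is_basis_list us U" "\<And>p. (\<Sum>j<length us. c j * (us ! j) p) = 0"
  shows "\<forall>j<length us. c j = 0"
proof (intro allI impI)
  fix j assume j: "j < length us"
  have d: "distinct us" and ind: "cfun.independent (set us)"
    using assms(1) by (auto simp: is_basis_list_def)
  have inj: "inj_on ((!) us) {..<length us}"
    using d by (auto simp: inj_on_def nth_eq_iff_index_eq)
  have im: "(!) us ` {..<length us} = set us"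
    by (auto simp: set_conv_nth)
  define f where "f v = c (inv_into {..<length us} ((!) us) v)" for v
  have f: "f (us ! l) = c l" if "l < length us" for l
    using inv_into_f_f[OF inj, of l] that by (simp add: f_def)
  have "(\<Sum>v\<in>set us. cscale (f v) v) = (\<Sum>l<length us. cscale (c l) (us ! l))"
    unfolding im[symmetric] by (subst sum.reindex[OF inj]) (auto intro!: sum.cong simp: f)
  also have "\<dots> = 0"
    using assms(2) by (simp add: fun_eq_iff sum_fun_apply cscale_apply)
  finally have "f (us ! j) = 0"
    using cfun.independentD[OF ind, of "set us" f "us ! j"] j by simp
  then show "c j = 0" using f j by simp
qed

lemma basis_list_length: "is_basis_list us U \<Longrightarrow> cfun.dim U = length us"
  unfolding is_basis_list_def
  by (metis cfun.dim_span_eq_card_independent distinct_card)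

text \<open>A basis can be chosen among the rank one generators, and it has the same length as
  \<open>us\<close>. The exact number of products matters, since it becomes the dimension term in
  the rank formula.\<close>

lemma rank_one_basis:
  assumes "spanned_by_rank_one Y Z M" "is_basis_list us M"
  obtains y z where "\<forall>s<length us. y s \<in> Y \<and> z s \<in> Z"
    "\<forall>u\<in>M. \<exists>c. \<forall>t. u t = (\<Sum>s<length us. c s * (y s (fst t) * z s (snd t)))"
proof -
  obtain R where R: "R \<subseteq> rank_one_tensors Y Z" "cfun.span R = M"
    using assms(1) by (auto simp: spanned_by_rank_one_def)
  obtain B where B: "B \<subseteq> R" "cfun.independent B" "R \<subseteq> cfun.span B"
    using cfun.maximal_independent_subset[of R] by blast
  have sB: "cfun.span B = M"
    using B R(2) cfun.span_mono[OF B(1)] cfun.span_minimal[OF B(3) cfun.subspace_span] by auto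
  have us: "cfun.span (set us) = M" using assms(2) by (auto simp: is_basis_list_def)
  have "finite B"
    using cfun.independent_span_bound[of "set us" B] B(2) us cfun.span_superset[of B] sB by auto
  then obtain bs where bs: "set bs = B" "distinct bs" using finite_distinct_list by blast
  have bl: "is_basis_list bs M" using bs B sB by (simp add: is_basis_list_def)
  have len: "length bs = length us"
    using basis_list_length[OF bl] basis_list_length[OF assms(2)] by simp
  have "\<forall>s. \<exists>y z. s < length us \<longrightarrow> bs ! s = tensor2 y z \<and> y \<in> Y \<and> z \<in> Z"
  proof
    fix s
    have "bs ! s \<in> rank_one_tensors Y Z" if "s < length us"
      using that bs(1) B(1) R(1) len by (metis nth_mem subsetD)
    then show "\<exists>y z. s < length us \<longrightarrow> bs ! s = tensor2 y z \<and> y \<in> Y \<and> z \<in> Z"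
      unfolding rank_one_tensors_def by blast
  qed
  then obtain y z where yz: "\<And>s. s < length us \<Longrightarrow> bs ! s = tensor2 (y s) (z s) \<and> y s \<in> Y \<and> z s \<in> Z"
    by metis
  have "\<exists>c. \<forall>t. u t = (\<Sum>s<length us. c s * (y s (fst t) * z s (snd t)))" if uM: "u \<in> M" for u
  proof -
    obtain r where "u = (\<Sum>l<length bs. cscale (r l) (bs ! l))"
      using uM unfolding basis_list_span[OF bl] by (elim CollectE exE conjE)
    then have "u t = (\<Sum>s<length us. r s * (y s (fst t) * z s (snd t)))" for t
      using yz by (cases t) (auto simp: len sum_fun_apply cscale_apply tensor2_def intro!: sum.cong)
    then show ?thesis by blast
  qed
  then show thesis using that[of y z] yz by blast
qed

text \<open>With \<rho> the rank one generators of \<open>M\<close>, the \<open>m\<close> simple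
  tensors of \<open>f s\<close> and \<rho>\<open>s\<close> do two things at once: their
  \<open>Inl\<close> part cancels a modification by \<open>M\<close>, and their \<open>Inr\<close>
  part is the tensor corresponding to the basis \<open>us\<close>. Cancelling thus costs no extra
  terms.\<close>

lemma absorb_modification:
  fixes \<rho> :: "nat \<Rightarrow> 'p \<Rightarrow> complex" and a :: "nat \<Rightarrow> 'i \<Rightarrow> complex"
  assumes X: "cfun.subspace X"
    and a: "\<And>l. l < p \<Longrightarrow> a l \<in> X" and u: "\<And>l. l < p \<Longrightarrow> u l \<in> M" and us: "set us \<subseteq> M"
    and M: "\<forall>u\<in>M. \<exists>c. \<forall>t. u t = (\<Sum>s<m. c s * \<rho> s t)"
  obtains f where "\<forall>s<m. f s \<in> dsum X (coord_space (length us))"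
    "\<forall>i t. (\<Sum>s<m. f s (Inl i) * \<rho> s t) = - (\<Sum>l<(p::nat). a l i * u l t)"
    "\<forall>j t. (\<Sum>s<m. f s (Inr j) * \<rho> s t) = (if j < length us then (us ! j) t else 0)"
proof -
  obtain C where C: "\<And>u t. u \<in> M \<Longrightarrow> u t = (\<Sum>s<m. C u s * \<rho> s t)"
    using M by metis
  \<comment> \<open>The coordinates of the \<open>u l\<close> and of the \<open>us ! j\<close> with
    respect to \<rho> are regrouped by generator: all that is multiplied by \<rho>\<open>s\<close>
    is collected into one vector.\<close>
  define g where "g s = (\<Sum>l<p. cscale (- C (u l) s) (a l))" for s
  define h where "h s j = (if j < length us then C (us ! j) s else 0)" for s j
  have "g s \<in> X" for s
    unfolding g_def using a by (intro cfun.subspace_sum cfun.subspace_scale X) auto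
  moreover have "h s \<in> coord_space (length us)" for s by (auto simp: h_def coord_space_def)
  ultimately have "case_sum (g s) (h s) \<in> dsum X (coord_space (length us))" for s
    unfolding dsum_def by blast
  moreover have "(\<Sum>s<m. case_sum (g s) (h s) (Inl i) * \<rho> s t) = - (\<Sum>l<p. a l i * u l t)" for i t
  proof -
    have "(\<Sum>l<p. a l i * u l t) = (\<Sum>l<p. a l i * (\<Sum>s<m. C (u l) s * \<rho> s t))"
      using u by (intro sum.cong) (auto simp flip: C)
    also have "\<dots> = (\<Sum>s<m. \<Sum>l<p. C (u l) s * a l i * \<rho> s t)"
      by (subst sum.swap) (simp add: sum_distrib_left mult_ac)
    also have "\<dots> = - (\<Sum>s<m. case_sum (g s) (h s) (Inl i) * \<rho> s t)"
      by (simp add: g_def sum_fun_apply cscale_apply sum_distrib_right sum_negf)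
    finally show ?thesis by simp
  qed
  moreover have "(\<Sum>s<m. case_sum (g s) (h s) (Inr j) * \<rho> s t)
      = (if j < length us then (us ! j) t else 0)" for j t
  proof (cases "j < length us")
    case True
    then have "us ! j \<in> M" using us by auto
    from C[OF this, of t] True show ?thesis by (simp add: h_def)
  qed (simp add: h_def)
  ultimately show thesis by (intro that[of "\<lambda>s. case_sum (g s) (h s)"]) simp_all
qed

lemma case_sum_in_dsum: "x \<in> X \<Longrightarrow> y \<in> Y \<Longrightarrow> case_sum x y \<in> dsum X Y"
  unfolding dsum_def by blast

lemma dsum_Inl: "x \<in> dsum X Y \<Longrightarrow> (\<lambda>i. x (Inl i)) \<in> X"
  by (auto simp: dsum_def)

text \<open>Write \<open>T\<close> as a modification of rank at most \<open>r\<close> minus its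
  modifying terms. Those terms are absorbed, for each space, into as many simple tensors as the
  corresponding tensor takes anyway.\<close>

lemma augmented_rank_le:
  assumes X: "cfun.subspace X" and Y: "cfun.subspace Y" and Z: "cfun.subspace Z"
    and MA: "spanned_by_rank_one Y Z MA" "is_basis_list us MA"
    and MB: "spanned_by_rank_one X Z MB" "is_basis_list vs MB"
    and MC: "spanned_by_rank_one X Y MC" "is_basis_list ws MC"
    and r: "mod_rank_le X Y Z T MA MB MC r"
  shows "rank_le (dsum X (coord_space (length us))) (dsum Y (coord_space (length vs)))
    (dsum Z (coord_space (length ws))) (r + length us + length vs + length ws)
    (augmented T us vs ws)"
    (is "rank_le ?X ?Y ?Z _ ?T")
proof -
  obtain \<alpha> \<beta> \<gamma> p a u q b v s c w where
    abc: "\<forall>l<r. \<alpha> l \<in> X \<and> \<beta> l \<in> Y \<and> \<gamma> l \<in> Z"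
    and m: "\<forall>l<p. a l \<in> X \<and> u l \<in> MA" "\<forall>l<q. b l \<in> Y \<and> v l \<in> MB" "\<forall>l<s. c l \<in> Z \<and> w l \<in> MC"
    and all: "\<forall>i j k. T (i, j, k) + (\<Sum>l<(p::nat). a l i * u l (j, k)) + (\<Sum>l<(q::nat). b l j * v l (i, k))
      + (\<Sum>l<(s::nat). c l k * w l (i, j)) = (\<Sum>l<r. \<alpha> l i * \<beta> l j * \<gamma> l k)"
    by (rule mod_rank_leE[OF r]) (rule that)
  note eq = all[rule_format]
  have \<alpha>: "\<alpha> l \<in> X" and \<beta>: "\<beta> l \<in> Y" and \<gamma>: "\<gamma> l \<in> Z" if "l < r" for l
    using abc that by auto
  have a: "a l \<in> X" and u: "u l \<in> MA" if "l < p" for l using m(1) that by auto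
  have b: "b l \<in> Y" and v: "v l \<in> MB" if "l < q" for l using m(2) that by auto
  have c: "c l \<in> Z" and w: "w l \<in> MC" if "l < s" for l using m(3) that by auto
  have sub: "set xs \<subseteq> M" if "is_basis_list xs M" for xs :: "('z \<Rightarrow> complex) list" and M
    using that cfun.span_superset unfolding is_basis_list_def by blast
  obtain y1 z1 where m1: "\<forall>l<length us. y1 l \<in> Y \<and> z1 l \<in> Z"
    and e1: "\<forall>u\<in>MA. \<exists>c. \<forall>t. u t = (\<Sum>l<length us. c l * (y1 l (fst t) * z1 l (snd t)))"
    by (rule rank_one_basis[OF MA]) (rule that)
  obtain f1 where g1: "\<forall>l<length us. f1 l \<in> ?X"
    and h1: "\<forall>i t. (\<Sum>l<length us. f1 l (Inl i) * (y1 l (fst t) * z1 l (snd t))) = - (\<Sum>l<p. a l i * u l t)"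
    and k1: "\<forall>j t. (\<Sum>l<length us. f1 l (Inr j) * (y1 l (fst t) * z1 l (snd t)))
      = (if j < length us then (us ! j) t else 0)"
    by (rule absorb_modification[OF X a u sub[OF MA(2)] e1]) (assumption | rule that)+
  obtain x2 z2 where m2: "\<forall>l<length vs. x2 l \<in> X \<and> z2 l \<in> Z"
    and e2: "\<forall>u\<in>MB. \<exists>c. \<forall>t. u t = (\<Sum>l<length vs. c l * (x2 l (fst t) * z2 l (snd t)))"
    by (rule rank_one_basis[OF MB]) (rule that)
  obtain f2 where g2: "\<forall>l<length vs. f2 l \<in> ?Y"
    and h2: "\<forall>i t. (\<Sum>l<length vs. f2 l (Inl i) * (x2 l (fst t) * z2 l (snd t))) = - (\<Sum>l<q. b l i * v l t)"
    and k2: "\<forall>j t. (\<Sum>l<length vs. f2 l (Inr j) * (x2 l (fst t) * z2 l (snd t)))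
      = (if j < length vs then (vs ! j) t else 0)"
    by (rule absorb_modification[OF Y b v sub[OF MB(2)] e2]) (assumption | rule that)+
  obtain x3 y3 where m3: "\<forall>l<length ws. x3 l \<in> X \<and> y3 l \<in> Y"
    and e3: "\<forall>u\<in>MC. \<exists>c. \<forall>t. u t = (\<Sum>l<length ws. c l * (x3 l (fst t) * y3 l (snd t)))"
    by (rule rank_one_basis[OF MC]) (rule that)
  obtain f3 where g3: "\<forall>l<length ws. f3 l \<in> ?Z"
    and h3: "\<forall>i t. (\<Sum>l<length ws. f3 l (Inl i) * (x3 l (fst t) * y3 l (snd t))) = - (\<Sum>l<s. c l i * w l t)"
    and k3: "\<forall>j t. (\<Sum>l<length ws. f3 l (Inr j) * (x3 l (fst t) * y3 l (snd t)))
      = (if j < length ws then (ws ! j) t else 0)"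
    by (rule absorb_modification[OF Z c w sub[OF MC(2)] e3]) (assumption | rule that)+
  let ?e = "\<lambda>x. case_sum x (0 :: nat \<Rightarrow> complex)"
  have e: "?e x \<in> dsum U (coord_space n)" if "x \<in> U" for x :: "'z \<Rightarrow> complex" and U n
    using that cfun.subspace_0[OF subspace_coord_space] by (intro case_sum_in_dsum)
  \<comment> \<open>\<open>P0\<close> is the decomposition of the modified tensor, extended by zero.
    \<open>P1\<close>, \<open>P2\<close>, \<open>P3\<close> undo the three parts of the modification
    on the \<open>Inl\<close> entries and supply the corresponding tensors.\<close>
  define P0 where "P0 = (\<lambda>(i, j, k). \<Sum>l<r. ?e (\<alpha> l) i * ?e (\<beta> l) j * ?e (\<gamma> l) k)"
  define P1 where "P1 = (\<lambda>(i, j, k). \<Sum>l<length us. f1 l i * ?e (y1 l) j * ?e (z1 l) k)"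
  define P2 where "P2 = (\<lambda>(i, j, k). \<Sum>l<length vs. ?e (x2 l) i * f2 l j * ?e (z2 l) k)"
  define P3 where "P3 = (\<lambda>(i, j, k). \<Sum>l<length ws. ?e (x3 l) i * ?e (y3 l) j * f3 l k)"
  have "rank_le ?X ?Y ?Z (card {..<r}) P0"
    by (rule rank_leI[where a = "\<lambda>l. ?e (\<alpha> l)" and b = "\<lambda>l. ?e (\<beta> l)" and c = "\<lambda>l. ?e (\<gamma> l)"])
      (auto simp: P0_def intro!: e \<alpha> \<beta> \<gamma>)
  moreover have "rank_le ?X ?Y ?Z (card {..<length us}) P1"
    by (rule rank_leI[where a = f1 and b = "\<lambda>l. ?e (y1 l)" and c = "\<lambda>l. ?e (z1 l)"])
      (auto simp: P1_def intro!: e m1[rule_format, THEN conjunct1] m1[rule_format, THEN conjunct2] g1[rule_format])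
  moreover have "rank_le ?X ?Y ?Z (card {..<length vs}) P2"
    by (rule rank_leI[where a = "\<lambda>l. ?e (x2 l)" and b = f2 and c = "\<lambda>l. ?e (z2 l)"])
      (auto simp: P2_def intro!: e m2[rule_format, THEN conjunct1] m2[rule_format, THEN conjunct2] g2[rule_format])
  moreover have "rank_le ?X ?Y ?Z (card {..<length ws}) P3"
    by (rule rank_leI[where a = "\<lambda>l. ?e (x3 l)" and b = "\<lambda>l. ?e (y3 l)" and c = f3])
      (auto simp: P3_def intro!: e m3[rule_format, THEN conjunct1] m3[rule_format, THEN conjunct2] g3[rule_format])
  ultimately have rk: "rank_le ?X ?Y ?Z (r + length us + length vs + length ws) (P0 + P1 + P2 + P3)"
    unfolding card_lessThan by (intro rank_le_add)
  have "?T = P0 + P1 + P2 + P3"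
  proof (rule ext, clarify)
    fix i :: "'a + nat" and j :: "'b + nat" and k :: "'c + nat"
    have s1: "(\<Sum>l<length us. f1 l (Inl i) * y1 l j * z1 l k) = - (\<Sum>l<p. a l i * u l (j, k))" for i j k
      using h1[rule_format, of i "(j, k)"] by (simp add: mult.assoc)
    have s2: "(\<Sum>l<length vs. x2 l i * f2 l (Inl j) * z2 l k) = - (\<Sum>l<q. b l j * v l (i, k))" for i j k
      using h2[rule_format, of j "(i, k)"] by (simp add: mult_ac)
    have s3: "(\<Sum>l<length ws. x3 l i * y3 l j * f3 l (Inl k)) = - (\<Sum>l<s. c l k * w l (i, j))" for i j k
      using h3[rule_format, of k "(i, j)"] by (simp add: mult_ac)
    have t1: "(\<Sum>l<length us. f1 l (Inr i) * y1 l j * z1 l k)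
        = (if i < length us then (us ! i) (j, k) else 0)" for i j k
      using k1[rule_format, of i "(j, k)"] by (simp add: mult.assoc)
    have t2: "(\<Sum>l<length vs. x2 l i * f2 l (Inr j) * z2 l k)
        = (if j < length vs then (vs ! j) (i, k) else 0)" for i j k
      using k2[rule_format, of j "(i, k)"] by (simp add: mult_ac)
    have t3: "(\<Sum>l<length ws. x3 l i * y3 l j * f3 l (Inr k))
        = (if k < length ws then (ws ! k) (i, j) else 0)" for i j k
      using k3[rule_format, of k "(i, j)"] by (simp add: mult_ac)
    show "?T (i, j, k) = (P0 + P1 + P2 + P3) (i, j, k)"
      by (cases i; cases j; cases k)
        (simp_all add: augmented_simps P0_def P1_def P2_def P3_def s1 s2 s3 t1 t2 t3 flip: eq)
  qed
  then show ?thesis using rk by simp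
qed

text \<open>Substitution is carried out in the three factors in turn. Each round removes as many
  terms as there are added coordinates, and replaces these coordinates by vectors, which adds to
  \<open>T\<close> a modification by the respective space.\<close>

lemma augmented_rank_ge:
  assumes X: "cfun.subspace X" and Y: "cfun.subspace Y" and Z: "cfun.subspace Z"
    and us: "is_basis_list us MA" and vs: "is_basis_list vs MB" and ws: "is_basis_list ws MC"
    and R: "rank_le (dsum X (coord_space (length us))) (dsum Y (coord_space (length vs)))
      (dsum Z (coord_space (length ws))) R (augmented T us vs ws)"
  obtains r where "R = r + length us + length vs + length ws" "mod_rank_le X Y Z T MA MB MC r"
proof -
  let ?T = "augmented T us vs ws"
  have mem: "us ! l \<in> U" if "is_basis_list us U" "l < length us" for us l and U :: "('z \<Rightarrow> complex) set"
    using that cfun.span_superset[of "set us"] unfolding is_basis_list_def by auto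
  obtain \<alpha> \<beta> \<gamma> where abc: "\<forall>l<R. \<alpha> l \<in> dsum X (coord_space (length us)) \<and>
      \<beta> l \<in> dsum Y (coord_space (length vs)) \<and> \<gamma> l \<in> dsum Z (coord_space (length ws))"
    and dec: "\<forall>i j k. ?T (i, j, k) = (\<Sum>l<R. \<alpha> l i * \<beta> l j * \<gamma> l k)"
    using R unfolding rank_le_def by (elim exE conjE)
  have "\<exists>L' \<rho> \<alpha>'. L' \<subseteq> {..<R} \<and> card L' + length us = card {..<R} \<and> (\<forall>j<length us. \<rho> j \<in> X) \<and>
    (\<forall>l\<in>L'. \<alpha>' l \<in> X) \<and>
    (\<forall>i p. ?T (Inl i, p) + (\<Sum>j<length us. \<rho> j i * ?T (Inr j, p))
      = (\<Sum>l\<in>L'. \<alpha>' l i * (\<beta> l (fst p) * \<gamma> l (snd p))))"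
  proof (rule eliminate_coordinates[where \<alpha> = \<alpha> and F = "\<lambda>s p. ?T (s, p)"])
    show "?T (s, p) = (\<Sum>l<R. \<alpha> l s * (\<beta> l (fst p) * \<gamma> l (snd p)))" for s p
      using dec by (cases p) (simp add: mult.assoc)
    show "(\<lambda>i. \<alpha> l (Inl i)) \<in> X" if "l \<in> {..<R}" for l
      by (rule dsum_Inl[where Y = "coord_space (length us)"]) (use that abc in blast)
    fix c assume c: "\<And>p. (\<Sum>j<length us. c j * ?T (Inr j, p)) = 0"
    show "\<forall>j<length us. c j = 0"
    proof (rule basis_list_independent[OF us])
      fix p show "(\<Sum>j<length us. c j * (us ! j) p) = 0"
        using c[of "(Inl (fst p), Inl (snd p))"] by (simp add: augmented_simps)
    qed
  qed (use X in auto)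
  then obtain L1 \<rho>1 \<alpha>1 where L1: "L1 \<subseteq> {..<R}" "card L1 + length us = R"
    and \<rho>1: "\<forall>j<length us. \<rho>1 j \<in> X" and \<alpha>1: "\<forall>l\<in>L1. \<alpha>1 l \<in> X"
    and eq1: "\<forall>i p. ?T (Inl i, p) + (\<Sum>j<length us. \<rho>1 j i * ?T (Inr j, p))
      = (\<Sum>l\<in>L1. \<alpha>1 l i * (\<beta> l (fst p) * \<gamma> l (snd p)))"
    unfolding card_lessThan by (elim exE conjE)
  define T1 where "T1 i s k = ?T (Inl i, s, k) + (\<Sum>j<length us. \<rho>1 j i * ?T (Inr j, s, k))" for i s k
  have fL1: "finite L1" using L1(1) finite_subset by blast
  have "\<exists>L' \<rho> \<beta>'. L' \<subseteq> L1 \<and> card L' + length vs = card L1 \<and> (\<forall>j<length vs. \<rho> j \<in> Y) \<and>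
    (\<forall>l\<in>L'. \<beta>' l \<in> Y) \<and>
    (\<forall>j p. T1 (fst p) (Inl j) (snd p) + (\<Sum>l<length vs. \<rho> l j * T1 (fst p) (Inr l) (snd p))
      = (\<Sum>l\<in>L'. \<beta>' l j * (\<alpha>1 l (fst p) * \<gamma> l (snd p))))"
  proof (rule eliminate_coordinates[where \<alpha> = \<beta> and F = "\<lambda>s p. T1 (fst p) s (snd p)"])
    show "T1 (fst p) s (snd p) = (\<Sum>l\<in>L1. \<beta> l s * (\<alpha>1 l (fst p) * \<gamma> l (snd p)))" for s p
      unfolding T1_def using eq1 by (simp add: mult_ac)
    show "(\<lambda>i. \<beta> l (Inl i)) \<in> Y" if "l \<in> L1" for l
      by (rule dsum_Inl[where Y = "coord_space (length vs)"]) (use that abc L1 in blast)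
    \<comment> \<open>The first round adds to the slices at \<open>Inr j\<close> only entries with
      two \<open>Inr\<close> indices, which are zero. Hence these slices still show the independent
      family \<open>vs\<close>; the third round is alike for \<open>ws\<close>.\<close>
    fix c assume c: "\<And>p. (\<Sum>j<length vs. c j * T1 (fst p) (Inr j) (snd p)) = 0"
    show "\<forall>j<length vs. c j = 0"
    proof (rule basis_list_independent[OF vs])
      fix p show "(\<Sum>j<length vs. c j * (vs ! j) p) = 0"
        using c[of "(fst p, Inl (snd p))"] by (simp add: T1_def augmented_simps)
    qed
  qed (use Y fL1 in auto)
  then obtain L2 \<rho>2 \<beta>2 where L2: "L2 \<subseteq> L1" "card L2 + length vs = card L1"
    and \<rho>2: "\<forall>j<length vs. \<rho>2 j \<in> Y" and \<beta>2: "\<forall>l\<in>L2. \<beta>2 l \<in> Y"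
    and eq2: "\<forall>j p. T1 (fst p) (Inl j) (snd p) + (\<Sum>l<length vs. \<rho>2 l j * T1 (fst p) (Inr l) (snd p))
      = (\<Sum>l\<in>L2. \<beta>2 l j * (\<alpha>1 l (fst p) * \<gamma> l (snd p)))"
    by (elim exE conjE)
  define T2 where "T2 i j k = T1 i (Inl j) k + (\<Sum>l<length vs. \<rho>2 l j * T1 i (Inr l) k)" for i j k
  have fL2: "finite L2" using L2(1) fL1 finite_subset by blast
  have "\<exists>L' \<rho> \<gamma>'. L' \<subseteq> L2 \<and> card L' + length ws = card L2 \<and> (\<forall>j<length ws. \<rho> j \<in> Z) \<and>
    (\<forall>l\<in>L'. \<gamma>' l \<in> Z) \<and>
    (\<forall>k p. T2 (fst p) (snd p) (Inl k) + (\<Sum>l<length ws. \<rho> l k * T2 (fst p) (snd p) (Inr l))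
      = (\<Sum>l\<in>L'. \<gamma>' l k * (\<alpha>1 l (fst p) * \<beta>2 l (snd p))))"
  proof (rule eliminate_coordinates[where \<alpha> = \<gamma> and F = "\<lambda>s p. T2 (fst p) (snd p) s"])
    show "T2 (fst p) (snd p) s = (\<Sum>l\<in>L2. \<gamma> l s * (\<alpha>1 l (fst p) * \<beta>2 l (snd p)))" for s p
      unfolding T2_def using eq2[rule_format, of "(fst p, s)"] by (simp add: mult_ac)
    show "(\<lambda>i. \<gamma> l (Inl i)) \<in> Z" if "l \<in> L2" for l
      by (rule dsum_Inl[where Y = "coord_space (length ws)"]) (use that abc L1 L2 in blast)
    fix c assume c: "\<And>p. (\<Sum>j<length ws. c j * T2 (fst p) (snd p) (Inr j)) = 0"
    show "\<forall>j<length ws. c j = 0"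
    proof (rule basis_list_independent[OF ws])
      fix p show "(\<Sum>j<length ws. c j * (ws ! j) p) = 0"
        using c[of p] by (simp add: T1_def T2_def augmented_simps)
    qed
  qed (use Z fL2 in auto)
  then obtain L3 \<rho>3 \<gamma>3 where L3: "L3 \<subseteq> L2" "card L3 + length ws = card L2"
    and \<rho>3: "\<forall>j<length ws. \<rho>3 j \<in> Z" and \<gamma>3: "\<forall>l\<in>L3. \<gamma>3 l \<in> Z"
    and eq3: "\<forall>k p. T2 (fst p) (snd p) (Inl k) + (\<Sum>l<length ws. \<rho>3 l k * T2 (fst p) (snd p) (Inr l))
      = (\<Sum>l\<in>L3. \<gamma>3 l k * (\<alpha>1 l (fst p) * \<beta>2 l (snd p)))"
    by (elim exE conjE)
  \<comment> \<open>After all three rounds the entries at \<open>Inl\<close> indices are those of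
    \<open>T\<close> plus combinations of \<open>us\<close>, \<open>vs\<close> and \<open>ws\<close>
    with the substituted vectors as coefficients, hence those of a modification of
    \<open>T\<close>.\<close>
  define T3 where "T3 = (\<lambda>(i, j, k). T2 i j (Inl k) + (\<Sum>l<length ws. \<rho>3 l k * T2 i j (Inr l)))"
  have "rank_le X Y Z (card L3) T3"
  proof (rule rank_leI[where a = \<alpha>1 and b = \<beta>2 and c = \<gamma>3])
    show "finite L3" using L3(1) fL2 finite_subset by blast
    show "\<alpha>1 l \<in> X \<and> \<beta>2 l \<in> Y \<and> \<gamma>3 l \<in> Z" if "l \<in> L3" for l
      using that \<alpha>1 \<beta>2 \<gamma>3 L2 L3 by blast
    show "T3 (i, j, k) = (\<Sum>l\<in>L3. \<alpha>1 l i * \<beta>2 l j * \<gamma>3 l k)" for i j k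
      unfolding T3_def using eq3[rule_format, of "(i, j)"] by (simp add: mult_ac)
  qed
  then have "mod_rank_le X Y Z T MA MB MC (card L3)"
  proof (rule mod_rank_leI[where ?S1.0 = "{..<length us}" and ?S2.0 = "{..<length vs}" and ?S3.0 = "{..<length ws}"
        and a = \<rho>1 and b = \<rho>2 and c = \<rho>3 and u = "(!) us" and v = "(!) vs" and w = "(!) ws"])
    show "T3 (i, j, k) = T (i, j, k) + (\<Sum>l<length us. \<rho>1 l i * (us ! l) (j, k))
      + (\<Sum>l<length vs. \<rho>2 l j * (vs ! l) (i, k)) + (\<Sum>l<length ws. \<rho>3 l k * (ws ! l) (i, j))" for i j k
      by (simp add: T3_def T2_def T1_def augmented_simps)
  qed (use \<rho>1 \<rho>2 \<rho>3 mem us vs ws in auto)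
  then show thesis using that[of "card L3"] L1 L2 L3 by simp
qed

section \<open>The lower bound for modifications of clones\<close>

definition step_at :: "'q \<Rightarrow> ('q \<Rightarrow> nat) \<Rightarrow> ('q \<Rightarrow> nat) \<Rightarrow> bool" where
  "step_at \<kappa> P P' \<longleftrightarrow> P \<kappa> < P' \<kappa> \<and> (\<forall>\<kappa>'. \<kappa>' \<noteq> \<kappa> \<longrightarrow> P \<kappa>' = P' \<kappa>')"

lemma step_at_unique: "step_at \<kappa> P P' \<Longrightarrow> step_at \<kappa>' P P' \<Longrightarrow> \<kappa> = \<kappa>'"
  unfolding step_at_def by (metis less_irrefl)

text \<open>\<tau> is 0, 1 or 2 for the space belonging to \<open>A\<close>, \<open>B\<close> or
  \<open>C\<close>, and \<open>(\<tau>, s)\<close> names the digit of its functional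
  \<open>s\<close>; \<open>n\<close> is the number of functionals, not the range of the digits.
  Diagonal blocks are left unconstrained.\<close>

definition allowed_blocks ::
  "('i \<Rightarrow> complex) set \<Rightarrow> ('j \<Rightarrow> complex) set \<Rightarrow> ('i \<times> 'j) set \<Rightarrow> (nat \<Rightarrow> 'i \<times> 'j \<Rightarrow> complex) \<Rightarrow> nat
    \<Rightarrow> nat \<Rightarrow> (nat \<times> nat \<Rightarrow> nat) \<Rightarrow> (nat \<times> nat \<Rightarrow> nat) \<Rightarrow> ('i \<times> 'j \<Rightarrow> complex) set" where
  "allowed_blocks X Y Q \<theta> n \<tau> P P' =
    {u \<in> tprod2 X Y. \<forall>s<n. step_at (\<tau>, s) P P' \<longrightarrow> (\<Sum>q\<in>Q. \<theta> s q * u q) = 0}"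

lemma subspace_tprod2: "cfun.subspace (tprod2 X Y)"
  by (simp add: tprod2_def)

lemma subspace_allowed_blocks: "cfun.subspace (allowed_blocks X Y Q \<theta> n \<tau> P P')"
proof (rule cfun.subspaceI)
  show "0 \<in> allowed_blocks X Y Q \<theta> n \<tau> P P'"
    by (simp only: allowed_blocks_def cfun.subspace_0[OF subspace_tprod2] mem_Collect_eq) simp
next
  fix u v assume "u \<in> allowed_blocks X Y Q \<theta> n \<tau> P P'" "v \<in> allowed_blocks X Y Q \<theta> n \<tau> P P'"
  then show "u + v \<in> allowed_blocks X Y Q \<theta> n \<tau> P P'"
    using cfun.subspace_add[OF subspace_tprod2, of u X Y v]
    by (auto simp: allowed_blocks_def distrib_left sum.distrib)
next
  fix r u assume u: "u \<in> allowed_blocks X Y Q \<theta> n \<tau> P P'"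
  have "(\<Sum>q\<in>Q. \<theta> s q * cscale r u q) = r * (\<Sum>q\<in>Q. \<theta> s q * u q)" for s
    by (simp add: cscale_apply sum_distrib_left mult_ac)
  then show "cscale r u \<in> allowed_blocks X Y Q \<theta> n \<tau> P P'"
    using u cfun.subspace_scale[OF subspace_tprod2, of u X Y r]
    by (auto simp: allowed_blocks_def)
qed

text \<open>Two digit vectors can differ in exactly one digit for at most one choice of that digit,
  so a block is constrained by at most one functional \<eta>, taken as zero if there is none. The
  kernel of a single functional is spanned by simple tensors.\<close>

lemma allowed_blocks_span:
  assumes "cfun.subspace X" "cfun.subspace Y"
  shows "allowed_blocks X Y Q \<theta> n \<tau> P P' \<subseteq> cfun.span
    {tensor2 x y | x y. x \<in> X \<and> y \<in> Y \<and> tensor2 x y \<in> allowed_blocks X Y Q \<theta> n \<tau> P P'}"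
proof -
  obtain \<eta> where \<eta>: "\<And>u. (\<forall>s<n. step_at (\<tau>, s) P P' \<longrightarrow> (\<Sum>q\<in>Q. \<theta> s q * u q) = 0)
    \<longleftrightarrow> (\<Sum>q\<in>Q. \<eta> q * u q) = 0"
  proof (cases "\<exists>s<n. step_at (\<tau>, s) P P'")
    case True
    then obtain s where s: "s < n" "step_at (\<tau>, s) P P'" by blast
    then have "s' = s" if "step_at (\<tau>, s') P P'" for s'
      using step_at_unique[OF that s(2)] by simp
    then show thesis using s by (intro that[of "\<theta> s"]) blast
  next
    case False
    then show thesis using that[of "\<lambda>_. 0"] by auto
  qed
  have "u \<in> cfun.span {tensor2 x y | x y. x \<in> X \<and> y \<in> Y \<and> (\<Sum>q\<in>Q. \<eta> q * tensor2 x y q) = 0}"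
    if "u \<in> tprod2 X Y" "(\<Sum>q\<in>Q. \<eta> q * u q) = 0" for u
    by (rule tprod2_kernel_span[OF assms])
      (use that in \<open>simp_all add: distrib_left sum.distrib cscale_apply sum_distrib_left mult_ac\<close>)
  moreover have "{tensor2 x y | x y. x \<in> X \<and> y \<in> Y \<and> tensor2 x y \<in> allowed_blocks X Y Q \<theta> n \<tau> P P'}
    = {tensor2 x y | x y. x \<in> X \<and> y \<in> Y \<and> (\<Sum>q\<in>Q. \<eta> q * tensor2 x y q) = 0}"
    unfolding allowed_blocks_def \<eta> by (auto intro: tensor2_in_tprod2)
  ultimately show ?thesis unfolding allowed_blocks_def \<eta> by auto
qed

section \<open>Slices and clones\<close>

lemma tprod2_slice:
  assumes "cfun.subspace X" "a \<in> tprod2 X Y"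
  shows "(\<lambda>i. a (i, x)) \<in> X"
  using assms(2) unfolding tprod2_def
proof (induction rule: cfun.span_induct_alt)
  case base
  show ?case using cfun.subspace_0[OF assms(1)] by (simp add: zero_fun_def)
next
  case (step r t v)
  then obtain y z where t: "t = tensor2 y z" "y \<in> X" by blast
  have "(\<lambda>i. (cscale r t + v) (i, x)) = cscale (r * z x) y + (\<lambda>i. v (i, x))"
    by (auto simp: t(1) tensor2_def fun_eq_iff cscale_apply)
  then show ?case
    using cfun.subspace_add[OF assms(1) cfun.subspace_scale[OF assms(1) t(2)] step(2)] by metis
qed

text \<open>For the standard basis, the sum of \<Sigma> is the all-ones vector, so a clone has the
  same block \<open>u\<close> everywhere.\<close>

lemma clone2_in_block_space:
  assumes "\<And>P P'. u \<in> H P P'"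
  shows "clone2 (unit_vec ` {..<m}) u \<in> block_space m key H"
  unfolding block_space_def mem_Collect_eq
  by (rule exI[of _ "\<lambda>_ _. u"])
    (use assms in \<open>auto simp: clone2_def Let_def sum_unit_vec fun_eq_iff\<close>)

lemma clone3_unit_vec:
  "clone3 (unit_vec ` {..<m}) T ((i, x), (j, y), (k, z))
    = (if x < m \<and> y < m \<and> z < m then T (i, j, k) else 0)"
  by (simp add: clone3_def Let_def sum_unit_vec)

lemma clone3_in_tprod3:
  fixes X :: "('i \<Rightarrow> complex) set" and Y :: "('j \<Rightarrow> complex) set" and Z :: "('k \<Rightarrow> complex) set"
  assumes "T \<in> tprod3 X Y Z" "\<Sum>\<Sigma> \<in> V"
  shows "clone3 \<Sigma> T \<in> tprod3 (tprod2 X V) (tprod2 Y V) (tprod2 Z V)"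
  using assms(1) unfolding tprod3_def[of X Y Z]
proof (induction rule: cfun.span_induct_alt)
  case base
  have "clone3 \<Sigma> (0 :: 'i \<times> 'j \<times> 'k \<Rightarrow> complex) = 0" by (auto simp: clone3_def fun_eq_iff Let_def)
  then show ?case by (simp only: cfun.subspace_0[OF subspace_tprod3])
next
  case (step r t v)
  then obtain x y z where t: "t = tensor3 x y z" "x \<in> X" "y \<in> Y" "z \<in> Z" by blast
  have "clone3 \<Sigma> t \<in> tprod3 (tprod2 X V) (tprod2 Y V) (tprod2 Z V)"
    unfolding t(1) clone3_tensor3 using t assms(2)
    by (intro tensor3_in_tprod3 tensor2_in_tprod2)
  then show ?case
    unfolding clone3_add clone3_cscale
    using step by (intro cfun.subspace_add[OF subspace_tprod3] cfun.subspace_scale[OF subspace_tprod3])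
qed

text \<open>The bound is the same for all \<open>T\<close>, which allows \<open>V\<close> to be
  chosen before \<open>T\<close>.\<close>

lemma tprod3_points_rank_le:
  assumes T: "T \<in> tprod3 X Y Z"
    and P: "finite P" "\<And>p. p \<in> P \<Longrightarrow> e p \<in> X" "\<And>f i. f \<in> X \<Longrightarrow> f i = (\<Sum>p\<in>P. f p * e p i)"
    and Q: "finite Q" "\<And>p. p \<in> Q \<Longrightarrow> d p \<in> Y" "\<And>f i. f \<in> Y \<Longrightarrow> f i = (\<Sum>p\<in>Q. f p * d p i)"
    and R: "finite R" "\<And>p. p \<in> R \<Longrightarrow> g p \<in> Z" "\<And>f i. f \<in> Z \<Longrightarrow> f i = (\<Sum>p\<in>R. f p * g p i)"
    and X: "cfun.subspace X"
  shows "rank_le X Y Z (card (P \<times> Q \<times> R)) T"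
proof (rule rank_leI[where a = "\<lambda>t. cscale (T t) (e (fst t))" and b = "\<lambda>t. d (fst (snd t))"
      and c = "\<lambda>t. g (snd (snd t))"])
  show "finite (P \<times> Q \<times> R)" using P Q R by simp
  show "cscale (T t) (e (fst t)) \<in> X \<and> d (fst (snd t)) \<in> Y \<and> g (snd (snd t)) \<in> Z"
    if "t \<in> P \<times> Q \<times> R" for t
    using that P(2) Q(2) R(2) cfun.subspace_scale[OF X] by auto
  let ?s = "\<lambda>T i j k. \<Sum>t\<in>P \<times> Q \<times> R. T t * (e (fst t) i * d (fst (snd t)) j * g (snd (snd t)) k)"
  have "\<forall>i j k. T (i, j, k) = ?s T i j k"
    using T unfolding tprod3_def
  proof (induction rule: cfun.span_induct_alt)
    case base
    show ?case by simp
  next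
    case (step r t v)
    then obtain x y z where t: "t = tensor3 x y z" "x \<in> X" "y \<in> Y" "z \<in> Z" by blast
    have "t (i, j, k) = ?s t i j k" for i j k
    proof -
      have "t (i, j, k) = (\<Sum>p\<in>P. x p * e p i) * ((\<Sum>p\<in>Q. y p * d p j) * (\<Sum>p\<in>R. z p * g p k))"
        unfolding P(3)[OF t(2), symmetric] Q(3)[OF t(3), symmetric] R(3)[OF t(4), symmetric]
        by (simp add: t(1) tensor3_def)
      also have "\<dots> = (\<Sum>t\<in>P \<times> Q \<times> R.
          (x (fst t) * e (fst t) i) * ((y (fst (snd t)) * d (fst (snd t)) j) *
          (z (snd (snd t)) * g (snd (snd t)) k)))"
        unfolding sum_product by (simp add: sum.cartesian_product sum_distrib_left case_prod_unfold)
      finally show ?thesis by (simp add: t(1) tensor3_def case_prod_unfold mult_ac)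
    qed
    then show ?case
      using step(2) by (simp add: cscale_apply distrib_right sum.distrib sum_distrib_left mult.assoc)
  qed
  then show "T (i, j, k) = (\<Sum>t\<in>P \<times> Q \<times> R.
      cscale (T t) (e (fst t)) i * d (fst (snd t)) j * g (snd (snd t)) k)" for i j k
    by (simp add: cscale_apply mult_ac)
qed

section \<open>Bad digits along a line\<close>

text \<open>For a fixed entry \<open>i\<close> of the first factor, the combination of the
  \<open>G l\<close> with coefficients \<open>a l i\<close> inherits the vanishing above the
  diagonal, so \<open>triangular_block_card\<close> applies. The bounds are then added over the
  points \<open>i\<close> in \<open>P\<close>.\<close>

lemma line_card:
  fixes n r :: nat
  assumes P: "finite P" and Q: "finite Q"
    and eq: "\<And>i j k p q. j < n \<Longrightarrow> k < n \<Longrightarrow>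
      (\<Sum>l<N. a l i * G l j k (p, q)) + (t i p q :: complex) + g i p q j + h i p q k
        = (\<Sum>l<r. \<alpha> l i * \<beta> l p j * \<gamma> l q k)"
    and tri: "\<And>l j k. l < (N::nat) \<Longrightarrow> j < k \<Longrightarrow> k < n \<Longrightarrow> (\<Sum>q\<in>Q. \<theta> q * G l j k q) = 0"
  shows "card {j. j < n \<and> (\<exists>i\<in>P. (\<Sum>q\<in>Q. \<theta> q * (\<Sum>l<N. a l i * G l j j q)) \<noteq> 0)}
    \<le> card P * (card Q * r + 3)"
proof -
  let ?B = "\<lambda>i. {j. j < n \<and> (\<Sum>q\<in>Q. \<theta> q * (\<Sum>l<N. a l i * G l j j q)) \<noteq> 0}"
  have one: "card (?B i) \<le> card Q * r + 3" for i
  proof -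
    have "(\<Sum>q\<in>Q. \<theta> q * (\<Sum>l<N. a l i * G l j k q)) = 0" if "j < k" "k < n" for j k
    proof -
      have "(\<Sum>q\<in>Q. \<theta> q * (\<Sum>l<N. a l i * G l j k q)) = (\<Sum>l<N. a l i * (\<Sum>q\<in>Q. \<theta> q * G l j k q))"
        unfolding sum_distrib_left by (subst sum.swap) (simp add: mult_ac)
      then show ?thesis using tri that by simp
    qed
    then show ?thesis
      using triangular_block_card[OF Q, of n "\<lambda>j k p q. \<Sum>l<N. a l i * G l j k (p, q)" "t i" "g i" "h i"
          "\<lambda>l. \<alpha> l i" \<beta> \<gamma> r \<theta>] eq
      by (simp add: case_prod_unfold)
  qed
  have "{j. j < n \<and> (\<exists>i\<in>P. (\<Sum>q\<in>Q. \<theta> q * (\<Sum>l<N. a l i * G l j j q)) \<noteq> 0)} = (\<Union>i\<in>P. ?B i)"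
    by auto
  also have "card \<dots> \<le> (\<Sum>i\<in>P. card (?B i))" using P by (rule card_UN_le)
  also have "\<dots> \<le> card P * (card Q * r + 3)"
    using sum_bounded_above[of P, OF one] by simp
  finally show ?thesis .
qed

text \<open>Used as the key of a block space. Masking the digits of the other two factors makes the
  blocks insensitive to changes of those digits.\<close>

definition part_digits :: "nat \<Rightarrow> (nat \<times> nat \<Rightarrow> nat) \<Rightarrow> nat \<times> nat \<Rightarrow> nat" where
  "part_digits \<tau> i = (\<lambda>\<kappa>. if fst \<kappa> = \<tau> then i \<kappa> else 0)"

lemma step_at_part_digits:
  "j < k \<Longrightarrow> step_at (\<tau>, s) (part_digits \<tau> (i((\<tau>, s) := j))) (part_digits \<tau> (i((\<tau>, s) := k)))"
  by (auto simp: step_at_def part_digits_def)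

lemma part_digits_upd: "\<tau> \<noteq> \<sigma> \<Longrightarrow> part_digits \<tau> (i((\<sigma>, s) := j)) = part_digits \<tau> i"
  by (auto simp: part_digits_def fun_eq_iff)

lemma sum_expand_points:
  fixes f :: "nat \<Rightarrow> 'i \<Rightarrow> complex"
  assumes "\<And>l. l < N \<Longrightarrow> f l t = (\<Sum>p\<in>P. f l p * e p t)"
  shows "(\<Sum>p\<in>P. e p t * (\<Sum>l<N. f l p * g l)) = (\<Sum>l<N. f l t * g l)"
proof -
  have "(\<Sum>p\<in>P. e p t * (\<Sum>l<N. f l p * g l)) = (\<Sum>l<N. (\<Sum>p\<in>P. f l p * e p t) * g l)"
    unfolding sum_distrib_left sum_distrib_right by (subst sum.swap) (simp add: mult_ac)
  then show ?thesis by (simp flip: assms)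
qed

text \<open>The bound on \<open>n\<close> is what the union bound requires. It yields a digit vector
  at which every diagonal block contribution lies in \<open>WA\<close>, \<open>WB\<close> or
  \<open>WC\<close>; restricting the decomposition to that position gives a modification of
  \<open>T\<close> with no more terms.\<close>

lemma block_mod_rank_le:
  assumes fin: "fin_dim_space A" "fin_dim_space B" "fin_dim_space C"
    and PA: "finite PA" "\<And>p. p \<in> PA \<Longrightarrow> eA p \<in> A" "\<And>f i. f \<in> A \<Longrightarrow> f i = (\<Sum>p\<in>PA. f p * eA p i)"
    and PB: "finite PB" "\<And>p. p \<in> PB \<Longrightarrow> eB p \<in> B" "\<And>f i. f \<in> B \<Longrightarrow> f i = (\<Sum>p\<in>PB. f p * eB p i)"
    and PC: "finite PC" "\<And>p. p \<in> PC \<Longrightarrow> eC p \<in> C" "\<And>f i. f \<in> C \<Longrightarrow> f i = (\<Sum>p\<in>PC. f p * eC p i)"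
    and QA: "finite QA" "\<And>u. u \<in> tprod2 B C \<Longrightarrow> u \<in> WA \<longleftrightarrow> (\<forall>s<kA. (\<Sum>q\<in>QA. \<theta>A s q * u q) = 0)"
    and QB: "finite QB" "\<And>u. u \<in> tprod2 A C \<Longrightarrow> u \<in> WB \<longleftrightarrow> (\<forall>s<kB. (\<Sum>q\<in>QB. \<theta>B s q * u q) = 0)"
    and QC: "finite QC" "\<And>u. u \<in> tprod2 A B \<Longrightarrow> u \<in> WC \<longleftrightarrow> (\<forall>s<kC. (\<Sum>q\<in>QC. \<theta>C s q * u q) = 0)"
    and K: "K = {0} \<times> {..<kA} \<union> {1} \<times> {..<kB} \<union> {2} \<times> {..<kC}"
    and D: "bij_betw D {..<m} (PiE K (\<lambda>_. {..<n}))"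
    and n: "card K * (card PA * (card QA * r + 3) + card PB * (card QB * r + 3)
      + card PC * (card QC * r + 3)) < n"
    and rk: "mod_rank_le (tprod2 A V) (tprod2 B V) (tprod2 C V) (clone3 (unit_vec ` {..<m}) T)
      (block_space m (\<lambda>x. part_digits 0 (D x)) (allowed_blocks B C QA \<theta>A kA 0))
      (block_space m (\<lambda>x. part_digits 1 (D x)) (allowed_blocks A C QB \<theta>B kB 1))
      (block_space m (\<lambda>x. part_digits 2 (D x)) (allowed_blocks A B QC \<theta>C kC 2)) r"
  shows "mod_rank_le A B C T WA WB WC r"
proof -
  let ?E = "PiE K (\<lambda>_. {..<n})"
  let ?HA = "allowed_blocks B C QA \<theta>A kA 0" and ?HB = "allowed_blocks A C QB \<theta>B kB 1"
    and ?HC = "allowed_blocks A B QC \<theta>C kC 2"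
  note sub = fin[THEN fin_dim_subspace]
  have finK: "finite K" unfolding K by simp
  obtain \<alpha> \<beta> \<gamma> NA a u NB b v NC c w where
    abc: "\<forall>l<r. \<alpha> l \<in> tprod2 A V \<and> \<beta> l \<in> tprod2 B V \<and> \<gamma> l \<in> tprod2 C V"
    and mA: "\<forall>l<NA. a l \<in> tprod2 A V \<and> u l \<in> block_space m (\<lambda>x. part_digits 0 (D x)) ?HA"
    and mB: "\<forall>l<NB. b l \<in> tprod2 B V \<and> v l \<in> block_space m (\<lambda>x. part_digits 1 (D x)) ?HB"
    and mC: "\<forall>l<NC. c l \<in> tprod2 C V \<and> w l \<in> block_space m (\<lambda>x. part_digits 2 (D x)) ?HC"
    and eq: "\<forall>i j k. clone3 (unit_vec ` {..<m}) T (i, j, k) + (\<Sum>l<(NA::nat). a l i * u l (j, k))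
      + (\<Sum>l<(NB::nat). b l j * v l (i, k)) + (\<Sum>l<(NC::nat). c l k * w l (i, j))
      = (\<Sum>l<r. \<alpha> l i * \<beta> l j * \<gamma> l k)"
    by (rule mod_rank_leE[OF rk]) (rule that)
  have block: "\<exists>G. \<forall>l<N. (\<forall>P P'. G l P P' \<in> H P P') \<and> (\<forall>p q y z. y < m \<longrightarrow> z < m \<longrightarrow>
      u l ((p, y), (q, z)) = G l (key y) (key z) (p, q))"
    if "\<forall>l<N. u l \<in> block_space m key H"
    for N :: nat and u :: "nat \<Rightarrow> ('y \<times> nat) \<times> ('z \<times> nat) \<Rightarrow> complex" and key :: "nat \<Rightarrow> 'q" and H
  proof -
    have "\<forall>l. \<exists>G. l < N \<longrightarrow> (\<forall>P P'. G P P' \<in> H P P') \<and> (\<forall>p q y z. y < m \<longrightarrow> z < m \<longrightarrow>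
      u l ((p, y), (q, z)) = G (key y) (key z) (p, q))"
    proof
      fix l
      show "\<exists>G. l < N \<longrightarrow> (\<forall>P P'. G P P' \<in> H P P') \<and> (\<forall>p q y z. y < m \<longrightarrow> z < m \<longrightarrow>
        u l ((p, y), (q, z)) = G (key y) (key z) (p, q))"
      proof (cases "l < N")
        case True
        then obtain G where "\<And>P Q. G P Q \<in> H P Q" "\<And>p q y z. y < m \<Longrightarrow> z < m \<Longrightarrow>
            u l ((p, y), (q, z)) = G (key y) (key z) (p, q)"
          using \<open>\<forall>l<N. u l \<in> block_space m key H\<close> block_spaceE by metis
        then show ?thesis by blast
      qed simp
    qed
    then show ?thesis by (rule choice)
  qed
  obtain GA where GA: "\<forall>l<NA. (\<forall>P P'. GA l P P' \<in> ?HA P P') \<and> (\<forall>p q y z. y < m \<longrightarrow> z < m \<longrightarrow>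
      u l ((p, y), (q, z)) = GA l (part_digits 0 (D y)) (part_digits 0 (D z)) (p, q))"
    by (rule exE[OF block[of NA u "\<lambda>x. part_digits 0 (D x)" ?HA]]) (use mA in blast, rule that)
  obtain GB where GB: "\<forall>l<NB. (\<forall>P P'. GB l P P' \<in> ?HB P P') \<and> (\<forall>p q y z. y < m \<longrightarrow> z < m \<longrightarrow>
      v l ((p, y), (q, z)) = GB l (part_digits 1 (D y)) (part_digits 1 (D z)) (p, q))"
    by (rule exE[OF block[of NB v "\<lambda>x. part_digits 1 (D x)" ?HB]]) (use mB in blast, rule that)
  obtain GC where GC: "\<forall>l<NC. (\<forall>P P'. GC l P P' \<in> ?HC P P') \<and> (\<forall>p q y z. y < m \<longrightarrow> z < m \<longrightarrow>
      w l ((p, y), (q, z)) = GC l (part_digits 2 (D y)) (part_digits 2 (D z)) (p, q))"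
    by (rule exE[OF block[of NC w "\<lambda>x. part_digits 2 (D x)" ?HC]]) (use mC in blast, rule that)
  define D' where "D' = inv_into {..<m} D"
  have D': "D' i < m" "D (D' i) = i" if "i \<in> ?E" for i
    using that D inv_into_into[of i D "{..<m}"] f_inv_into_f[of i D "{..<m}"]
    by (auto simp: bij_betw_def D'_def)
  \<comment> \<open>Zeroing the digits of factor \<open>\<tau>\<close> does not affect the blocks in which position \<open>\<tau>\<close> takes part,
    and keeps that position fixed when a digit of factor \<open>\<tau>\<close> varies.\<close>
  define idx where "idx \<tau> i = D' (\<lambda>\<kappa>. if \<kappa> \<in> K \<and> fst \<kappa> = \<tau> then 0 else i \<kappa>)" for \<tau> and i :: "nat \<times> nat \<Rightarrow> nat"
  have idx: "idx \<tau> i < m" "\<sigma> \<noteq> \<tau> \<Longrightarrow> part_digits \<sigma> (D (idx \<tau> i)) = part_digits \<sigma> i" if "i \<in> ?E" for \<sigma> \<tau> i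
  proof -
    have "(\<lambda>\<kappa>. if \<kappa> \<in> K \<and> fst \<kappa> = \<tau> then 0 else i \<kappa>) \<in> ?E"
      using that n by (auto simp: PiE_iff extensional_def)
    note * = D'[OF this]
    show "idx \<tau> i < m" unfolding idx_def by (rule *(1))
    show "part_digits \<sigma> (D (idx \<tau> i)) = part_digits \<sigma> i" if "\<sigma> \<noteq> \<tau>"
      unfolding idx_def *(2) using that by (auto simp: part_digits_def fun_eq_iff)
  qed
  have idx_upd: "idx \<tau> (i((\<tau>, s) := j)) = idx \<tau> i" if "(\<tau>, s) \<in> K" for \<tau> s i j
    unfolding idx_def by (rule arg_cong[of _ _ D']) (use that in \<open>auto simp: fun_eq_iff\<close>)
  have upd: "i(\<kappa> := j) \<in> ?E" if "i \<in> ?E" "\<kappa> \<in> K" "j < n" for i \<kappa> j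
    using that by (auto simp: PiE_iff extensional_def)
  have beq: "T (i, j, k)
      + (\<Sum>l<NA. a l (i, x) * GA l (part_digits 0 (D y)) (part_digits 0 (D z)) (j, k))
      + (\<Sum>l<NB. b l (j, y) * GB l (part_digits 1 (D x)) (part_digits 1 (D z)) (i, k))
      + (\<Sum>l<NC. c l (k, z) * GC l (part_digits 2 (D x)) (part_digits 2 (D y)) (i, j))
      = (\<Sum>l<r. \<alpha> l (i, x) * \<beta> l (j, y) * \<gamma> l (k, z))"
    if xyz: "x < m" "y < m" "z < m" for x y z i j k
  proof -
    have "(\<Sum>l<NA. a l (i, x) * GA l (part_digits 0 (D y)) (part_digits 0 (D z)) (j, k))
        = (\<Sum>l<NA. a l (i, x) * u l ((j, y), (k, z)))"
      using GA xyz by (intro sum.cong) auto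
    moreover have "(\<Sum>l<NB. b l (j, y) * GB l (part_digits 1 (D x)) (part_digits 1 (D z)) (i, k))
        = (\<Sum>l<NB. b l (j, y) * v l ((i, x), (k, z)))"
      using GB xyz by (intro sum.cong) auto
    moreover have "(\<Sum>l<NC. c l (k, z) * GC l (part_digits 2 (D x)) (part_digits 2 (D y)) (i, j))
        = (\<Sum>l<NC. c l (k, z) * w l ((i, x), (j, y)))"
      using GC xyz by (intro sum.cong) auto
    ultimately show ?thesis
      using eq[rule_format, of "(i, x)" "(j, y)" "(k, z)"] xyz by (simp add: clone3_unit_vec)
  qed
  \<comment> \<open>Row \<open>p\<close> of the contribution of the first space at digit vector
    \<open>i\<close>: position one is \<open>idx 0 i\<close>, and positions two and three show the
    same digits, so a diagonal block appears.\<close>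
  define SA where "SA i p q = (\<Sum>l<NA. a l (p, idx 0 i) * GA l (part_digits 0 i) (part_digits 0 i) q)" for i p q
  define SB where "SB i p q = (\<Sum>l<NB. b l (p, idx 1 i) * GB l (part_digits 1 i) (part_digits 1 i) q)" for i p q
  define SC where "SC i p q = (\<Sum>l<NC. c l (p, idx 2 i) * GC l (part_digits 2 i) (part_digits 2 i) q)" for i p q
  \<comment> \<open>Only the finitely many rows in \<open>PA\<close>, \<open>PB\<close>,
    \<open>PC\<close> are tested; they determine all other rows.\<close>
  define Bad where "Bad \<kappa> i \<longleftrightarrow>
      (fst \<kappa> = 0 \<and> (\<exists>p\<in>PA. (\<Sum>q\<in>QA. \<theta>A (snd \<kappa>) q * SA i p q) \<noteq> 0)) \<or>
      (fst \<kappa> = 1 \<and> (\<exists>p\<in>PB. (\<Sum>q\<in>QB. \<theta>B (snd \<kappa>) q * SB i p q) \<noteq> 0)) \<or>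
      (fst \<kappa> = 2 \<and> (\<exists>p\<in>PC. (\<Sum>q\<in>QC. \<theta>C (snd \<kappa>) q * SC i p q) \<noteq> 0))" for \<kappa> :: "nat \<times> nat" and i
  have "\<exists>i\<in>?E. \<forall>\<kappa>\<in>K. \<not> Bad \<kappa> i"
  proof (rule exists_avoiding[OF finK _ n])
    fix \<kappa> i assume \<kappa>: "\<kappa> \<in> K" and i: "i \<in> ?E"
    obtain \<tau> s where \<kappa>_eq: "\<kappa> = (\<tau>, s)" by (cases \<kappa>)
    let ?i = "\<lambda>j. i((\<tau>, s) := j)"
    have iE: "?i j \<in> ?E" if "j < n" for j using upd[OF i \<kappa> that] by (simp add: \<kappa>_eq)
    have idx_eq: "idx \<tau> (?i j) = idx \<tau> i" for j using \<kappa> idx_upd unfolding \<kappa>_eq by blast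
    consider (A) "\<tau> = 0" "s < kA" | (B) "\<tau> = 1" "s < kB" | (C) "\<tau> = 2" "s < kC"
      using \<kappa> unfolding \<kappa>_eq K by auto
    then show "card {j. j < n \<and> Bad \<kappa> (i(\<kappa> := j))} \<le> card PA * (card QA * r + 3)
      + card PB * (card QB * r + 3) + card PC * (card QC * r + 3)"
    proof cases
      case A
      \<comment> \<open>The first position stays at \<open>idx 0 i\<close>, \<open>j\<close> enters
        through the second and \<open>k\<close> through the third. The second space sees only
        unchanged digits at positions one and three, so its part depends on \<open>j\<close> alone,
        through \<open>b\<close>. In the same way the part of the third space depends on
        \<open>k\<close> alone.\<close>
      have "card {j. j < n \<and> (\<exists>p\<in>PA. (\<Sum>q\<in>QA. \<theta>A s q * (\<Sum>l<NA. a l (p, idx \<tau> i)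
          * GA l (part_digits \<tau> (?i j)) (part_digits \<tau> (?i j)) q)) \<noteq> 0)}
        \<le> card PA * (card QA * r + 3)"
      proof (rule line_card[OF PA(1) QA(1), where
            a = "\<lambda>l p. a l (p, idx \<tau> i)" and G = "\<lambda>l j k. GA l (part_digits \<tau> (?i j)) (part_digits \<tau> (?i k))"
            and t = "\<lambda>i' p q. T (i', p, q)"
            and g = "\<lambda>i' p q j. \<Sum>l<NB. b l (p, idx 1 (?i j)) * GB l (part_digits 1 i) (part_digits 1 i) (i', q)"
            and h = "\<lambda>i' p q k. \<Sum>l<NC. c l (q, idx 2 (?i k)) * GC l (part_digits 2 i) (part_digits 2 i) (i', p)"
            and \<alpha> = "\<lambda>l p. \<alpha> l (p, idx \<tau> i)" and \<beta> = "\<lambda>l p j. \<beta> l (p, idx 1 (?i j))"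
            and \<gamma> = "\<lambda>l q k. \<gamma> l (q, idx 2 (?i k))"])
        fix i' j k p q assume jk: "j < n" "k < n"
        show "(\<Sum>l<NA. a l (i', idx \<tau> i) * GA l (part_digits \<tau> (?i j)) (part_digits \<tau> (?i k)) (p, q))
            + T (i', p, q)
            + (\<Sum>l<NB. b l (p, idx 1 (?i j)) * GB l (part_digits 1 i) (part_digits 1 i) (i', q))
            + (\<Sum>l<NC. c l (q, idx 2 (?i k)) * GC l (part_digits 2 i) (part_digits 2 i) (i', p))
            = (\<Sum>l<r. \<alpha> l (i', idx \<tau> i) * \<beta> l (p, idx 1 (?i j)) * \<gamma> l (q, idx 2 (?i k)))"
          using beq[OF idx(1)[OF i] idx(1)[OF iE[OF jk(1)]] idx(1)[OF iE[OF jk(2)]], of i' p q 0 1 2]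
          by (simp add: idx(2)[OF i] idx(2)[OF iE[OF jk(1)], unfolded A(1)] idx(2)[OF iE[OF jk(2)], unfolded A(1)] part_digits_upd A
              add_ac)
      next
        fix l j k assume "l < NA" "j < k" "k < n"
        then show "(\<Sum>q\<in>QA. \<theta>A s q * GA l (part_digits \<tau> (?i j)) (part_digits \<tau> (?i k)) q) = 0"
          using GA A step_at_part_digits[of j k 0 s i] unfolding allowed_blocks_def by auto
      qed
      moreover have "Bad \<kappa> (i(\<kappa> := j)) \<longleftrightarrow> (\<exists>p\<in>PA. (\<Sum>q\<in>QA. \<theta>A s q * (\<Sum>l<NA. a l (p, idx \<tau> i)
          * GA l (part_digits \<tau> (?i j)) (part_digits \<tau> (?i j)) q)) \<noteq> 0)" for j
        using idx_eq[of j] by (simp add: Bad_def SA_def \<kappa>_eq A)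
      ultimately show ?thesis by simp
    next
      case B
      \<comment> \<open>Now the second position is fixed, and the first and third carry
        \<open>j\<close> and \<open>k\<close>.\<close>
      have "card {j. j < n \<and> (\<exists>p\<in>PB. (\<Sum>q\<in>QB. \<theta>B s q * (\<Sum>l<NB. b l (p, idx \<tau> i)
          * GB l (part_digits \<tau> (?i j)) (part_digits \<tau> (?i j)) q)) \<noteq> 0)}
        \<le> card PB * (card QB * r + 3)"
      proof (rule line_card[OF PB(1) QB(1), where
            a = "\<lambda>l p. b l (p, idx \<tau> i)" and G = "\<lambda>l j k. GB l (part_digits \<tau> (?i j)) (part_digits \<tau> (?i k))"
            and t = "\<lambda>i' p q. T (p, i', q)"
            and g = "\<lambda>i' p q j. \<Sum>l<NA. a l (p, idx 0 (?i j)) * GA l (part_digits 0 i) (part_digits 0 i) (i', q)"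
            and h = "\<lambda>i' p q k. \<Sum>l<NC. c l (q, idx 2 (?i k)) * GC l (part_digits 2 i) (part_digits 2 i) (p, i')"
            and \<alpha> = "\<lambda>l p. \<beta> l (p, idx \<tau> i)" and \<beta> = "\<lambda>l p j. \<alpha> l (p, idx 0 (?i j))"
            and \<gamma> = "\<lambda>l q k. \<gamma> l (q, idx 2 (?i k))"])
        fix i' j k p q assume jk: "j < n" "k < n"
        show "(\<Sum>l<NB. b l (i', idx \<tau> i) * GB l (part_digits \<tau> (?i j)) (part_digits \<tau> (?i k)) (p, q))
            + T (p, i', q)
            + (\<Sum>l<NA. a l (p, idx 0 (?i j)) * GA l (part_digits 0 i) (part_digits 0 i) (i', q))
            + (\<Sum>l<NC. c l (q, idx 2 (?i k)) * GC l (part_digits 2 i) (part_digits 2 i) (p, i'))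
            = (\<Sum>l<r. \<beta> l (i', idx \<tau> i) * \<alpha> l (p, idx 0 (?i j)) * \<gamma> l (q, idx 2 (?i k)))"
          using beq[OF idx(1)[OF iE[OF jk(1)]] idx(1)[OF i] idx(1)[OF iE[OF jk(2)]], of p i' q 0 1 2]
          by (simp add: idx(2)[OF i] idx(2)[OF iE[OF jk(1)], unfolded B(1) One_nat_def] idx(2)[OF iE[OF jk(2)], unfolded B(1) One_nat_def] part_digits_upd B
              ac_simps)
      next
        fix l j k assume "l < NB" "j < k" "k < n"
        then show "(\<Sum>q\<in>QB. \<theta>B s q * GB l (part_digits \<tau> (?i j)) (part_digits \<tau> (?i k)) q) = 0"
          using GB B step_at_part_digits[of j k 1 s i] unfolding allowed_blocks_def by auto
      qed
      moreover have "Bad \<kappa> (i(\<kappa> := j)) \<longleftrightarrow> (\<exists>p\<in>PB. (\<Sum>q\<in>QB. \<theta>B s q * (\<Sum>l<NB. b l (p, idx \<tau> i)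
          * GB l (part_digits \<tau> (?i j)) (part_digits \<tau> (?i j)) q)) \<noteq> 0)" for j
        using idx_eq[of j] by (simp add: Bad_def SB_def \<kappa>_eq B)
      ultimately show ?thesis by simp
    next
      case C
      \<comment> \<open>Now the third position is fixed, and the first and second carry
        \<open>j\<close> and \<open>k\<close>.\<close>
      have "card {j. j < n \<and> (\<exists>p\<in>PC. (\<Sum>q\<in>QC. \<theta>C s q * (\<Sum>l<NC. c l (p, idx \<tau> i)
          * GC l (part_digits \<tau> (?i j)) (part_digits \<tau> (?i j)) q)) \<noteq> 0)}
        \<le> card PC * (card QC * r + 3)"
      proof (rule line_card[OF PC(1) QC(1), where
            a = "\<lambda>l p. c l (p, idx \<tau> i)" and G = "\<lambda>l j k. GC l (part_digits \<tau> (?i j)) (part_digits \<tau> (?i k))"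
            and t = "\<lambda>i' p q. T (p, q, i')"
            and g = "\<lambda>i' p q j. \<Sum>l<NA. a l (p, idx 0 (?i j)) * GA l (part_digits 0 i) (part_digits 0 i) (q, i')"
            and h = "\<lambda>i' p q k. \<Sum>l<NB. b l (q, idx 1 (?i k)) * GB l (part_digits 1 i) (part_digits 1 i) (p, i')"
            and \<alpha> = "\<lambda>l p. \<gamma> l (p, idx \<tau> i)" and \<beta> = "\<lambda>l p j. \<alpha> l (p, idx 0 (?i j))"
            and \<gamma> = "\<lambda>l q k. \<beta> l (q, idx 1 (?i k))"])
        fix i' j k p q assume jk: "j < n" "k < n"
        show "(\<Sum>l<NC. c l (i', idx \<tau> i) * GC l (part_digits \<tau> (?i j)) (part_digits \<tau> (?i k)) (p, q))
            + T (p, q, i')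
            + (\<Sum>l<NA. a l (p, idx 0 (?i j)) * GA l (part_digits 0 i) (part_digits 0 i) (q, i'))
            + (\<Sum>l<NB. b l (q, idx 1 (?i k)) * GB l (part_digits 1 i) (part_digits 1 i) (p, i'))
            = (\<Sum>l<r. \<gamma> l (i', idx \<tau> i) * \<alpha> l (p, idx 0 (?i j)) * \<beta> l (q, idx 1 (?i k)))"
          using beq[OF idx(1)[OF iE[OF jk(1)]] idx(1)[OF iE[OF jk(2)]] idx(1)[OF i], of p q i' 0 1 2]
          by (simp add: idx(2)[OF i] idx(2)[OF iE[OF jk(1)], unfolded C(1)] idx(2)[OF iE[OF jk(2)], unfolded C(1)] part_digits_upd C
              ac_simps)
      next
        fix l j k assume "l < NC" "j < k" "k < n"
        then show "(\<Sum>q\<in>QC. \<theta>C s q * GC l (part_digits \<tau> (?i j)) (part_digits \<tau> (?i k)) q) = 0"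
          using GC C step_at_part_digits[of j k 2 s i] unfolding allowed_blocks_def by auto
      qed
      moreover have "Bad \<kappa> (i(\<kappa> := j)) \<longleftrightarrow> (\<exists>p\<in>PC. (\<Sum>q\<in>QC. \<theta>C s q * (\<Sum>l<NC. c l (p, idx \<tau> i)
          * GC l (part_digits \<tau> (?i j)) (part_digits \<tau> (?i j)) q)) \<noteq> 0)" for j
        using idx_eq[of j] by (simp add: Bad_def SC_def \<kappa>_eq C)
      ultimately show ?thesis by simp
    qed
  qed
  then obtain i where i: "i \<in> ?E" and good: "\<forall>\<kappa>\<in>K. \<not> Bad \<kappa> i" by blast
  have S_in: "(\<lambda>q. \<Sum>l<N. f l * G l q) \<in> U" if "cfun.subspace U" "\<forall>l<N. G l \<in> U"
    for N :: nat and f and G :: "nat \<Rightarrow> 'z \<Rightarrow> complex" and U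
  proof -
    have "(\<lambda>q. \<Sum>l<N. f l * G l q) = (\<Sum>l<N. cscale (f l) (G l))"
      by (simp add: fun_eq_iff sum_fun_apply cscale_apply)
    also have "\<dots> \<in> U" using that by (intro cfun.subspace_sum cfun.subspace_scale) auto
    finally show ?thesis .
  qed
  have SA: "SA i p \<in> WA" if "p \<in> PA" for p
  proof -
    have "SA i p \<in> tprod2 B C"
      unfolding SA_def using GA by (intro S_in subspace_tprod2) (auto simp: allowed_blocks_def)
    moreover have "(\<Sum>q\<in>QA. \<theta>A s q * SA i p q) = 0" if "s < kA" for s
      using bspec[OF good, of "(0, s)"] \<open>p \<in> PA\<close> that by (simp add: K Bad_def)
    ultimately show ?thesis using QA(2) by blast
  qed
  have SB: "SB i p \<in> WB" if "p \<in> PB" for p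
  proof -
    have "SB i p \<in> tprod2 A C"
      unfolding SB_def using GB by (intro S_in subspace_tprod2) (auto simp: allowed_blocks_def)
    moreover have "(\<Sum>q\<in>QB. \<theta>B s q * SB i p q) = 0" if "s < kB" for s
      using bspec[OF good, of "(1, s)"] \<open>p \<in> PB\<close> that by (simp add: K Bad_def)
    ultimately show ?thesis using QB(2) by blast
  qed
  have SC: "SC i p \<in> WC" if "p \<in> PC" for p
  proof -
    have "SC i p \<in> tprod2 A B"
      unfolding SC_def using GC by (intro S_in subspace_tprod2) (auto simp: allowed_blocks_def)
    moreover have "(\<Sum>q\<in>QC. \<theta>C s q * SC i p q) = 0" if "s < kC" for s
      using bspec[OF good, of "(2, s)"] \<open>p \<in> PC\<close> that by (simp add: K Bad_def)
    ultimately show ?thesis using QC(2) by blast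
  qed
  \<comment> \<open>The rows at the points \<open>PA\<close> recover the whole contribution, which
    thereby becomes a sum of terms with one factor \<open>eA p\<close> in \<open>A\<close> and the
    other in \<open>WA\<close>.\<close>
  have rA: "(\<Sum>p\<in>PA. eA p t * SA i p q)
      = (\<Sum>l<NA. a l (t, idx 0 i) * GA l (part_digits 0 i) (part_digits 0 i) q)" for t q
    unfolding SA_def
    by (rule sum_expand_points[where f = "\<lambda>l p. a l (p, idx 0 i)"], rule PA(3), rule tprod2_slice[OF sub(1)])
      (use mA in blast)
  have rB: "(\<Sum>p\<in>PB. eB p t * SB i p q)
      = (\<Sum>l<NB. b l (t, idx 1 i) * GB l (part_digits 1 i) (part_digits 1 i) q)" for t q
    unfolding SB_def
    by (rule sum_expand_points[where f = "\<lambda>l p. b l (p, idx 1 i)"], rule PB(3), rule tprod2_slice[OF sub(2)])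
      (use mB in blast)
  have rC: "(\<Sum>p\<in>PC. eC p t * SC i p q)
      = (\<Sum>l<NC. c l (t, idx 2 i) * GC l (part_digits 2 i) (part_digits 2 i) q)" for t q
    unfolding SC_def
    by (rule sum_expand_points[where f = "\<lambda>l p. c l (p, idx 2 i)"], rule PC(3), rule tprod2_slice[OF sub(3)])
      (use mC in blast)
  \<comment> \<open>The block of the decomposition at positions \<open>idx 0 i\<close>,
    \<open>idx 1 i\<close>, \<open>idx 2 i\<close>, where all three spaces contribute their diagonal
    blocks for \<open>i\<close>.\<close>
  define T' where "T' = (\<lambda>(p, q, s). \<Sum>l<r. \<alpha> l (p, idx 0 i) * \<beta> l (q, idx 1 i) * \<gamma> l (s, idx 2 i))"
  have "rank_le A B C (card {..<r}) T'"
  proof (rule rank_leI[where a = "\<lambda>l p. \<alpha> l (p, idx 0 i)" and b = "\<lambda>l p. \<beta> l (p, idx 1 i)"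
        and c = "\<lambda>l p. \<gamma> l (p, idx 2 i)"])
    show "(\<lambda>p. \<alpha> l (p, idx 0 i)) \<in> A \<and> (\<lambda>p. \<beta> l (p, idx 1 i)) \<in> B \<and> (\<lambda>p. \<gamma> l (p, idx 2 i)) \<in> C"
      if "l \<in> {..<r}" for l
      using abc that tprod2_slice sub by (metis lessThan_iff)
  qed (simp_all add: T'_def)
  then have "rank_le A B C r T'" by simp
  then show ?thesis
  proof (rule mod_rank_leI[OF _ PA(1) PB(1) PC(1), where a = eA and b = eB and c = eC
        and u = "SA i" and v = "SB i" and w = "SC i"])
    show "T' (p, q, s) = T (p, q, s) + (\<Sum>l\<in>PA. eA l p * SA i l (q, s))
        + (\<Sum>l\<in>PB. eB l q * SB i l (p, s)) + (\<Sum>l\<in>PC. eC l s * SC i l (p, q))" for p q s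
      using beq[OF idx(1)[OF i] idx(1)[OF i] idx(1)[OF i], of p q s 0 1 2]
      by (simp add: T'_def rA rB rC idx(2)[OF i])
  qed (use PA PB PC SA SB SC in auto)
qed

section \<open>The upper bound for modifications of clones\<close>

text \<open>A decomposition of a modification of \<open>T\<close> is cloned term by term; clones of
  elements of the \<open>W\<close> spaces are admissible by hypothesis.\<close>

lemma clone_mod_rank_le:
  fixes A :: "('i \<Rightarrow> complex) set" and B :: "('j \<Rightarrow> complex) set" and C :: "('k \<Rightarrow> complex) set"
    and V :: "('v \<Rightarrow> complex) set"
  assumes rk: "mod_rank_le A B C T WA WB WC r" and S: "\<Sum>\<Sigma> \<in> V"
    and WA: "\<And>u. u \<in> WA \<Longrightarrow> clone2 \<Sigma> u \<in> MA" and WB: "\<And>u. u \<in> WB \<Longrightarrow> clone2 \<Sigma> u \<in> MB"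
    and WC: "\<And>u. u \<in> WC \<Longrightarrow> clone2 \<Sigma> u \<in> MC"
  shows "mod_rank_le (tprod2 A V) (tprod2 B V) (tprod2 C V) (clone3 \<Sigma> T) MA MB MC r"
proof -
  obtain \<alpha> \<beta> \<gamma> p a u q b v s c w where
    abc: "\<forall>l<r. \<alpha> l \<in> A \<and> \<beta> l \<in> B \<and> \<gamma> l \<in> C"
    and m: "\<forall>l<p. a l \<in> A \<and> u l \<in> WA" "\<forall>l<q. b l \<in> B \<and> v l \<in> WB" "\<forall>l<s. c l \<in> C \<and> w l \<in> WC"
    and eq: "\<forall>i j k. T (i, j, k) + (\<Sum>l<(p::nat). a l i * u l (j, k)) + (\<Sum>l<(q::nat). b l j * v l (i, k))
      + (\<Sum>l<(s::nat). c l k * w l (i, j)) = (\<Sum>l<r. \<alpha> l i * \<beta> l j * \<gamma> l k)"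
    by (rule mod_rank_leE[OF rk]) (rule that)
  let ?S = "\<Sum>\<Sigma>"
  define T' where "T' = (\<lambda>(i, j, k). \<Sum>l<r. tensor2 (\<alpha> l) ?S i * tensor2 (\<beta> l) ?S j * tensor2 (\<gamma> l) ?S k)"
  have "rank_le (tprod2 A V) (tprod2 B V) (tprod2 C V) (card {..<r}) T'"
    by (rule rank_leI[where a = "\<lambda>l. tensor2 (\<alpha> l) ?S" and b = "\<lambda>l. tensor2 (\<beta> l) ?S"
          and c = "\<lambda>l. tensor2 (\<gamma> l) ?S"])
      (use abc S in \<open>auto simp: T'_def intro!: tensor2_in_tprod2\<close>)
  then have "rank_le (tprod2 A V) (tprod2 B V) (tprod2 C V) r T'" by simp
  then show ?thesis
  proof (rule mod_rank_leI[where a = "\<lambda>l. tensor2 (a l) ?S" and b = "\<lambda>l. tensor2 (b l) ?S"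
        and c = "\<lambda>l. tensor2 (c l) ?S" and u = "\<lambda>l. clone2 \<Sigma> (u l)" and v = "\<lambda>l. clone2 \<Sigma> (v l)"
        and w = "\<lambda>l. clone2 \<Sigma> (w l)" and ?S1.0 = "{..<p}" and ?S2.0 = "{..<q}" and ?S3.0 = "{..<s}"])
    fix i :: "'i \<times> 'v" and j :: "'j \<times> 'v" and k :: "'k \<times> 'v"
    obtain i' x j' y k' z where ijk: "i = (i', x)" "j = (j', y)" "k = (k', z)"
      by (metis surj_pair)
    have "T' (i, j, k) = (\<Sum>l<r. \<alpha> l i' * \<beta> l j' * \<gamma> l k') * (?S x * ?S y * ?S z)"
      unfolding sum_distrib_right by (simp add: T'_def ijk tensor2_def mult_ac)
    also have "\<dots> = clone3 \<Sigma> T (i, j, k) + (\<Sum>l<p. tensor2 (a l) ?S i * clone2 \<Sigma> (u l) (j, k))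
       + (\<Sum>l<q. tensor2 (b l) ?S j * clone2 \<Sigma> (v l) (i, k))
       + (\<Sum>l<s. tensor2 (c l) ?S k * clone2 \<Sigma> (w l) (i, j))"
      unfolding eq[rule_format, symmetric] distrib_right sum_distrib_right
      by (simp add: ijk clone3_def clone2_def tensor2_def Let_def mult_ac)
    finally show "T' (i, j, k) = clone3 \<Sigma> T (i, j, k)
       + (\<Sum>l<p. tensor2 (a l) ?S i * clone2 \<Sigma> (u l) (j, k))
       + (\<Sum>l<q. tensor2 (b l) ?S j * clone2 \<Sigma> (v l) (i, k))
       + (\<Sum>l<s. tensor2 (c l) ?S k * clone2 \<Sigma> (w l) (i, j))" .
  qed (use m S WA WB WC in \<open>auto intro: tensor2_in_tprod2\<close>)
qed

section \<open>Choice of the digit range, of \<open>V\<close> and of the three spaces\<close>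

theorem lemma3p1:
  fixes A :: "('a \<Rightarrow> complex) set" and B :: "('b \<Rightarrow> complex) set" and C :: "('c \<Rightarrow> complex) set"
    and WA :: "('b \<times> 'c \<Rightarrow> complex) set" and WB :: "('a \<times> 'c \<Rightarrow> complex) set"
    and WC :: "('a \<times> 'b \<Rightarrow> complex) set"
  assumes "fin_dim_space A" and "fin_dim_space B" and "fin_dim_space C"
    and "cfun.subspace WA" and "WA \<subseteq> tprod2 B C"
    and "cfun.subspace WB" and "WB \<subseteq> tprod2 A C"
    and "cfun.subspace WC" and "WC \<subseteq> tprod2 A B"
  shows "\<exists>(V :: (nat \<Rightarrow> complex) set) \<Sigma> MA MB MC.
    finite \<Sigma> \<and> cfun.independent \<Sigma> \<and> cfun.span \<Sigma> = V \<and>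
    cfun.subspace MA \<and> MA \<subseteq> tprod2 (tprod2 B V) (tprod2 C V) \<and>
    cfun.subspace MB \<and> MB \<subseteq> tprod2 (tprod2 A V) (tprod2 C V) \<and>
    cfun.subspace MC \<and> MC \<subseteq> tprod2 (tprod2 A V) (tprod2 B V) \<and>
    spanned_by_rank_one (tprod2 B V) (tprod2 C V) MA \<and>
    spanned_by_rank_one (tprod2 A V) (tprod2 C V) MB \<and>
    spanned_by_rank_one (tprod2 A V) (tprod2 B V) MC \<and>
    clone_space1 \<Sigma> WA \<subseteq> MA \<and> clone_space2 \<Sigma> WB \<subseteq> MB \<and> clone_space3 \<Sigma> WC \<subseteq> MC \<and>
    (\<forall>T \<in> tprod3 A B C.
      min_rank_mod (tprod2 A V) (tprod2 B V) (tprod2 C V) (clone3 \<Sigma> T) MA MB MC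
        = min_rank_mod A B C T WA WB WC \<and>
      (\<forall>us vs ws. is_basis_list us MA \<and> is_basis_list vs MB \<and> is_basis_list ws MC \<longrightarrow>
        tensor_rank (dsum (tprod2 A V) (coord_space (cfun.dim MA)))
                    (dsum (tprod2 B V) (coord_space (cfun.dim MB)))
                    (dsum (tprod2 C V) (coord_space (cfun.dim MC)))
                    (augmented (clone3 \<Sigma> T) us vs ws)
          = min_rank_mod A B C T WA WB WC + cfun.dim MA + cfun.dim MB + cfun.dim MC))"
proof -
  note fin = assms(1-3)
  note sub = fin[THEN fin_dim_subspace]
  obtain PA eA where PA: "finite PA" "\<And>p. p \<in> PA \<Longrightarrow> eA p \<in> A"
    "\<And>f i. f \<in> A \<Longrightarrow> f i = (\<Sum>p\<in>PA. f p * eA p i)"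
    by (rule fin_dim_points[OF fin(1)]) (rule that)
  obtain PB eB where PB: "finite PB" "\<And>p. p \<in> PB \<Longrightarrow> eB p \<in> B"
    "\<And>f i. f \<in> B \<Longrightarrow> f i = (\<Sum>p\<in>PB. f p * eB p i)"
    by (rule fin_dim_points[OF fin(2)]) (rule that)
  obtain PC eC where PC: "finite PC" "\<And>p. p \<in> PC \<Longrightarrow> eC p \<in> C"
    "\<And>f i. f \<in> C \<Longrightarrow> f i = (\<Sum>p\<in>PC. f p * eC p i)"
    by (rule fin_dim_points[OF fin(3)]) (rule that)
  note fBC = fin_dim_tprod2[OF fin(2,3)] and fAC = fin_dim_tprod2[OF fin(1,3)]
    and fAB = fin_dim_tprod2[OF fin(1,2)]
  obtain QA kA \<theta>A where QA: "finite QA"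
    "\<And>u. u \<in> tprod2 B C \<Longrightarrow> u \<in> WA \<longleftrightarrow> (\<forall>s<(kA::nat). (\<Sum>q\<in>QA. \<theta>A s q * u q) = 0)"
    by (rule subspace_functionals[OF fBC assms(4,5)]) (rule that)
  obtain QB kB \<theta>B where QB: "finite QB"
    "\<And>u. u \<in> tprod2 A C \<Longrightarrow> u \<in> WB \<longleftrightarrow> (\<forall>s<(kB::nat). (\<Sum>q\<in>QB. \<theta>B s q * u q) = 0)"
    by (rule subspace_functionals[OF fAC assms(6,7)]) (rule that)
  obtain QC kC \<theta>C where QC: "finite QC"
    "\<And>u. u \<in> tprod2 A B \<Longrightarrow> u \<in> WC \<longleftrightarrow> (\<forall>s<(kC::nat). (\<Sum>q\<in>QC. \<theta>C s q * u q) = 0)"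
    by (rule subspace_functionals[OF fAB assms(8,9)]) (rule that)
  define K :: "(nat \<times> nat) set" where "K = {0} \<times> {..<kA} \<union> {1} \<times> {..<kB} \<union> {2} \<times> {..<kC}"
  \<comment> \<open>\<open>N\<close> bounds the rank of every tensor in the product of
    \<open>A\<close>, \<open>B\<close> and \<open>C\<close>. Using it in place of \<open>r\<close>
    in \<open>n\<close> makes one \<open>V\<close> serve all \<open>T\<close>.\<close>
  define N where "N = card (PA \<times> PB \<times> PC)"
  define n where "n = Suc (card K * (card PA * (card QA * N + 3) + card PB * (card QB * N + 3)
      + card PC * (card QC * N + 3)))"
  define E where "E = PiE K (\<lambda>_. {..<n})"
  define m where "m = card E"
  have "finite E" unfolding E_def K_def by (intro finite_PiE) auto
  \<comment> \<open>Basis vector number \<open>x\<close> of \<open>V\<close> carries the digit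
    vector \<open>D x\<close>.\<close>
  then obtain D where D: "bij_betw D {..<m} E"
    using ex_bij_betw_nat_finite[of E] by (auto simp: m_def atLeast0LessThan)
  define \<Sigma> where "\<Sigma> = unit_vec ` {..<m}"
  define V where "V = coord_space m"
  define MA where "MA = block_space m (\<lambda>x. part_digits 0 (D x)) (allowed_blocks B C QA \<theta>A kA 0)"
  define MB where "MB = block_space m (\<lambda>x. part_digits 1 (D x)) (allowed_blocks A C QB \<theta>B kB 1)"
  define MC where "MC = block_space m (\<lambda>x. part_digits 2 (D x)) (allowed_blocks A B QC \<theta>C kC 2)"
  have S: "\<Sum>\<Sigma> \<in> V" by (simp add: \<Sigma>_def V_def coord_space_def sum_unit_vec)
  have subM: "cfun.subspace MA" "cfun.subspace MB" "cfun.subspace MC"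
    unfolding MA_def MB_def MC_def by (rule subspace_block_space, rule subspace_allowed_blocks)+
  have r1: "spanned_by_rank_one (tprod2 B V) (tprod2 C V) MA"
    "spanned_by_rank_one (tprod2 A V) (tprod2 C V) MB"
    "spanned_by_rank_one (tprod2 A V) (tprod2 B V) MC"
    unfolding MA_def MB_def MC_def V_def
    by (rule rank_one_block_space, rule subspace_allowed_blocks, rule allowed_blocks_span, rule sub, rule sub)+
  note Msub = r1[THEN spanned_by_rank_one_subset]
  \<comment> \<open>Elements of \<open>WA\<close> are killed by all its functionals, hence
    admissible in every block; likewise for the other two spaces.\<close>
  have cA: "clone2 \<Sigma> u \<in> MA" if "u \<in> WA" for u
    unfolding MA_def \<Sigma>_def using QA(2)[of u] assms(5) that
    by (intro clone2_in_block_space) (auto simp: allowed_blocks_def)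
  have cB: "clone2 \<Sigma> u \<in> MB" if "u \<in> WB" for u
    unfolding MB_def \<Sigma>_def using QB(2)[of u] assms(7) that
    by (intro clone2_in_block_space) (auto simp: allowed_blocks_def)
  have cC: "clone2 \<Sigma> u \<in> MC" if "u \<in> WC" for u
    unfolding MC_def \<Sigma>_def using QC(2)[of u] assms(9) that
    by (intro clone2_in_block_space) (auto simp: allowed_blocks_def)
  have csp: "clone_space1 \<Sigma> WA \<subseteq> MA" "clone_space2 \<Sigma> WB \<subseteq> MB" "clone_space3 \<Sigma> WC \<subseteq> MC"
    unfolding clone_space_eq_image(1)[OF subspace_fin_dim[OF fBC assms(4,5)]]
      clone_space_eq_image(2)[OF subspace_fin_dim[OF fAC assms(6,7)]]
      clone_space_eq_image(3)[OF subspace_fin_dim[OF fAB assms(8,9)]]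
    using cA cB cC by blast+
  note T' = clone3_in_tprod3[OF _ S]
  note min = min_rank_mod_eq[OF sub(1) _ assms(5,7,9)]
    and min' = min_rank_mod_eq[OF subspace_tprod2 T' Msub]
  have main: "min_rank_mod (tprod2 A V) (tprod2 B V) (tprod2 C V) (clone3 \<Sigma> T) MA MB MC
      = min_rank_mod A B C T WA WB WC" if T: "T \<in> tprod3 A B C" for T
    unfolding min'(1)[OF T]
  proof (rule Least_equality)
    show "mod_rank_le (tprod2 A V) (tprod2 B V) (tprod2 C V) (clone3 \<Sigma> T) MA MB MC
        (min_rank_mod A B C T WA WB WC)"
      by (rule clone_mod_rank_le[OF min(2)[OF T] S cA cB cC])
    fix r assume r: "mod_rank_le (tprod2 A V) (tprod2 B V) (tprod2 C V) (clone3 \<Sigma> T) MA MB MC r"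
    have "rank_le A B C N T"
      unfolding N_def
      by (rule tprod3_points_rank_le[OF T PA(1) _ _ PB(1) _ _ PC(1) _ _ sub(1)]) (fact PA PB PC)+
    then have "mod_rank_le A B C T WA WB WC N"
      by (rule mod_rank_leI[where ?S1.0 = "{} :: nat set" and ?S2.0 = "{} :: nat set" and ?S3.0 = "{} :: nat set"])
        simp_all
    then have le_N: "min_rank_mod A B C T WA WB WC \<le> N"
      unfolding min(1)[OF T] by (rule Least_le)
    show "min_rank_mod A B C T WA WB WC \<le> r"
    \<comment> \<open>For \<open>r\<close> up to \<open>N\<close> the digit range is large enough
      for the union bound; beyond \<open>N\<close> the trivial bound suffices.\<close>
    proof (cases "r \<le> N")
      case True
      have "card PA * (card QA * r + 3) + card PB * (card QB * r + 3) + card PC * (card QC * r + 3)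
          \<le> card PA * (card QA * N + 3) + card PB * (card QB * N + 3) + card PC * (card QC * N + 3)"
        using True by (intro add_mono mult_le_mono order.refl)
      then have "card K * (card PA * (card QA * r + 3) + card PB * (card QB * r + 3)
          + card PC * (card QC * r + 3)) < n"
        unfolding n_def less_Suc_eq_le by (rule mult_le_mono2)
      then have "mod_rank_le A B C T WA WB WC r"
        by (rule block_mod_rank_le[OF fin PA(1) _ _ PB(1) _ _ PC(1) _ _ QA(1) _ QB(1) _ QC(1) _
              K_def D[unfolded E_def] _ r[unfolded MA_def MB_def MC_def \<Sigma>_def], rotated -1])
          (fact PA PB PC QA QB QC)+
      then show ?thesis unfolding min(1)[OF T] by (rule Least_le)
    qed (use le_N in simp)
  qed
  have aug: "tensor_rank (dsum (tprod2 A V) (coord_space (cfun.dim MA)))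
      (dsum (tprod2 B V) (coord_space (cfun.dim MB))) (dsum (tprod2 C V) (coord_space (cfun.dim MC)))
      (augmented (clone3 \<Sigma> T) us vs ws)
      = min_rank_mod A B C T WA WB WC + cfun.dim MA + cfun.dim MB + cfun.dim MC"
    if T: "T \<in> tprod3 A B C" and us: "is_basis_list us MA" and vs: "is_basis_list vs MB"
      and ws: "is_basis_list ws MC" for T us vs ws
    \<comment> \<open>Dimensions become basis lengths, and the minimal rank for \<open>T\<close>
      becomes that for its clone, to which the two bounds on augmented tensors refer.\<close>
    unfolding tensor_rank_eq basis_list_length[OF us] basis_list_length[OF vs] basis_list_length[OF ws]
      main[OF T, symmetric]
  proof (rule Least_equality)
    let ?r = "min_rank_mod (tprod2 A V) (tprod2 B V) (tprod2 C V) (clone3 \<Sigma> T) MA MB MC"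
    show "rank_le (dsum (tprod2 A V) (coord_space (length us))) (dsum (tprod2 B V) (coord_space (length vs)))
      (dsum (tprod2 C V) (coord_space (length ws))) (?r + length us + length vs + length ws)
      (augmented (clone3 \<Sigma> T) us vs ws)"
      by (rule augmented_rank_le[OF subspace_tprod2 subspace_tprod2 subspace_tprod2
            r1(1) us r1(2) vs r1(3) ws min'(2)[OF T]])
    fix R assume "rank_le (dsum (tprod2 A V) (coord_space (length us)))
      (dsum (tprod2 B V) (coord_space (length vs))) (dsum (tprod2 C V) (coord_space (length ws))) R
      (augmented (clone3 \<Sigma> T) us vs ws)"
    from augmented_rank_ge[OF subspace_tprod2 subspace_tprod2 subspace_tprod2 us vs ws this]
    obtain r where R: "R = r + length us + length vs + length ws"
      and r: "mod_rank_le (tprod2 A V) (tprod2 B V) (tprod2 C V) (clone3 \<Sigma> T) MA MB MC r" .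
    have "?r \<le> r" unfolding min'(1)[OF T] using r by (rule Least_le)
    then show "?r + length us + length vs + length ws \<le> R" by (simp add: R)
  qed
  have "finite \<Sigma>" "cfun.independent \<Sigma>" "cfun.span \<Sigma> = V"
    by (simp_all add: \<Sigma>_def V_def independent_unit_vec span_unit_vec)
  then show ?thesis
    using subM Msub r1 csp main aug by (intro exI[of _ V] exI[of _ \<Sigma>] exI[of _ MA] exI[of _ MB] exI[of _ MC]) blast
qed

end
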